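(* Let $X$ be a stationary marked point process on $\mathbb E=\mathbb R^d\times(0,\infty)$ of finite intensity which admits a tail configuration $Y$ with respect to a scaling function $r$ that is regularly varying at infinity. Then for every measurable $h:\mathbb R^d\times\mathcal N\to[0,\infty)$, $$\mathbf E\Big[\sum_{(t,s)\in Y}h(t,Y)\,\boldsymbol 1\{s>1\}\Big]=\mathbf E\Big[\sum_{(t,s)\in Y}h(-t,\varphi_tY)\,\boldsymbol 1\{s>1\}\Big].$$
   Context: $\mathbb E=\mathbb R^d\times(0,\infty)$; for $(t,s)\in\mathbb E$, $t$ is the position and $s$ the score. A counting measure is a Borel measure on $\mathbb E$ with values in $\{0,1,2,\dots\}\cup\{\infty\}$; it is simple if $\mu(\{t\}\times(0,\infty))\le1$ for all $t\in\mathbb R^d$. Such measures are identified with their sets of atoms, $\mu=\sum_{(t,s)\in\mu}\delta_{(t,s)}$, and $\mu(t):=s$ if $(t,s)\in\mu$. $\mathcal B_{11}$ is the family of Borel subsets of $\mathbb E$ contained in $B\times(\varepsilon,\infty)$ for some bounded $B\subset\mathbb R^d$ and $\varepsilon>0$; $\mathcal N=\mathcal N_{11}$ is the set of simple counting measures finite on $\mathcal B_{11}$; $\mathcal N_{10}\subset\mathcal N$ is the set of simple counting measures finite on $B\times(0,\infty)$ for all bounded Borel $B$. The $\mathcal B_{11}$-vague topology on $\mathcal N$ is the smallest one making $\mu\mapsto\int f\,d\mu$ continuous for all bounded continuous $f:\mathbb E\to\mathbb R$ with support in a set of $\mathcal B_{11}$; the $\sigma$-algebra is generated by the maps $\mu\mapsto\mu(B)$,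 $B$ Borel. Shifts: $\varphi_z\mu=\sum_{(t,s)\in\mu}\delta_{(t-z,s)}$. Scalings: $T_{v,u}\mu=\sum_{(t,s)\in\mu}\delta_{(t/v,s/u)}$, $u,v>0$. A marked point process is a random element $X$ of $\mathcal N_{10}$; it is stationary if $\varphi_zX\stackrel d=X$ for all $z\in\mathbb R^d$, and it has intensity $\lambda$ if the expected number of points with positions in $A$ is $\lambda$ times the Lebesgue measure of $A$. Its Palm version $\widetilde X$ is the marked point process with $\mathbf E[\sum_{(t,s)\in X}h(t,\varphi_tX)]=\lambda\int_{\mathbb R^d}\mathbf E[h(t,\widetilde X)]\,dt$ for all measurable $h:\mathbb R^d\times\mathcal N_{10}\to[0,\infty)$; almost surely it has a point at position $0$, with score $\xi:=\widetilde X(0)$. Let $r:(0,\infty)\to(0,\infty)$ be regularly varying at infinity (with some index $\beta\in\mathbb R$). A random element $Y$ of $\mathcal N$ with $Y(\{0\}\times(1,\infty))=1$ a.s. is the tail configuration of $X$ (with respect to $r$) if $\mathbf P(T_{r(u),u}\widetilde X\in\cdot\mid\xi>u)$ converges weakly to $\mathbf P(Y\in\cdot)$ as $u\to\infty$ with respect to the $\mathcal B_{11}$-vague topology. *)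

theory Defs
  imports "HOL-Probability.Probability"
begin

section \<open>Counting measures on position-score space\<close>

type_synonym 'd point = "(real ^ 'd) \<times> real"

definition EE :: "('d::finite) point set" where
  "EE = UNIV \<times> {0<..}"

definition borel_EE :: "('d::finite) point measure" where
  "borel_EE = restrict_space borel EE"

definition counting_measure :: "('d::finite) point measure \<Rightarrow> bool" where
  "counting_measure \<mu> \<longleftrightarrow> sets \<mu> = sets borel_EE \<and>
     (\<forall>A\<in>sets borel_EE. emeasure \<mu> A = \<infinity> \<or> (\<exists>n::nat. emeasure \<mu> A = of_nat n))"

definition simple_counting_measure :: "('d::finite) point measure \<Rightarrow> bool" where
  "simple_counting_measure \<mu> \<longleftrightarrow>
     counting_measure \<mu> \<and> (\<forall>t. emeasure \<mu> ({t} \<times> {0<..}) \<le> 1)"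

definition B11 :: "('d::finite) point set set" where
  "B11 = {A \<in> sets borel_EE. \<exists>B \<epsilon>. bounded B \<and> 0 < \<epsilon> \<and> A \<subseteq> B \<times> {\<epsilon><..}}"

definition N11 :: "('d::finite) point measure set" where
  "N11 = {\<mu>. simple_counting_measure \<mu> \<and> (\<forall>A\<in>B11. emeasure \<mu> A < \<infinity>)}"

definition N10 :: "('d::finite) point measure set" where
  "N10 = {\<mu>. simple_counting_measure \<mu> \<and>
     (\<forall>B\<in>sets borel. bounded B \<longrightarrow> emeasure \<mu> (B \<times> {0<..}) < \<infinity>)}"

definition atoms :: "('d::finite) point measure \<Rightarrow> 'd point set" where
  "atoms \<mu> = {x \<in> EE. emeasure \<mu> {x} \<noteq> 0}"

text \<open>The score $\mu(t)$; an unspecified number if $\mu$ has no point at position $t$.\<close>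

definition score :: "('d::finite) point measure \<Rightarrow> real ^ 'd \<Rightarrow> real" where
  "score \<mu> t = (THE s. (t, s) \<in> atoms \<mu>)"

text \<open>The sum of $f(t,s)$ over the atoms $(t,s)$ of $\mu$.\<close>

definition atom_sum :: "('d::finite) point measure \<Rightarrow> ('d point \<Rightarrow> ennreal) \<Rightarrow> ennreal" where
  "atom_sum \<mu> f = (\<integral>\<^sup>+x. f x \<partial>count_space (atoms \<mu>))"

text \<open>The image of \<^term>\<open>count_space (atoms \<mu>)\<close> under a map $g$ is the sum of the Dirac
  measures at $g(t,s)$ over the atoms $(t,s)$ of $\mu$.\<close>

definition shift_pts :: "real ^ 'd \<Rightarrow> ('d::finite) point measure \<Rightarrow> 'd point measure" where
  "shift_pts z \<mu> = distr (count_space (atoms \<mu>)) borel_EE (\<lambda>(t, s). (t - z, s))"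

definition scaling :: "real \<Rightarrow> real \<Rightarrow> ('d::finite) point measure \<Rightarrow> 'd point measure" where
  "scaling v u \<mu> = distr (count_space (atoms \<mu>)) borel_EE (\<lambda>(t, s). (t /\<^sub>R v, s / u))"

section \<open>Measurable and topological structure\<close>

definition N11_space :: "('d::finite) point measure measure" where
  "N11_space = sigma N11
     {{\<mu> \<in> N11. emeasure \<mu> B \<in> C} | B C. B \<in> sets borel_EE \<and> C \<in> sets borel}"

definition N10_space :: "('d::finite) point measure measure" where
  "N10_space = restrict_space N11_space N10"

definition test_functions :: "(('d::finite) point \<Rightarrow> real) set" where
  "test_functions = {f. continuous_on EE f \<and> bounded (f ` EE) \<and>
     EE \<inter> closure {x \<in> EE. f x \<noteq> 0} \<in> B11}"

definition vague_topology :: "('d::finite) point measure topology" where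
  "vague_topology = topology_generated_by
     {{\<mu> \<in> N11. (\<integral>x. f x \<partial>\<mu>) \<in> U} | f U. f \<in> test_functions \<and> open U}"

definition weakly_converges ::
  "'b topology \<Rightarrow> ('i \<Rightarrow> 'b measure) \<Rightarrow> 'b measure \<Rightarrow> 'i filter \<Rightarrow> bool" where
  "weakly_converges T P P0 G \<longleftrightarrow>
     (\<forall>F. continuous_map T euclideanreal F \<and> bounded (F ` topspace T) \<longrightarrow>
        ((\<lambda>i. \<integral>x. F x \<partial>P i) \<longlongrightarrow> (\<integral>x. F x \<partial>P0)) G)"

section \<open>Marked point processes, Palm versions and tail configurations\<close>

definition marked_point_process ::
  "'w measure \<Rightarrow> ('w \<Rightarrow> ('d::finite) point measure) \<Rightarrow> bool" where
  "marked_point_process M X \<longleftrightarrow> prob_space M \<and> X \<in> M \<rightarrow>\<^sub>M N10_space"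

definition stationary :: "'w measure \<Rightarrow> ('w \<Rightarrow> ('d::finite) point measure) \<Rightarrow> bool" where
  "stationary M X \<longleftrightarrow>
     (\<forall>z. distr M N10_space (\<lambda>\<omega>. shift_pts z (X \<omega>)) = distr M N10_space X)"

definition has_intensity ::
  "'w measure \<Rightarrow> ('w \<Rightarrow> ('d::finite) point measure) \<Rightarrow> real \<Rightarrow> bool" where
  "has_intensity M X lam \<longleftrightarrow>
     (\<forall>A\<in>sets borel. (\<integral>\<^sup>+\<omega>. emeasure (X \<omega>) (A \<times> {0<..}) \<partial>M) = ennreal lam * emeasure lborel A)"

text \<open>\<open>Xt\<close>, defined on its own probability space \<open>P\<close>, is a Palm version of \<open>X\<close>. The identity
  determines the law of \<open>Xt\<close> when \<open>lam > 0\<close>, and says nothing when \<open>lam = 0\<close>.\<close>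

definition palm_version ::
  "'w measure \<Rightarrow> ('w \<Rightarrow> ('d::finite) point measure) \<Rightarrow> real \<Rightarrow>
   'v measure \<Rightarrow> ('v \<Rightarrow> 'd point measure) \<Rightarrow> bool" where
  "palm_version M X lam P Xt \<longleftrightarrow> marked_point_process P Xt \<and>
     (\<forall>h :: (real ^ 'd) \<times> 'd point measure \<Rightarrow> real.
        h \<in> borel_measurable (borel \<Otimes>\<^sub>M N10_space) \<and> (\<forall>t. \<forall>\<mu>\<in>N10. 0 \<le> h (t, \<mu>)) \<longrightarrow>
        (\<integral>\<^sup>+\<omega>. atom_sum (X \<omega>) (\<lambda>(t, s). ennreal (h (t, shift_pts t (X \<omega>)))) \<partial>M) =
        ennreal lam * (\<integral>\<^sup>+t. (\<integral>\<^sup>+\<omega>. ennreal (h (t, Xt \<omega>)) \<partial>P) \<partial>lborel))"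

definition regularly_varying :: "(real \<Rightarrow> real) \<Rightarrow> real \<Rightarrow> bool" where
  "regularly_varying r \<beta> \<longleftrightarrow> (\<forall>u>0. 0 < r u) \<and>
     (\<forall>x>0. ((\<lambda>u. r (u * x) / r u) \<longlongrightarrow> x powr \<beta>) at_top)"

text \<open>Here \<open>Xt\<close> is the Palm version and \<^term>\<open>uniform_measure P {\<omega> \<in> space P. u < score (Xt \<omega>) 0}\<close>
  is $P$ conditioned on $\xi > u$. If that event had probability 0 for large $u$, all integrals on
  the left would eventually vanish and convergence would fail for the constant function 1; so the
  definition forces the conditioning to be meaningful.\<close>

definition tail_configuration ::
  "'v measure \<Rightarrow> ('v \<Rightarrow> ('d::finite) point measure) \<Rightarrow> (real \<Rightarrow> real) \<Rightarrow>
   'q measure \<Rightarrow> ('q \<Rightarrow> 'd point measure) \<Rightarrow> bool" where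
  "tail_configuration P Xt r Q Y \<longleftrightarrow>
     prob_space Q \<and> Y \<in> Q \<rightarrow>\<^sub>M N11_space \<and>
     (AE \<omega> in Q. emeasure (Y \<omega>) ({0} \<times> {1<..}) = 1) \<and>
     weakly_converges vague_topology
       (\<lambda>u. distr (uniform_measure P {\<omega> \<in> space P. u < score (Xt \<omega>) 0}) N11_space
              (\<lambda>\<omega>. scaling (r u) u (Xt \<omega>)))
       (distr Q N11_space Y) at_top"

end

theory Submission
  imports Defs
begin

text \<open>Grouping the pairs of points of \<open>X\<close> by their first or by their second member, the Palm formula
  yields the exchange formula
  $E \sum_{t} k(t, Xt) = E \sum_{t} k(-t, \varphi_t Xt)$, the sums being over the points of \<open>Xt\<close>.
  Applied to a function that vanishes unless the scores at $0$ and at $t$ both exceed $u$, it becomes the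
  claimed identity for the rescaled \<open>Xt\<close> conditioned on its score at $0$ exceeding $u$, with the two
  indicators replaced by $b(Y(0))\, b(s)$ for any $b$ vanishing on $(-\infty, 1]$.
  If $b$ is continuous, no mass is lost at the level $1$, and the identity passes to the limit
  $u \to \infty$ for $h(t, \mu) = a(t) \Psi(\mu)$ with $a$ and $\Psi$ continuous and a cutoff in $\Psi$
  that bounds the number of points involved. Two functionals have to be approximated by vaguely continuous
  ones: $b(Y(0))$, where the simplicity of \<open>Y\<close> excludes a second point close to $0$, and
  $\sum_t a(-t) \Psi(\varphi_t Y)$, where the position $t$ in $\varphi_t$ is discretised by a partition of unity.
  Monotone limits in $b$, $a$ and $\Psi$ and uniqueness of measures give the theorem.\<close>

text \<open>Weak convergence is given only against vaguely continuous functionals. A functional F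
  that is not evidently of this kind is enclosed as |F - H| \<le> D with H and D continuous and the
  integral of D small under the limit law alone; convergence of the integrals of D then controls the
  error before the limit as well.

  The product b(Y(0)) b(s) is what makes the conditioning harmless. Re-centring at the second point
  exchanges the two factors, and b vanishing up to 1 puts the support of both sides inside the event
  that the score at 0 exceeds u, so conditioning divides both by the same probability.

  Two quantities have no uniform bound over configurations: the number of points in a window, which
  multiplies every error, and the Lipschitz constant of a functional under shifts, which is
  proportional to such a number. The first is removed by a cutoff built into the test functionals;
  the second is dominated by a continuous majorant, multiplied by a small mesh width and truncated
  at 1.\<close>

section \<open>Counting measures and their atoms\<close>

lemma EE_open: "open (EE :: ('d::finite) point set)"
  unfolding EE_def by (intro open_Times) auto

lemma EE_borel: "(EE :: ('d::finite) point set) \<in> sets borel"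
  by (intro borel_open EE_open)

lemma space_borel_EE [simp]: "space (borel_EE :: ('d::finite) point measure) = EE"
  by (simp add: borel_EE_def space_restrict_space)

lemma sets_borel_EE: "A \<in> sets (borel_EE :: ('d::finite) point measure) \<longleftrightarrow> A \<in> sets borel \<and> A \<subseteq> EE"
  unfolding borel_EE_def using EE_borel by (subst sets_restrict_space_iff) auto

lemma EE_sets [measurable]: "(EE :: ('d::finite) point set) \<in> sets borel_EE"
  by (simp add: sets_borel_EE EE_borel)

lemma measurable_EE: "f \<in> borel \<rightarrow>\<^sub>M N \<Longrightarrow> f \<in> (borel_EE :: ('d::finite) point measure) \<rightarrow>\<^sub>M N"
  unfolding borel_EE_def by (rule measurable_restrict_space1)

lemma fst_measurable_EE [measurable]: "fst \<in> (borel_EE :: ('d::finite) point measure) \<rightarrow>\<^sub>M borel"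
  by (intro measurable_EE borel_measurable_continuous_onI continuous_intros)

lemma snd_measurable_EE [measurable]: "snd \<in> (borel_EE :: ('d::finite) point measure) \<rightarrow>\<^sub>M borel"
  by (intro measurable_EE borel_measurable_continuous_onI continuous_intros)

section \<open>Windows exhausting the position-score space\<close>

definition window :: "real \<Rightarrow> real \<Rightarrow> ('d::finite) point set" where
  "window R \<epsilon> = ball 0 R \<times> {\<epsilon><..}"

lemma mem_window: "(t, s) \<in> window R \<epsilon> \<longleftrightarrow> norm t < R \<and> \<epsilon> < s"
  by (auto simp: window_def)

lemma window_open: "open (window R \<epsilon>)"
  unfolding window_def by (intro open_Times) auto

lemma window_mono: "R \<le> R' \<Longrightarrow> \<epsilon>' \<le> \<epsilon> \<Longrightarrow> window R \<epsilon> \<subseteq> window R' \<epsilon>'"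
  by (auto simp: window_def)

lemma window_EE: "0 \<le> \<epsilon> \<Longrightarrow> window R \<epsilon> \<subseteq> EE"
  by (auto simp: window_def EE_def)

lemma window_sets: "0 \<le> \<epsilon> \<Longrightarrow> window R \<epsilon> \<in> sets borel_EE"
  by (simp add: sets_borel_EE window_EE window_open)

lemma window_B11: "0 < \<epsilon> \<Longrightarrow> window R \<epsilon> \<in> B11"
  using bounded_ball by (fastforce simp: B11_def window_sets window_def intro: window_sets[unfolded window_def])

text \<open>Every set of \<open>B11\<close> lies in a window with positive level, so finiteness on
  windows is local finiteness. Tying radius and level to one index gives a single countable
  exhaustion by open sets that serves all configurations at once, so kernels can be truncated
  independently of their argument.\<close>

definition windows :: "nat \<Rightarrow> ('d::finite) point set" where
  "windows n = window (real (Suc n)) (1 / real (Suc n))"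

lemma incseq_windows: "incseq windows"
  unfolding incseq_def windows_def by (intro allI impI window_mono) (auto simp: frac_le)

lemma windows_sets [measurable]: "windows n \<in> sets borel_EE"
  by (simp add: windows_def window_sets)

lemma windows_open: "open (windows n)"
  by (simp add: windows_def window_open)

lemma UN_windows: "(\<Union>n. windows n) = (EE :: ('d::finite) point set)"
proof
  show "(\<Union>n. windows n) \<subseteq> (EE :: 'd point set)"
    unfolding windows_def by (intro UN_least window_EE) simp
  show "EE \<subseteq> (\<Union>n. windows n :: 'd point set)"
  proof
    fix x :: "'d point" assume x: "x \<in> EE"
    obtain t s where ts: "x = (t, s)" by fastforce
    with x have "0 < s" by (simp add: EE_def)
    obtain n where n: "max (norm t) (1 / s) < real n"
      using reals_Archimedean2 by blast
    have "1 / real (Suc n) < s"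
      using n \<open>0 < s\<close> by (simp add: field_simps)
    then have "x \<in> windows n" using n by (auto simp: ts windows_def mem_window)
    then show "x \<in> (\<Union>n. windows n)" by blast
  qed
qed

lemma N11_sets: "\<mu> \<in> N11 \<Longrightarrow> sets \<mu> = sets borel_EE"
  by (simp add: N11_def simple_counting_measure_def counting_measure_def)

lemma N11_space_eq: "\<mu> \<in> N11 \<Longrightarrow> space \<mu> = EE"
  using sets_eq_imp_space_eq[OF N11_sets] by simp

lemma N11_B11_finite: "\<mu> \<in> N11 \<Longrightarrow> A \<in> B11 \<Longrightarrow> emeasure \<mu> A < \<infinity>"
  by (simp add: N11_def)

lemma N11_window_finite: "\<mu> \<in> N11 \<Longrightarrow> 0 < \<epsilon> \<Longrightarrow> emeasure \<mu> (window R \<epsilon>) < \<infinity>"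
  using N11_B11_finite window_B11 by blast

lemma N11_windows_finite: "\<mu> \<in> N11 \<Longrightarrow> emeasure \<mu> (windows n) < \<infinity>"
  unfolding windows_def by (rule N11_window_finite) auto

lemma N11_integer:
  "\<mu> \<in> N11 \<Longrightarrow> A \<in> sets borel_EE \<Longrightarrow> emeasure \<mu> A = \<infinity> \<or> (\<exists>n::nat. emeasure \<mu> A = of_nat n)"
  by (simp add: N11_def simple_counting_measure_def counting_measure_def)

lemma N11_column: "\<mu> \<in> N11 \<Longrightarrow> emeasure \<mu> ({t} \<times> {0<..}) \<le> 1"
  by (simp add: N11_def simple_counting_measure_def)

lemma N11_sigma_finite: assumes "\<mu> \<in> N11" shows "sigma_finite_measure \<mu>"
proof
  show "\<exists>A. countable A \<and> A \<subseteq> sets \<mu> \<and> \<Union> A = space \<mu> \<and> (\<forall>a\<in>A. emeasure \<mu> a \<noteq> \<infinity>)"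
    using UN_windows N11_windows_finite[OF assms]
    by (intro exI[of _ "range windows"]) (auto simp: N11_sets[OF assms] N11_space_eq[OF assms] less_top)
qed

section \<open>Unit atoms and pure atomicity\<close>

lemma singleton_sets: "x \<in> EE \<Longrightarrow> {x} \<in> sets borel_EE"
  by (simp add: sets_borel_EE)

lemma column_sets [measurable]: "{t} \<times> {0<..} \<in> sets (borel_EE :: ('d::finite) point measure)"
  by (auto simp: sets_borel_EE EE_def intro!: borel_Times)

text \<open>An atom weighs at most 1 because its whole column does, and every value is an integer or
  infinite.\<close>

lemma N11_atom_one:
  assumes "\<mu> \<in> N11" "x \<in> atoms \<mu>" shows "emeasure \<mu> {x} = 1"
proof -
  have x: "x \<in> EE" "emeasure \<mu> {x} \<noteq> 0" using assms(2) by (auto simp: atoms_def)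
  have "emeasure \<mu> {x} \<le> emeasure \<mu> ({fst x} \<times> {0<..})"
    using x by (intro emeasure_mono) (auto simp: N11_sets[OF assms(1)] EE_def)
  then have le: "emeasure \<mu> {x} \<le> 1" using N11_column[OF assms(1)] order_trans by blast
  obtain n :: nat where "emeasure \<mu> {x} = of_nat n"
    using N11_integer[OF assms(1) singleton_sets[OF x(1)]] le by (auto simp: top_unique)
  with x(2) le show ?thesis by (cases n) (auto simp: order.antisym)
qed

text \<open>Integer values force a gap: the masses of balls shrinking to a point that is not an atom
  tend to 0, so one of them is below 1 and hence 0. The balls stay inside a window, which gives the
  finite mass required for continuity from above.\<close>

lemma N11_null_nbhd:
  assumes "\<mu> \<in> N11" "x \<in> EE - atoms \<mu>"
  obtains V where "open V" "x \<in> V" "V \<subseteq> EE" "emeasure \<mu> V = 0"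
proof -
  obtain k where k: "x \<in> windows k" using assms(2) UN_windows by blast
  then obtain r where r: "0 < r" "ball x r \<subseteq> windows k"
    using windows_open openE by blast
  define V where "V n = ball x (r / real (Suc n))" for n
  have sub: "V n \<subseteq> windows k" for n
    using r by (auto simp: V_def field_simps intro!: order_trans[OF _ r(2)] subset_ball)
  have EE: "V n \<subseteq> EE" for n using sub UN_windows by blast
  have V_sets: "V n \<in> sets \<mu>" for n
    using EE by (simp add: N11_sets[OF assms(1)] sets_borel_EE V_def)
  have fin: "emeasure \<mu> (V n) < \<infinity>" for n
    using emeasure_mono[OF sub, of \<mu> n] N11_windows_finite[OF assms(1), of k]
    by (auto simp: N11_sets[OF assms(1)] intro: le_less_trans)
  have "decseq V"
    unfolding decseq_def V_def using r by (auto intro!: subset_ball divide_left_mono)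
  moreover have "(\<Inter>n. V n) = {x}"
  proof
    show "{x} \<subseteq> (\<Inter>n. V n)" using r by (auto simp: V_def)
    show "(\<Inter>n. V n) \<subseteq> {x}"
    proof
      fix y assume y: "y \<in> (\<Inter>n. V n)"
      have "(\<lambda>n. r / real (Suc n)) \<longlonglongrightarrow> 0"
        using LIMSEQ_Suc[OF lim_const_over_n[of r]] by simp
      moreover have "dist x y \<le> r / real (Suc n)" for n
        using y by (auto simp: V_def intro: less_imp_le)
      ultimately have "dist x y \<le> 0" by (intro LIMSEQ_le_const) auto
      then show "y \<in> {x}" by simp
    qed
  qed
  ultimately have "(\<lambda>n. emeasure \<mu> (V n)) \<longlonglongrightarrow> emeasure \<mu> {x}"
    using Lim_emeasure_decseq[of V \<mu>] V_sets fin by (simp add: image_subset_iff less_top)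
  moreover have "emeasure \<mu> {x} = 0" using assms(2) by (auto simp: atoms_def)
  ultimately have "eventually (\<lambda>n. emeasure \<mu> (V n) < 1) sequentially"
    by (intro order_tendstoD(2)) auto
  then obtain n where n: "emeasure \<mu> (V n) < 1" by (auto simp: eventually_sequentially)
  then have "emeasure \<mu> (V n) = 0"
    using N11_integer[OF assms(1), of "V n"] V_sets[of n]
    by (auto simp: N11_sets[OF assms(1)])
  then show ?thesis using that[of "V n"] EE r by (auto simp: V_def)
qed

text \<open>The null neighbourhoods of the points that are not atoms may form an uncountable family;
  the Lindelof property leaves a countable subfamily with the same union.\<close>

lemma N11_diffuse_part_null:
  assumes "\<mu> \<in> N11" shows "EE - atoms \<mu> \<in> null_sets \<mu>"
proof -
  define F where "F = {V. open V \<and> V \<subseteq> EE \<and> emeasure \<mu> V = 0}"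
  obtain F' where F': "F' \<subseteq> F" "countable F'" "\<Union>F' = \<Union>F"
    using Lindelof[of F] by (auto simp: F_def)
  have "EE - atoms \<mu> = \<Union>F"
  proof
    show "EE - atoms \<mu> \<subseteq> \<Union>F"
      using N11_null_nbhd[OF assms] unfolding F_def by (metis (mono_tags, lifting) UnionI mem_Collect_eq subsetI)
    show "\<Union>F \<subseteq> EE - atoms \<mu>"
    proof
      fix x assume "x \<in> \<Union>F"
      then obtain V where V: "x \<in> V" "open V" "V \<subseteq> EE" "emeasure \<mu> V = 0" by (auto simp: F_def)
      have "emeasure \<mu> {x} \<le> emeasure \<mu> V"
        using V by (intro emeasure_mono) (auto simp: N11_sets[OF assms] sets_borel_EE)
      then show "x \<in> EE - atoms \<mu>" using V by (auto simp: atoms_def)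
    qed
  qed
  moreover have "\<Union>F' \<in> null_sets \<mu>"
  proof -
    have "V \<in> null_sets \<mu>" if "V \<in> F'" for V
      using that F'(1) by (auto simp: F_def null_sets_def N11_sets[OF assms] sets_borel_EE)
    then show ?thesis using null_sets_UN'[OF F'(2), of "\<lambda>V. V" \<mu>] by simp
  qed
  ultimately show ?thesis using F' by simp
qed

lemma N11_atoms_sets: assumes "\<mu> \<in> N11" shows "atoms \<mu> \<in> sets borel_EE"
proof -
  have "EE - (EE - atoms \<mu>) \<in> sets \<mu>"
    using null_setsD2[OF N11_diffuse_part_null[OF assms]] EE_sets
    unfolding N11_sets[OF assms] by (metis sets.Diff)
  moreover have "EE - (EE - atoms \<mu>) = atoms \<mu>" by (auto simp: atoms_def)
  ultimately show ?thesis by (simp add: N11_sets[OF assms])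
qed

lemma N11_countable_atoms: assumes "\<mu> \<in> N11" shows "countable (atoms \<mu>)"
proof -
  have "finite (atoms \<mu> \<inter> windows n)" for n
  proof (rule ccontr)
    assume inf: "infinite (atoms \<mu> \<inter> windows n)"
    obtain m :: nat where m: "emeasure \<mu> (windows n) = of_nat m"
      using N11_integer[OF assms windows_sets, of n] N11_windows_finite[OF assms, of n] by auto
    \<comment> \<open>Finitely many atoms per window: m + 1 atoms of weight 1 do not fit into a
      window of mass m.\<close>
    obtain S where S: "S \<subseteq> atoms \<mu> \<inter> windows n" "finite S" "card S = Suc m"
      using infinite_arbitrarily_large[OF inf] by metis
    have sets: "{x} \<in> sets \<mu>" if "x \<in> S" for x
      using that S by (auto simp: N11_sets[OF assms] atoms_def intro: singleton_sets)
    have "of_nat (Suc m) = (\<Sum>x\<in>S. emeasure \<mu> {x})"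
      using S N11_atom_one[OF assms] by (subst sum.cong[OF refl, of _ _ "\<lambda>_. 1"]) auto
    also have "\<dots> = emeasure \<mu> S"
      using sets S by (intro emeasure_eq_sum_singleton[symmetric]) auto
    also have "\<dots> \<le> of_nat m"
      unfolding m[symmetric] using S by (intro emeasure_mono) (auto simp: N11_sets[OF assms])
    finally have "Suc m \<le> m" by (simp only: of_nat_le_iff)
    then show False by simp
  qed
  then have "countable (\<Union>n. atoms \<mu> \<inter> windows n)" by (intro countable_UN) (auto intro: countable_finite)
  moreover have "(\<Union>n. atoms \<mu> \<inter> windows n) = atoms \<mu>"
    using UN_windows by (auto simp: atoms_def)
  ultimately show ?thesis by simp
qed

lemma measurable_count_space_atoms: "(\<lambda>x. x) \<in> count_space (atoms \<mu>) \<rightarrow>\<^sub>M borel_EE"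
  by (auto simp: atoms_def)

text \<open>The bridge to the definitions by sets of atoms: it turns \<open>atom_sum\<close> into an
  integral against the measure, and \<open>shift_pts\<close> and \<open>scaling\<close> into image
  measures.\<close>

lemma N11_eq_distr:
  assumes "\<mu> \<in> N11" shows "\<mu> = distr (count_space (atoms \<mu>)) borel_EE (\<lambda>x. x)"
proof (rule measure_eqI)
  fix A assume A: "A \<in> sets \<mu>"
  have sub: "A \<subseteq> EE" using A sets.sets_into_space N11_space_eq[OF assms] by blast
  have "AE x in \<mu>. x \<in> atoms \<mu>"
    using N11_diffuse_part_null[OF assms]
    by (intro AE_I'[of "EE - atoms \<mu>"]) (auto simp: N11_space_eq[OF assms])
  then have "emeasure \<mu> A = emeasure \<mu> (A \<inter> atoms \<mu>)"
    using A N11_atoms_sets[OF assms] by (intro emeasure_eq_AE) (auto simp: N11_sets[OF assms])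
  also have "\<dots> = (\<integral>\<^sup>+x. emeasure \<mu> {x} \<partial>count_space (A \<inter> atoms \<mu>))"
    using N11_countable_atoms[OF assms] sub
    by (intro emeasure_countable_singleton) (auto simp: N11_sets[OF assms] singleton_sets)
  also have "\<dots> = (\<integral>\<^sup>+x. 1 \<partial>count_space (A \<inter> atoms \<mu>))"
    using N11_atom_one[OF assms] by (intro nn_integral_cong) auto
  also have "\<dots> = emeasure (count_space (A \<inter> atoms \<mu>)) (A \<inter> atoms \<mu>)" by simp
  also have "\<dots> = emeasure (count_space (atoms \<mu>)) (A \<inter> atoms \<mu>)"
    by (simp add: emeasure_count_space)
  also have "\<dots> = emeasure (distr (count_space (atoms \<mu>)) borel_EE (\<lambda>x. x)) A"
    using A by (subst emeasure_distr) (auto simp: N11_sets[OF assms] atoms_def)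
  finally show "emeasure \<mu> A = emeasure (distr (count_space (atoms \<mu>)) borel_EE (\<lambda>x. x)) A" .
qed (simp add: N11_sets[OF assms])

lemma N11_atom_sum:
  assumes "\<mu> \<in> N11" "f \<in> borel_measurable borel_EE"
  shows "atom_sum \<mu> f = (\<integral>\<^sup>+x. f x \<partial>\<mu>)"
  by (subst N11_eq_distr[OF assms(1)])
     (simp add: nn_integral_distr[OF measurable_count_space_atoms] assms(2) atom_sum_def)

lemma N11_distr_atoms:
  assumes "\<mu> \<in> N11" "g \<in> borel_EE \<rightarrow>\<^sub>M borel_EE"
  shows "distr (count_space (atoms \<mu>)) borel_EE g = distr \<mu> borel_EE g"
  by (subst (2) N11_eq_distr[OF assms(1)])
     (simp add: distr_distr[OF assms(2) measurable_count_space_atoms] comp_def)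

lemma N11_AE_atoms:
  assumes "\<mu> \<in> N11" shows "AE x in \<mu>. x \<in> atoms \<mu>"
  using N11_diffuse_part_null[OF assms]
    by (intro AE_I'[of "EE - atoms \<mu>"]) (auto simp: N11_space_eq[OF assms])

lemma N11_atoms_unique:
  assumes "\<mu> \<in> N11" "(t, s) \<in> atoms \<mu>" "(t, s') \<in> atoms \<mu>" shows "s = s'"
proof (rule ccontr)
  assume "s \<noteq> s'"
  have EE: "(t, s) \<in> EE" "(t, s') \<in> EE" using assms by (auto simp: atoms_def)
  have "emeasure \<mu> {(t, s), (t, s')} = (\<Sum>x\<in>{(t, s), (t, s')}. emeasure \<mu> {x})"
    using EE by (intro emeasure_eq_sum_singleton) (auto simp: N11_sets[OF assms(1)] singleton_sets)
  also have "\<dots> = 2"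
    using \<open>s \<noteq> s'\<close> assms by (simp add: N11_atom_one)
  finally have "2 \<le> emeasure \<mu> ({t} \<times> {0<..})"
    using emeasure_mono[of "{(t, s), (t, s')}" "{t} \<times> {0<..}" \<mu>] EE
    by (simp add: N11_sets[OF assms(1)] EE_def)
  from this N11_column[OF assms(1), of t] have "(2::ennreal) \<le> 1" by (rule order_trans)
  then show False by simp
qed

section \<open>Measurability of sums over points\<close>

lemma space_N11_space [simp]: "space N11_space = N11"
  unfolding N11_space_def by (rule space_measure_of) auto

lemma N11_emeasure_measurable [measurable]:
  assumes "B \<in> sets borel_EE" shows "(\<lambda>\<mu>. emeasure \<mu> B) \<in> borel_measurable N11_space"
proof (rule measurableI)
  fix C :: "ennreal set" assume "C \<in> sets borel"
  then have "{\<mu> \<in> N11. emeasure \<mu> B \<in> C} \<in> sets N11_space"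
    unfolding N11_space_def using assms by (subst sets_measure_of) auto
  moreover have "(\<lambda>\<mu>. emeasure \<mu> B) -` C \<inter> space N11_space = {\<mu> \<in> N11. emeasure \<mu> B \<in> C}" by auto
  ultimately show "(\<lambda>\<mu>. emeasure \<mu> B) -` C \<inter> space N11_space \<in> sets N11_space" by simp
qed simp

lemma measurable_N11_spaceI:
  fixes K :: "'a \<Rightarrow> ('d::finite) point measure"
  assumes "\<And>x. x \<in> space S \<Longrightarrow> K x \<in> N11"
    and "\<And>B. B \<in> sets borel_EE \<Longrightarrow> (\<lambda>x. emeasure (K x) B) \<in> borel_measurable S"
  shows "K \<in> S \<rightarrow>\<^sub>M N11_space"
  unfolding N11_space_def
proof (rule measurable_measure_of)
  fix A :: "'d point measure set" assume "A \<in> {{\<mu> \<in> N11. emeasure \<mu> B \<in> C} |B C. B \<in> sets borel_EE \<and> C \<in> sets borel}"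
  then obtain B C where A: "A = {\<mu> \<in> N11. emeasure \<mu> B \<in> C}" and B: "B \<in> sets borel_EE"
    and C: "C \<in> sets borel" by blast
  have "K -` A \<inter> space S = (\<lambda>x. emeasure (K x) B) -` C \<inter> space S" using assms(1) by (auto simp: A)
  also have "\<dots> \<in> sets S" using measurable_sets[OF assms(2)[OF B] C] .
  finally show "K -` A \<inter> space S \<in> sets S" .
qed (use assms(1) in auto)

text \<open>The sets with measurable evaluation form a Dynkin system; finiteness of the measures
  turns complements into differences. The generator is left abstract because two are used:
  measurable rectangles for joint measurability of kernels, and open sets for the generating class
  of \<open>N11_space\<close>.\<close>

lemma measurable_emeasure_generated:
  assumes "\<And>x. x \<in> space S \<Longrightarrow> finite_measure (\<kappa> x)"
    and sets: "\<And>x. x \<in> space S \<Longrightarrow> sets (\<kappa> x) = sigma_sets \<Omega> G"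
    and G: "Int_stable G" "G \<subseteq> Pow \<Omega>"
    and \<Omega>: "(\<lambda>x. emeasure (\<kappa> x) \<Omega>) \<in> borel_measurable S"
    and basic: "\<And>A. A \<in> G \<Longrightarrow> (\<lambda>x. emeasure (\<kappa> x) A) \<in> borel_measurable S"
    and A: "A \<in> sigma_sets \<Omega> G"
  shows "(\<lambda>x. emeasure (\<kappa> x) A) \<in> borel_measurable S"
  using G A
proof (induction rule: sigma_sets_induct_disjoint)
  case (compl A)
  have space: "space (\<kappa> x) = \<Omega>" if "x \<in> space S" for x
    using sets_eq_imp_space_eq[of "\<kappa> x" "sigma \<Omega> G"] sets[OF that] G(2) by simp
  have "emeasure (\<kappa> x) (\<Omega> - A) = emeasure (\<kappa> x) \<Omega> - emeasure (\<kappa> x) A" if "x \<in> space S" for x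
    using emeasure_compl[of A "\<kappa> x"] compl(1) sets[OF that] assms(1)[OF that] space[OF that]
    by (simp add: finite_measure.emeasure_finite)
  moreover have "(\<lambda>x. emeasure (\<kappa> x) \<Omega> - emeasure (\<kappa> x) A) \<in> borel_measurable S"
    using compl(2) \<Omega> by measurable
  ultimately show ?case by (simp cong: measurable_cong)
next
  case (union A)
  have "emeasure (\<kappa> x) (\<Union>i. A i) = (\<Sum>i. emeasure (\<kappa> x) (A i))" if "x \<in> space S" for x
    using union(1,2) sets[OF that] by (intro suminf_emeasure[symmetric]) auto
  moreover have "(\<lambda>x. \<Sum>i. emeasure (\<kappa> x) (A i)) \<in> borel_measurable S"
    using union(3) by measurable
  ultimately show ?case by (simp cong: measurable_cong)
qed (use basic in auto)

section \<open>Kernels with values in \<open>N11\<close>, truncated to windows\<close>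

lemma N11_windows_SUP:
  assumes "\<mu> \<in> N11" "A \<in> sets borel_EE"
  shows "emeasure \<mu> A = (SUP n. emeasure \<mu> (A \<inter> windows n))"
proof -
  have "(SUP n. emeasure \<mu> (A \<inter> windows n)) = emeasure \<mu> (\<Union>n. A \<inter> windows n)"
    using assms incseq_windows
    by (intro SUP_emeasure_incseq) (auto simp: N11_sets incseq_def)
  also have "(\<Union>n. A \<inter> windows n) = A"
    using UN_windows sets.sets_into_space[OF assms(2)] by auto
  finally show ?thesis by simp
qed

lemma N11_density_windows:
  assumes "\<mu> \<in> N11"
  shows "finite_measure (density \<mu> (indicator (windows n)))"
    and "A \<in> sets borel_EE \<Longrightarrow>
      emeasure (density \<mu> (indicator (windows n))) A = emeasure \<mu> (A \<inter> windows n)"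
proof -
  show *: "emeasure (density \<mu> (indicator (windows n))) A = emeasure \<mu> (A \<inter> windows n)"
    if "A \<in> sets borel_EE" for A
  proof -
    have "emeasure (density \<mu> (indicator (windows n))) A = (\<integral>\<^sup>+x. indicator (A \<inter> windows n) x \<partial>\<mu>)"
      using that by (subst emeasure_density)
        (auto simp: N11_sets[OF assms] indicator_inter_arith mult.commute[of "indicator A _"]
          simp del: nn_integral_indicator intro!: borel_measurable_indicator nn_integral_cong)
    then show ?thesis using that by (simp add: N11_sets[OF assms])
  qed
  show "finite_measure (density \<mu> (indicator (windows n)))"
  proof
    have "emeasure \<mu> (EE \<inter> windows n) = emeasure \<mu> (windows n)" using UN_windows by (auto intro: arg_cong[where f="emeasure \<mu>"])
    then show "emeasure (density \<mu> (indicator (windows n))) (space (density \<mu> (indicator (windows n)))) \<noteq> \<infinity>"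
      using *[of EE] N11_windows_finite[OF assms, of n] by (simp add: N11_space_eq[OF assms])
  qed
qed

text \<open>The measures \<open>K x\<close> need not be finite, so they are first restricted to a
  window. The image of the restricted measure under \<open>Pair x\<close> lives on the product space
  and evaluates sections of A as masses of A itself, so the Dynkin argument on rectangles applies;
  then the windows increase.\<close>

lemma kernel_emeasure_measurable:
  assumes K: "K \<in> S \<rightarrow>\<^sub>M N11_space" and A: "A \<in> sets (S \<Otimes>\<^sub>M borel_EE)"
  shows "(\<lambda>x. emeasure (K x) (Pair x -` A)) \<in> borel_measurable S"
proof -
  have K_N11: "K x \<in> N11" if "x \<in> space S" for x using measurable_space[OF K that] by simp
  define \<kappa> where "\<kappa> n x = distr (density (K x) (indicator (windows n))) (S \<Otimes>\<^sub>M borel_EE) (Pair x)" for n x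
  have meas: "Pair x \<in> density (K x) (indicator (windows n)) \<rightarrow>\<^sub>M S \<Otimes>\<^sub>M borel_EE" if "x \<in> space S" for x n
    using measurable_Pair1'[OF that, of borel_EE]
    by (simp cong: measurable_cong_sets add: N11_sets[OF K_N11[OF that]])
  have \<kappa>: "emeasure (\<kappa> n x) A = emeasure (K x) (Pair x -` A \<inter> windows n)"
    if "x \<in> space S" "A \<in> sets (S \<Otimes>\<^sub>M borel_EE)" for n x A
  proof -
    have "emeasure (\<kappa> n x) A = emeasure (density (K x) (indicator (windows n))) (Pair x -` A \<inter> EE)"
      unfolding \<kappa>_def
      by (subst emeasure_distr[OF meas[OF that(1)] that(2)]) (simp add: N11_space_eq[OF K_N11[OF that(1)]])
    also have "\<dots> = emeasure (K x) (Pair x -` A \<inter> EE \<inter> windows n)"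
      using measurable_sets[OF measurable_Pair1'[OF that(1)] that(2)]
      by (intro N11_density_windows K_N11 that) simp
    also have "Pair x -` A \<inter> EE \<inter> windows n = Pair x -` A \<inter> windows n" using UN_windows by blast
    finally show ?thesis .
  qed
  have n: "(\<lambda>x. emeasure (K x) (Pair x -` A \<inter> windows n)) \<in> borel_measurable S" for n
  proof -
    let ?G = "{a \<times> b |a b. a \<in> sets S \<and> b \<in> sets (borel_EE :: 'b point measure)}"
    have rect: "(\<lambda>x. emeasure (\<kappa> n x) (a \<times> b)) \<in> borel_measurable S"
      if ab: "a \<in> sets S" "b \<in> sets borel_EE" for a b
    proof -
      have "emeasure (\<kappa> n x) (a \<times> b) = indicator a x * emeasure (K x) (b \<inter> windows n)" if "x \<in> space S" for x
        using ab that by (subst \<kappa>) (auto simp: indicator_def vimage_def)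
      moreover have "(\<lambda>x. indicator a x * emeasure (K x) (b \<inter> windows n)) \<in> borel_measurable S"
        using ab by (intro borel_measurable_times_ennreal borel_measurable_indicator
            measurable_compose[OF K N11_emeasure_measurable] sets.Int windows_sets)
      ultimately show ?thesis by (subst measurable_cong) auto
    qed
    have "(\<lambda>x. emeasure (\<kappa> n x) A) \<in> borel_measurable S"
    proof (rule measurable_emeasure_generated[where G="?G" and \<Omega>="space S \<times> EE"])
      show "finite_measure (\<kappa> n x)" if "x \<in> space S" for x
        unfolding \<kappa>_def using meas[OF that] N11_density_windows(1)[OF K_N11[OF that]]
        by (intro finite_measure.finite_measure_distr)
      show "sets (\<kappa> n x) = sigma_sets (space S \<times> EE) ?G" for x
        by (simp add: \<kappa>_def sets_pair_measure)
      show "Int_stable ?G" by (rule Int_stable_pair_measure_generator)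
      show "?G \<subseteq> Pow (space S \<times> EE)" using pair_measure_closed[of S "borel_EE :: 'b point measure"] by simp
      show "(\<lambda>x. emeasure (\<kappa> n x) (space S \<times> EE)) \<in> borel_measurable S" by (intro rect) simp_all
      show "A \<in> sigma_sets (space S \<times> EE) ?G" using A by (simp add: sets_pair_measure)
    qed (use rect in auto)
    then show ?thesis using A by (subst measurable_cong[where g="\<lambda>x. emeasure (\<kappa> n x) A"]) (simp_all add: \<kappa>)
  qed
  have "emeasure (K x) (Pair x -` A) = (SUP n. emeasure (K x) (Pair x -` A \<inter> windows n))" if "x \<in> space S" for x
    by (intro N11_windows_SUP K_N11 that sets_Pair1[OF A])
  then show ?thesis using n by (subst measurable_cong) auto
qed

text \<open>The integrand may depend on the same argument as the integrating measure. This is the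
  typical situation below, where a configuration is summed over its own points and also enters the
  summand.\<close>

lemma kernel_nn_integral_measurable_pair:
  assumes K: "K \<in> S \<rightarrow>\<^sub>M N11_space" and f: "f \<in> borel_measurable (S \<Otimes>\<^sub>M borel_EE)"
  shows "(\<lambda>x. \<integral>\<^sup>+y. f (x, y) \<partial>K x) \<in> borel_measurable S"
  using f
proof (induction rule: borel_measurable_induct)
  case (cong f g)
  have "(\<integral>\<^sup>+y. f (x, y) \<partial>K x) = (\<integral>\<^sup>+y. g (x, y) \<partial>K x)" if "x \<in> space S" for x
    using cong.hyps(3) that measurable_space[OF K that]
    by (intro nn_integral_cong) (auto simp: N11_space_eq space_pair_measure)
  then show ?case using cong.IH by (simp cong: measurable_cong)
next
  case (set A)
  have "(\<integral>\<^sup>+y. indicator A (x, y) \<partial>K x) = emeasure (K x) (Pair x -` A)" if "x \<in> space S" for x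
  proof -
    have "(\<integral>\<^sup>+y. indicator A (x, y) \<partial>K x) = (\<integral>\<^sup>+y. indicator (Pair x -` A) y \<partial>K x)"
      by (intro nn_integral_cong) (auto simp: indicator_def)
    also have "\<dots> = emeasure (K x) (Pair x -` A)"
      using sets_Pair1[OF set] measurable_space[OF K that] by (simp add: N11_sets)
    finally show ?thesis .
  qed
  then show ?case using kernel_emeasure_measurable[OF K set] by (simp cong: measurable_cong)
next
  case (mult u c)
  have "(\<integral>\<^sup>+y. c * u (x, y) \<partial>K x) = c * (\<integral>\<^sup>+y. u (x, y) \<partial>K x)" if "x \<in> space S" for x
    using measurable_space[OF K that] measurable_Pair2[OF mult.hyps(2), of x] that
    by (intro nn_integral_cmult) (simp add: N11_sets cong: measurable_cong_sets)
  then show ?case using mult by (simp cong: measurable_cong)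
next
  case (add u v)
  have "(\<integral>\<^sup>+y. v (x, y) + u (x, y) \<partial>K x) = (\<integral>\<^sup>+y. v (x, y) \<partial>K x) + (\<integral>\<^sup>+y. u (x, y) \<partial>K x)" if "x \<in> space S" for x
    using measurable_space[OF K that] measurable_Pair2[OF add.hyps(1), of x] measurable_Pair2[OF add.hyps(3), of x] that
    by (intro nn_integral_add) (simp_all add: N11_sets cong: measurable_cong_sets)
  then show ?case using add by (simp cong: measurable_cong)
next
  case (seq U)
  have "(\<integral>\<^sup>+y. (SUP i. U i) (x, y) \<partial>K x) = (SUP i. \<integral>\<^sup>+y. U i (x, y) \<partial>K x)" if "x \<in> space S" for x
    unfolding SUP_apply using measurable_space[OF K that] measurable_Pair2[OF seq.hyps(1), of x] that \<open>incseq U\<close>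
    by (intro nn_integral_monotone_convergence_SUP)
      (auto simp: N11_sets incseq_def le_fun_def cong: measurable_cong_sets)
  then show ?case using seq by (simp cong: measurable_cong)
qed

lemma kernel_nn_integral_measurable:
  assumes "K \<in> S \<rightarrow>\<^sub>M N11_space" "(\<lambda>(x, y). f x y) \<in> borel_measurable (S \<Otimes>\<^sub>M borel_EE)"
  shows "(\<lambda>x. \<integral>\<^sup>+y. f x y \<partial>K x) \<in> borel_measurable S"
  using kernel_nn_integral_measurable_pair[OF assms] by simp

section \<open>Shifts and scalings\<close>

text \<open>Shifts (\<open>v = u = 1\<close>) and scalings (\<open>z = 0\<close>) in one family that
  is closed under composition, so preservation of \<open>N11\<close> and the commutation rules are
  single computations.\<close>

definition rescale :: "real ^ 'd \<Rightarrow> real \<Rightarrow> real \<Rightarrow> ('d::finite) point \<Rightarrow> 'd point" where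
  "rescale z v u x = ((fst x - z) /\<^sub>R v, snd x / u)"

lemma measurable_borel_EE_iff:
  "f \<in> M \<rightarrow>\<^sub>M borel_EE \<longleftrightarrow> f \<in> M \<rightarrow>\<^sub>M borel \<and> (\<forall>x\<in>space M. f x \<in> EE)"
  by (auto simp: borel_EE_def measurable_restrict_space2_iff)

lemma rescale_measurable [measurable]:
  assumes "0 < u" shows "rescale z v u \<in> borel_EE \<rightarrow>\<^sub>M borel_EE"
proof -
  have "rescale z v u \<in> borel_EE \<rightarrow>\<^sub>M borel"
    unfolding rescale_def by (intro measurable_EE borel_measurable_continuous_onI continuous_intros)
      (use assms in auto)
  then show ?thesis using assms by (auto simp: measurable_borel_EE_iff rescale_def EE_def)
qed

lemma rescale_vimage_column:
  assumes "0 < u" "0 < v"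
  shows "rescale z v u -` (B \<times> {0<..}) \<inter> EE = (\<lambda>t. (t - z) /\<^sub>R v) -` B \<times> {0<..}"
  using assms by (auto simp: rescale_def EE_def)

lemma bounded_rescale_vimage:
  fixes B :: "('a::real_normed_vector) set"
  assumes "0 < v" "bounded B" shows "bounded ((\<lambda>t. (t - z) /\<^sub>R v) -` B)"
proof -
  have "(\<lambda>t. (t - z) /\<^sub>R v) -` B \<subseteq> (\<lambda>t. v *\<^sub>R t + z) ` B"
  proof
    fix t assume "t \<in> (\<lambda>t. (t - z) /\<^sub>R v) -` B"
    then show "t \<in> (\<lambda>t. v *\<^sub>R t + z) ` B"
      using assms by (intro image_eqI[of _ _ "(t - z) /\<^sub>R v"]) auto
  qed
  moreover have "bounded ((\<lambda>t. v *\<^sub>R t + z) ` B)"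
    using bounded_translation[OF bounded_scaling[OF assms(2), of v], of z]
    by (simp add: image_image add.commute)
  ultimately show ?thesis by (rule bounded_subset[rotated])
qed

text \<open>The preimage of a column is a single column, at position
  \<open>v *\<^sub>R t + z\<close>, so simplicity survives.\<close>

lemma simple_counting_measure_rescale:
  assumes "simple_counting_measure \<mu>" "0 < u" "0 < v"
  shows "simple_counting_measure (distr \<mu> borel_EE (rescale z v u))"
proof -
  have sets: "sets \<mu> = sets borel_EE" using assms by (simp add: simple_counting_measure_def counting_measure_def)
  then have space: "space \<mu> = EE" using sets_eq_imp_space_eq[OF sets] by simp
  have meas: "rescale z v u \<in> \<mu> \<rightarrow>\<^sub>M borel_EE"
    using rescale_measurable[OF assms(2), of z v] by (simp add: sets cong: measurable_cong_sets)
  have vim: "rescale z v u -` A \<inter> EE \<in> sets borel_EE" if "A \<in> sets borel_EE" for A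
    using measurable_sets[OF rescale_measurable[OF assms(2)] that] by simp
  have col: "(\<lambda>x. (x - z) /\<^sub>R v) -` {t} = {v *\<^sub>R t + z}" for t
    using assms(3) by (auto simp: field_simps)
  show ?thesis
    unfolding simple_counting_measure_def counting_measure_def
  proof (intro conjI allI ballI)
    fix A :: "'a point set" assume "A \<in> sets borel_EE"
    then show "emeasure (distr \<mu> borel_EE (rescale z v u)) A = \<infinity> \<or>
      (\<exists>n::nat. emeasure (distr \<mu> borel_EE (rescale z v u)) A = of_nat n)"
      using assms(1) vim by (simp add: emeasure_distr[OF meas] space simple_counting_measure_def counting_measure_def)
  next
    fix t :: "real ^ 'a"
    show "emeasure (distr \<mu> borel_EE (rescale z v u)) ({t} \<times> {0<..}) \<le> 1"
      using assms(1) by (simp add: emeasure_distr[OF meas column_sets] space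
          rescale_vimage_column[OF assms(2,3)] col simple_counting_measure_def)
  qed simp
qed

lemma N10_N11: "N10 \<subseteq> N11"
proof
  fix \<mu> :: "('a::finite) point measure" assume \<mu>: "\<mu> \<in> N10"
  have "emeasure \<mu> A < \<infinity>" if A: "A \<in> B11" for A
  proof -
    obtain B \<epsilon> where B: "bounded B" "0 < \<epsilon>" "A \<subseteq> B \<times> {\<epsilon><..}" using A by (auto simp: B11_def)
    obtain R where R: "B \<subseteq> ball 0 R" using bounded_subset_ballD[OF B(1)] by blast
    have "ball 0 R \<times> {0<..} \<in> sets borel_EE" using window_sets[of 0 R] by (simp add: window_def)
    then have "emeasure \<mu> A \<le> emeasure \<mu> (ball 0 R \<times> {0<..})"
      using B R \<mu> by (intro emeasure_mono) (auto simp: N10_def simple_counting_measure_def counting_measure_def)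
    also have "\<dots> < \<infinity>" using \<mu> by (simp add: N10_def)
    finally show ?thesis .
  qed
  then show "\<mu> \<in> N11" using \<mu> by (simp add: N11_def N10_def)
qed

lemma N11_distr_rescale:
  assumes "\<mu> \<in> N11" "0 < u" "0 < v"
  shows "distr \<mu> borel_EE (rescale z v u) \<in> N11"
  unfolding N11_def
proof (intro CollectI conjI ballI)
  show "simple_counting_measure (distr \<mu> borel_EE (rescale z v u))"
    using assms by (intro simple_counting_measure_rescale) (auto simp: N11_def)
  fix A :: "'a point set" assume A: "A \<in> B11"
  then obtain B \<epsilon> where B: "A \<in> sets borel_EE" "bounded B" "0 < \<epsilon>" "A \<subseteq> B \<times> {\<epsilon><..}" by (auto simp: B11_def)
  have meas: "rescale z v u \<in> \<mu> \<rightarrow>\<^sub>M borel_EE"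
    using rescale_measurable[OF assms(2), of z v] by (simp add: N11_sets[OF assms(1)] cong: measurable_cong_sets)
  have "rescale z v u -` A \<inter> EE \<subseteq> (\<lambda>t. (t - z) /\<^sub>R v) -` B \<times> {u * \<epsilon><..}"
    using B assms by (fastforce simp: rescale_def field_simps)
  moreover have "rescale z v u -` A \<inter> EE \<in> sets borel_EE"
    using measurable_sets[OF rescale_measurable[OF assms(2)] B(1)] by simp
  ultimately have "rescale z v u -` A \<inter> EE \<in> B11"
    unfolding B11_def using bounded_rescale_vimage[OF assms(3) B(2), of z] assms(2) B(3)
    by (intro CollectI conjI exI[of _ "(\<lambda>t. (t - z) /\<^sub>R v) -` B"] exI[of _ "u * \<epsilon>"]) auto
  then show "emeasure (distr \<mu> borel_EE (rescale z v u)) A < \<infinity>"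
    using N11_B11_finite[OF assms(1)] by (simp add: emeasure_distr[OF meas B(1)] N11_space_eq[OF assms(1)])
qed

lemma N10_distr_rescale:
  assumes "\<mu> \<in> N10" "0 < u" "0 < v"
  shows "distr \<mu> borel_EE (rescale z v u) \<in> N10"
  unfolding N10_def
proof (intro CollectI conjI ballI impI)
  show "simple_counting_measure (distr \<mu> borel_EE (rescale z v u))"
    using assms by (intro simple_counting_measure_rescale) (auto simp: N10_def)
  have \<mu>: "\<mu> \<in> N11" using assms N10_N11 by blast
  fix B :: "(real ^ 'a) set" assume B: "B \<in> sets borel" "bounded B"
  have meas: "rescale z v u \<in> \<mu> \<rightarrow>\<^sub>M borel_EE"
    using rescale_measurable[OF assms(2), of z v] by (simp add: N11_sets[OF \<mu>] cong: measurable_cong_sets)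
  have EE: "B \<times> {0<..} \<in> sets borel_EE" using B by (auto simp: sets_borel_EE EE_def intro!: borel_Times)
  have "(\<lambda>t. (t - z) /\<^sub>R v) \<in> borel \<rightarrow>\<^sub>M (borel :: (real ^ 'a) measure)"
    by (intro borel_measurable_continuous_onI continuous_intros)
  from measurable_sets[OF this B(1)] have "(\<lambda>t. (t - z) /\<^sub>R v) -` B \<in> sets borel" by simp
  then show "emeasure (distr \<mu> borel_EE (rescale z v u)) (B \<times> {0<..}) < \<infinity>"
    using assms(1) bounded_rescale_vimage[OF assms(3) B(2), of z]
    by (simp add: emeasure_distr[OF meas EE] N11_space_eq[OF \<mu>] rescale_vimage_column[OF assms(2,3)] N10_def)
qed

section \<open>Shifts and scalings as image measures, and their measurability\<close>

lemma shift_eq_distr: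
  assumes "\<mu> \<in> N11" shows "shift_pts z \<mu> = distr \<mu> borel_EE (rescale z 1 1)"
proof -
  have "(\<lambda>(t, s). (t - z, s)) = rescale z 1 1" by (auto simp: rescale_def)
  then show ?thesis by (simp add: shift_pts_def N11_distr_atoms[OF assms])
qed

lemma scaling_eq_distr:
  assumes "\<mu> \<in> N11" "0 < u" shows "scaling v u \<mu> = distr \<mu> borel_EE (rescale 0 v u)"
proof -
  have "(\<lambda>(t :: real ^ 'a, s). (t /\<^sub>R v, s / u)) = rescale 0 v u" by (auto simp: rescale_def)
  then show ?thesis by (simp add: scaling_def N11_distr_atoms[OF assms(1)] assms(2))
qed

lemma shift_N11: "\<mu> \<in> N11 \<Longrightarrow> shift_pts z \<mu> \<in> N11"
  by (simp add: shift_eq_distr N11_distr_rescale)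

lemma shift_N10: "\<mu> \<in> N10 \<Longrightarrow> shift_pts z \<mu> \<in> N10"
  using N10_N11 by (subst shift_eq_distr) (auto simp: N10_distr_rescale)

lemma scaling_N11: "\<mu> \<in> N11 \<Longrightarrow> 0 < u \<Longrightarrow> 0 < v \<Longrightarrow> scaling v u \<mu> \<in> N11"
  by (simp add: scaling_eq_distr N11_distr_rescale)

lemma nn_integral_distr_rescale:
  assumes "\<mu> \<in> N11" "0 < u" "f \<in> borel_measurable borel_EE"
  shows "(\<integral>\<^sup>+x. f x \<partial>distr \<mu> borel_EE (rescale z v u)) = (\<integral>\<^sup>+x. f (rescale z v u x) \<partial>\<mu>)"
  using rescale_measurable[OF assms(2), of z v] assms(3)
  by (intro nn_integral_distr) (simp_all add: N11_sets[OF assms(1)] cong: measurable_cong_sets)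

lemma nn_integral_shift:
  assumes "\<mu> \<in> N11" "f \<in> borel_measurable borel_EE"
  shows "(\<integral>\<^sup>+x. f x \<partial>shift_pts z \<mu>) = (\<integral>\<^sup>+x. f (fst x - z, snd x) \<partial>\<mu>)"
  using assms by (simp add: shift_eq_distr nn_integral_distr_rescale) (simp add: rescale_def)

lemma nn_integral_scaling:
  assumes "\<mu> \<in> N11" "0 < u" "f \<in> borel_measurable borel_EE"
  shows "(\<integral>\<^sup>+x. f x \<partial>scaling v u \<mu>) = (\<integral>\<^sup>+x. f (fst x /\<^sub>R v, snd x / u) \<partial>\<mu>)"
  using assms by (simp add: scaling_eq_distr nn_integral_distr_rescale) (simp add: rescale_def)

lemma rescale_rescale:
  "0 < v \<Longrightarrow> rescale z v u (rescale z' v' u' x) = rescale (z' + v' *\<^sub>R z) (v * v') (u * u') x" if "0 < v'"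
  using that by (simp add: rescale_def divide_simps algebra_simps scaleR_right_diff_distrib)

lemma distr_rescale_rescale:
  assumes "\<mu> \<in> N11" "0 < u" "0 < u'" "0 < v" "0 < v'"
  shows "distr (distr \<mu> borel_EE (rescale z' v' u')) borel_EE (rescale z v u) =
    distr \<mu> borel_EE (rescale (z' + v' *\<^sub>R z) (v * v') (u * u'))"
  using rescale_measurable[OF assms(3), of z' v'] rescale_measurable[OF assms(2), of z v] assms
  by (subst distr_distr) (auto simp: N11_sets[OF assms(1)] comp_def rescale_rescale cong: measurable_cong_sets)

lemma shift_shift: "\<mu> \<in> N11 \<Longrightarrow> shift_pts a (shift_pts b \<mu>) = shift_pts (a + b) \<mu>"
  by (simp add: shift_eq_distr N11_distr_rescale distr_rescale_rescale add.commute)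

lemma shift_0: "\<mu> \<in> N11 \<Longrightarrow> shift_pts 0 \<mu> = \<mu>"
  by (simp add: shift_eq_distr rescale_def[abs_def] distr_id2 N11_sets)

lemma scaling_shift:
  assumes "\<mu> \<in> N11" "0 < u" "0 < v"
  shows "scaling v u (shift_pts z \<mu>) = shift_pts (z /\<^sub>R v) (scaling v u \<mu>)"
  using assms by (simp add: scaling_eq_distr shift_eq_distr N11_distr_rescale distr_rescale_rescale)

text \<open>Joint measurability is essential because below the shift vector is itself a point of the
  configuration. The mass of B after the shift is a kernel integral of an indicator whose argument
  moves with the shift vector.\<close>

lemma shift_measurable_pair:
  "(\<lambda>p. shift_pts (fst p) (snd p)) \<in> borel \<Otimes>\<^sub>M N11_space \<rightarrow>\<^sub>M N11_space"
proof (rule measurable_N11_spaceI)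
  fix B :: "('a::finite) point set" assume B: "B \<in> sets borel_EE"
  let ?S = "(borel :: (real ^ 'a) measure) \<Otimes>\<^sub>M (N11_space :: 'a point measure measure)"
  have "(\<lambda>q. (fst (snd q) - fst (fst q), snd (snd q))) \<in> ?S \<Otimes>\<^sub>M borel_EE \<rightarrow>\<^sub>M borel_EE"
    unfolding measurable_borel_EE_iff by (auto simp: space_pair_measure EE_def)
  from measurable_compose[OF this borel_measurable_indicator[OF B]]
  have "(\<lambda>q. indicator B (fst (snd q) - fst (fst q), snd (snd q)) :: ennreal) \<in> borel_measurable (?S \<Otimes>\<^sub>M borel_EE)" .
  from kernel_nn_integral_measurable_pair[OF measurable_snd this]
  have "(\<lambda>p. \<integral>\<^sup>+x. indicator B (fst x - fst p, snd x) \<partial>(snd p)) \<in> borel_measurable ?S"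
    by simp
  moreover have "emeasure (shift_pts (fst p) (snd p)) B = (\<integral>\<^sup>+x. indicator B (fst x - fst p, snd x) \<partial>(snd p))"
    if "p \<in> space ?S" for p
    using that nn_integral_shift[of "snd p" "indicator B" "fst p"] B shift_N11[of "snd p" "fst p"]
    by (simp add: space_pair_measure mem_Times_iff nn_integral_indicator N11_sets)
  ultimately show "(\<lambda>p. emeasure (shift_pts (fst p) (snd p)) B) \<in> borel_measurable ?S"
    by (simp cong: measurable_cong)
qed (auto simp: space_pair_measure shift_N11)

lemma shift_measurable [measurable (raw)]:
  assumes "f \<in> S \<rightarrow>\<^sub>M borel" "g \<in> S \<rightarrow>\<^sub>M N11_space"
  shows "(\<lambda>x. shift_pts (f x) (g x)) \<in> S \<rightarrow>\<^sub>M N11_space"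
  using measurable_compose[OF measurable_Pair[OF assms] shift_measurable_pair] by simp

lemma scaling_measurable:
  assumes "0 < u" "0 < v" shows "scaling v u \<in> N11_space \<rightarrow>\<^sub>M N11_space"
proof (rule measurable_N11_spaceI)
  fix B :: "('a::finite) point set" assume B: "B \<in> sets borel_EE"
  have "emeasure (scaling v u \<mu>) B = emeasure \<mu> (rescale 0 v u -` B \<inter> EE)" if "\<mu> \<in> N11" for \<mu>
    using rescale_measurable[OF assms(1), of 0 v] that B unfolding scaling_eq_distr[OF that assms(1)]
    by (subst emeasure_distr) (simp_all add: N11_sets N11_space_eq cong: measurable_cong_sets)
  moreover have "rescale 0 v u -` B \<inter> EE \<in> sets borel_EE"
    using measurable_sets[OF rescale_measurable[OF assms(1)] B] by simp
  ultimately show "(\<lambda>\<mu>. emeasure (scaling v u \<mu>) B) \<in> borel_measurable N11_space"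
    by (subst measurable_cong[of _ _ "\<lambda>\<mu>. emeasure \<mu> (rescale 0 v u -` B \<inter> EE)"]) auto
qed (simp add: scaling_N11 assms)

lemma space_N10_space [simp]: "space N10_space = N10"
  using N10_N11 by (auto simp: N10_space_def space_restrict_space)

lemma measurable_N10_space_iff:
  "f \<in> S \<rightarrow>\<^sub>M N10_space \<longleftrightarrow> f \<in> S \<rightarrow>\<^sub>M N11_space \<and> (\<forall>x\<in>space S. f x \<in> N10)"
  by (auto simp: N10_space_def measurable_restrict_space2_iff)

lemma N10_space_N11_space [measurable]: "(\<lambda>\<mu>. \<mu>) \<in> N10_space \<rightarrow>\<^sub>M N11_space"
  unfolding N10_space_def by (intro measurable_restrict_space1) simp

lemma shift_measurable_N10:
  assumes "f \<in> S \<rightarrow>\<^sub>M borel" "g \<in> S \<rightarrow>\<^sub>M N10_space"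
  shows "(\<lambda>x. shift_pts (f x) (g x)) \<in> S \<rightarrow>\<^sub>M N10_space"
  using assms by (auto simp: measurable_N10_space_iff shift_N10 intro!: shift_measurable)

section \<open>The exchange formula for the Palm version\<close>

lemma measurable_N11: "\<mu> \<in> N11 \<Longrightarrow> f \<in> borel_EE \<rightarrow>\<^sub>M N \<Longrightarrow> f \<in> \<mu> \<rightarrow>\<^sub>M N"
  by (simp add: N11_sets cong: measurable_cong_sets)

lemma ennreal_SUP_inf_of_nat: "(SUP n. inf x (of_nat n)) = (x :: ennreal)"
  using inf_SUP[of x of_nat "UNIV :: nat set"] by (simp add: ennreal_SUP_of_nat_eq_top)

text \<open>\<open>palm_version\<close> speaks of real-valued integrands only. Truncation of G at n
  makes its values finite, and monotone convergence through the three integrals on each side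
  restores G, including infinite values.\<close>

lemma palm_version_nn_integral:
  assumes palm: "palm_version M X lam P Xt" and X: "marked_point_process M X"
    and G: "G \<in> borel_measurable (borel \<Otimes>\<^sub>M N10_space)"
  shows "(\<integral>\<^sup>+\<omega>. \<integral>\<^sup>+x. G (fst x, shift_pts (fst x) (X \<omega>)) \<partial>X \<omega> \<partial>M) =
    ennreal lam * (\<integral>\<^sup>+t. \<integral>\<^sup>+\<omega>. G (t, Xt \<omega>) \<partial>P \<partial>lborel)"
proof -
  interpret P: prob_space P using palm by (simp add: palm_version_def marked_point_process_def)
  have X10: "X \<in> M \<rightarrow>\<^sub>M N10_space" using X by (simp add: marked_point_process_def)
  then have X11: "X \<in> M \<rightarrow>\<^sub>M N11_space" by (simp add: measurable_N10_space_iff)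
  have X\<omega>: "X \<omega> \<in> N10" "X \<omega> \<in> N11" if "\<omega> \<in> space M" for \<omega>
    using measurable_space[OF X10 that] N10_N11 by auto
  have Xt: "Xt \<in> P \<rightarrow>\<^sub>M N10_space" using palm by (simp add: palm_version_def marked_point_process_def)
  define g where "g n p = inf (G p) (of_nat n)" for n :: nat and p
  have g: "g n \<in> borel_measurable (borel \<Otimes>\<^sub>M N10_space)" for n
    unfolding g_def using G by measurable
  have g_SUP: "(SUP n. g n p) = G p" for p by (simp add: g_def ennreal_SUP_inf_of_nat)
  have g_inc: "g m p \<le> g n p" if "m \<le> n" for m n p using that by (simp add: g_def le_infI2)
  have g_real: "ennreal (enn2real (g n p)) = g n p" for n p
  proof -
    have "g n p \<le> of_nat n" by (simp add: g_def)
    also have "\<dots> < top" by (rule of_nat_less_top)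
    finally show ?thesis by simp
  qed
  have gXx: "(\<lambda>q. g n (fst (snd q), shift_pts (fst (snd q)) (X (fst q)))) \<in> borel_measurable (M \<Otimes>\<^sub>M borel_EE)" for n
    by (intro measurable_compose[OF _ g] measurable_Pair shift_measurable_N10
        measurable_compose[OF measurable_fst X10] measurable_compose[OF measurable_snd fst_measurable_EE])
  have gX: "(\<lambda>x. g n (fst x, shift_pts (fst x) (X \<omega>))) \<in> borel_measurable borel_EE" if "\<omega> \<in> space M" for n \<omega>
    using measurable_Pair2[OF gXx that, of n] by simp
  have gXt: "(\<lambda>p. g n (fst p, Xt (snd p))) \<in> borel_measurable (lborel \<Otimes>\<^sub>M P)" for n
    by (intro measurable_compose[OF _ g] measurable_Pair measurable_compose[OF measurable_snd Xt]) simp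
  have g_palm: "(\<integral>\<^sup>+\<omega>. \<integral>\<^sup>+x. g n (fst x, shift_pts (fst x) (X \<omega>)) \<partial>X \<omega> \<partial>M) =
      ennreal lam * (\<integral>\<^sup>+t. \<integral>\<^sup>+\<omega>. g n (t, Xt \<omega>) \<partial>P \<partial>lborel)" for n
  proof -
    have g_meas: "(\<lambda>p. enn2real (g n p)) \<in> borel_measurable (borel \<Otimes>\<^sub>M N10_space)" using g by measurable
    have "(\<integral>\<^sup>+\<omega>. atom_sum (X \<omega>) (\<lambda>(t, s). ennreal (enn2real (g n (t, shift_pts t (X \<omega>))))) \<partial>M) =
        ennreal lam * (\<integral>\<^sup>+t. (\<integral>\<^sup>+\<omega>. ennreal (enn2real (g n (t, Xt \<omega>))) \<partial>P) \<partial>lborel)"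
      using conjunct2[OF palm[unfolded palm_version_def], THEN spec, of "\<lambda>p. enn2real (g n p)"]
        g_meas by (rule mp[OF _ conjI]) simp
    moreover have "atom_sum (X \<omega>) (\<lambda>(t, s). g n (t, shift_pts t (X \<omega>))) =
        (\<integral>\<^sup>+x. g n (fst x, shift_pts (fst x) (X \<omega>)) \<partial>X \<omega>)" if "\<omega> \<in> space M" for \<omega>
      using N11_atom_sum[OF X\<omega>(2)[OF that] gX[OF that]] by (simp add: case_prod_beta')
    ultimately show ?thesis by (simp add: g_real cong: nn_integral_cong)
  qed
  have SUP_X: "(\<integral>\<^sup>+x. G (fst x, shift_pts (fst x) (X \<omega>)) \<partial>X \<omega>) =
      (SUP n. \<integral>\<^sup>+x. g n (fst x, shift_pts (fst x) (X \<omega>)) \<partial>X \<omega>)" if "\<omega> \<in> space M" for \<omega>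
    using nn_integral_monotone_convergence_SUP[of "\<lambda>n x. g n (fst x, shift_pts (fst x) (X \<omega>))" "X \<omega>"]
      measurable_N11[OF X\<omega>(2)[OF that] gX[OF that]]
    by (simp add: g_SUP incseq_def le_fun_def g_inc)
  have SUP_Xt: "(\<integral>\<^sup>+\<omega>. G (t, Xt \<omega>) \<partial>P) = (SUP n. \<integral>\<^sup>+\<omega>. g n (t, Xt \<omega>) \<partial>P)" for t
    using nn_integral_monotone_convergence_SUP[of "\<lambda>n \<omega>. g n (t, Xt \<omega>)" P] measurable_Pair2[OF gXt, of t]
    by (simp add: g_SUP incseq_def le_fun_def g_inc)
  have "(\<integral>\<^sup>+\<omega>. \<integral>\<^sup>+x. G (fst x, shift_pts (fst x) (X \<omega>)) \<partial>X \<omega> \<partial>M) =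
      (\<integral>\<^sup>+\<omega>. (SUP n. \<integral>\<^sup>+x. g n (fst x, shift_pts (fst x) (X \<omega>)) \<partial>X \<omega>) \<partial>M)"
    by (intro nn_integral_cong SUP_X)
  also have "\<dots> = (SUP n. \<integral>\<^sup>+\<omega>. \<integral>\<^sup>+x. g n (fst x, shift_pts (fst x) (X \<omega>)) \<partial>X \<omega> \<partial>M)"
  proof (rule nn_integral_monotone_convergence_SUP)
    show "incseq (\<lambda>n \<omega>. \<integral>\<^sup>+x. g n (fst x, shift_pts (fst x) (X \<omega>)) \<partial>X \<omega>)"
      unfolding incseq_def le_fun_def by (intro allI impI nn_integral_mono g_inc)
    show "(\<lambda>\<omega>. \<integral>\<^sup>+x. g n (fst x, shift_pts (fst x) (X \<omega>)) \<partial>X \<omega>) \<in> borel_measurable M" for n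
      using kernel_nn_integral_measurable_pair[OF X11 gXx[of n]] by simp
  qed
  also have "\<dots> = (SUP n. ennreal lam * (\<integral>\<^sup>+t. \<integral>\<^sup>+\<omega>. g n (t, Xt \<omega>) \<partial>P \<partial>lborel))"
    by (simp only: g_palm)
  also have "\<dots> = ennreal lam * (SUP n. \<integral>\<^sup>+t. \<integral>\<^sup>+\<omega>. g n (t, Xt \<omega>) \<partial>P \<partial>lborel)"
    by (rule SUP_mult_left_ennreal[symmetric])
  also have "(SUP n. \<integral>\<^sup>+t. \<integral>\<^sup>+\<omega>. g n (t, Xt \<omega>) \<partial>P \<partial>lborel) =
      (\<integral>\<^sup>+t. (SUP n. \<integral>\<^sup>+\<omega>. g n (t, Xt \<omega>) \<partial>P) \<partial>lborel)"
  proof (rule nn_integral_monotone_convergence_SUP[symmetric])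
    show "incseq (\<lambda>n t. \<integral>\<^sup>+\<omega>. g n (t, Xt \<omega>) \<partial>P)"
      unfolding incseq_def le_fun_def by (intro allI impI nn_integral_mono g_inc)
    show "(\<lambda>t. \<integral>\<^sup>+\<omega>. g n (t, Xt \<omega>) \<partial>P) \<in> borel_measurable lborel" for n
      using P.borel_measurable_nn_integral_fst[OF gXt[of n]] by simp
  qed
  also have "\<dots> = (\<integral>\<^sup>+t. \<integral>\<^sup>+\<omega>. G (t, Xt \<omega>) \<partial>P \<partial>lborel)"
    by (simp only: SUP_Xt)
  finally show ?thesis .
qed

lemma nn_integral_translated_cube:
  "(\<integral>\<^sup>+z. indicator (cbox 0 One) (t + z) \<partial>lborel) = (1 :: ennreal)" for t :: "'a::euclidean_space"
proof -
  have "(\<integral>\<^sup>+z. indicator (cbox 0 One) (t + z) \<partial>lborel) =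
      (\<integral>\<^sup>+z. indicator (cbox 0 One) z \<partial>distr lborel borel ((+) t) :: ennreal)"
    by (subst nn_integral_distr) auto
  also have "\<dots> = emeasure lborel (cbox 0 One :: 'a set)"
    by (simp add: lborel_distr_plus)
  also have "\<dots> = 1" by (simp add: emeasure_lborel_cbox_eq)
  finally show ?thesis .
qed

text \<open>A mass transport argument. Both sides come from one sum over pairs (x, y) of points of X
  with y in the unit cube: the Palm formula is applied once with x and once with y as the
  distinguished point. The cube makes the sum local, and Lebesgue integration over the position then
  removes it, because every translate of the cube has volume 1.\<close>

lemma palm_exchange:
  fixes k :: "(real ^ 'd) \<times> ('d::finite) point measure \<Rightarrow> ennreal"
  assumes palm: "palm_version M X lam P Xt" and X: "marked_point_process M X" and lam: "0 < lam"
    and k: "k \<in> borel_measurable (borel \<Otimes>\<^sub>M N10_space)"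
  shows "(\<integral>\<^sup>+\<omega>. \<integral>\<^sup>+x. k (fst x, Xt \<omega>) \<partial>Xt \<omega> \<partial>P) =
    (\<integral>\<^sup>+\<omega>. \<integral>\<^sup>+x. k (- fst x, shift_pts (fst x) (Xt \<omega>)) \<partial>Xt \<omega> \<partial>P)"
proof -
  interpret P: prob_space P using palm by (simp add: palm_version_def marked_point_process_def)
  interpret PL: pair_sigma_finite P lborel ..
  have X10: "X \<in> M \<rightarrow>\<^sub>M N10_space" using X by (simp add: marked_point_process_def)
  have Xt: "Xt \<in> P \<rightarrow>\<^sub>M N10_space" using palm by (simp add: palm_version_def marked_point_process_def)
  then have Xt11: "Xt \<in> P \<rightarrow>\<^sub>M N11_space" by (simp add: measurable_N10_space_iff)
  have X\<omega>: "X \<omega> \<in> N10" "X \<omega> \<in> N11" if "\<omega> \<in> space M" for \<omega>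
    using measurable_space[OF X10 that] N10_N11 by auto
  have Xt\<omega>: "Xt \<omega> \<in> N10" "Xt \<omega> \<in> N11" if "\<omega> \<in> space P" for \<omega>
    using measurable_space[OF Xt that] N10_N11 by auto
  let ?f = "indicator (cbox 0 One) :: real ^ 'd \<Rightarrow> ennreal"
  \<comment> \<open>Evaluated at a point and the configuration seen from it, \<open>G1\<close> sums
    over partners whose original position lies in the cube, while \<open>G2\<close> asks that the
    distinguished point itself lie there and sums \<open>k\<close> as seen from the
    partners.\<close>
  define G1 where "G1 p = (\<integral>\<^sup>+x. ?f (fst x + fst p) * k (fst x, snd p) \<partial>snd p)" for p
  define G2 where "G2 p = ?f (fst p) * (\<integral>\<^sup>+x. k (- fst x, shift_pts (fst x) (snd p)) \<partial>snd p)" for p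
  let ?S = "(borel :: (real ^ 'd) measure) \<Otimes>\<^sub>M (N10_space :: 'd point measure measure)"
  have snd11: "snd \<in> ?S \<rightarrow>\<^sub>M N11_space"
    using measurable_compose[OF measurable_snd N10_space_N11_space] by simp
  have fm: "?f \<in> borel_measurable borel" by simp
  have m1: "(\<lambda>q. ?f (fst (snd q) + fst (fst q)) * k (fst (snd q), snd (fst q))) \<in>
      borel_measurable (?S \<Otimes>\<^sub>M borel_EE)"
    by (intro borel_measurable_times_ennreal measurable_compose[OF _ fm] measurable_compose[OF _ k]
        measurable_Pair borel_measurable_add measurable_compose[OF measurable_snd fst_measurable_EE]
        measurable_compose[OF measurable_fst measurable_fst] measurable_compose[OF measurable_fst measurable_snd])
  have G1: "G1 \<in> borel_measurable ?S"
    unfolding G1_def using kernel_nn_integral_measurable_pair[OF snd11 m1] by simp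
  have m2: "(\<lambda>q. k (- fst (snd q), shift_pts (fst (snd q)) (snd (fst q)))) \<in> borel_measurable (?S \<Otimes>\<^sub>M borel_EE)"
    by (intro measurable_compose[OF _ k] measurable_Pair shift_measurable_N10 borel_measurable_uminus
        measurable_compose[OF measurable_snd fst_measurable_EE] measurable_compose[OF measurable_fst measurable_snd])
  have G2: "G2 \<in> borel_measurable ?S"
    unfolding G2_def using kernel_nn_integral_measurable_pair[OF snd11 m2]
    by (intro borel_measurable_times_ennreal measurable_compose[OF measurable_fst fm]) simp
  \<comment> \<open>Both sides equal the sum over pairs (x, y) with y in the cube of
    \<open>k (fst y - fst x, shift_pts (fst x) \<mu>)\<close>. Tonelli interchanges the two sums,
    and composing the two shifts in \<open>G2\<close> brings the configuration back to the one seen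
    from x.\<close>
  have pointwise: "(\<integral>\<^sup>+x. G1 (fst x, shift_pts (fst x) \<mu>) \<partial>\<mu>) = (\<integral>\<^sup>+x. G2 (fst x, shift_pts (fst x) \<mu>) \<partial>\<mu>)"
    if \<mu>: "\<mu> \<in> N10" for \<mu>
  proof -
    have \<mu>11: "\<mu> \<in> N11" using \<mu> N10_N11 by blast
    interpret sigma_finite_measure \<mu> by (rule N11_sigma_finite[OF \<mu>11])
    interpret pair_sigma_finite \<mu> \<mu> ..
    have shift: "shift_pts z \<mu> \<in> N10" "shift_pts z \<mu> \<in> N11" for z
      using shift_N10[OF \<mu>] N10_N11 by auto
    have k1: "(\<lambda>x. k (fst x - z, shift_pts z \<mu>)) \<in> borel_measurable borel_EE" for z
      using shift(1) by (intro measurable_compose[OF _ k]) simp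
    have k1': "(\<lambda>x. ?f (fst x + z) * k (fst x, shift_pts z \<mu>)) \<in> borel_measurable borel_EE" for z
      using shift(1) by (intro borel_measurable_times_ennreal measurable_compose[OF _ k] measurable_compose[OF _ fm]) simp_all
    have \<mu>const: "(\<lambda>q. \<mu>) \<in> borel_EE \<Otimes>\<^sub>M borel_EE \<rightarrow>\<^sub>M N10_space" using \<mu> by simp
    have kk: "(\<lambda>q. k (fst (snd q) - fst (fst q), shift_pts (fst (fst q)) \<mu>)) \<in> borel_measurable (borel_EE \<Otimes>\<^sub>M borel_EE)"
      by (intro measurable_compose[OF _ k] measurable_Pair shift_measurable_N10 \<mu>const borel_measurable_diff) measurable
    have k2: "(\<lambda>x. k (fst y - fst x, shift_pts (fst x) \<mu>)) \<in> borel_measurable borel_EE" if "y \<in> EE" for y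
      using measurable_Pair1[OF kk, of y] that by simp
    have k2': "(\<lambda>x. k (- fst x, shift_pts (fst x) \<nu>)) \<in> borel_measurable borel_EE" if "\<nu> \<in> N10" for \<nu>
      using that by (intro measurable_compose[OF _ k] measurable_Pair shift_measurable_N10) measurable
    have "(\<integral>\<^sup>+x. G1 (fst x, shift_pts (fst x) \<mu>) \<partial>\<mu>) =
        (\<integral>\<^sup>+x. \<integral>\<^sup>+y. ?f (fst y) * k (fst y - fst x, shift_pts (fst x) \<mu>) \<partial>\<mu> \<partial>\<mu>)"
      unfolding G1_def using nn_integral_shift[OF \<mu>11 k1'] by (intro nn_integral_cong) simp
    also have "\<dots> = (\<integral>\<^sup>+y. \<integral>\<^sup>+x. ?f (fst y) * k (fst y - fst x, shift_pts (fst x) \<mu>) \<partial>\<mu> \<partial>\<mu>)"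
    proof (rule Fubini'[symmetric])
      have "(\<lambda>q. ?f (fst (snd q)) * k (fst (snd q) - fst (fst q), shift_pts (fst (fst q)) \<mu>)) \<in>
          borel_measurable (borel_EE \<Otimes>\<^sub>M borel_EE)"
        using kk by (intro borel_measurable_times_ennreal measurable_compose[OF _ fm]) measurable
      moreover have "sets (\<mu> \<Otimes>\<^sub>M \<mu>) = sets (borel_EE \<Otimes>\<^sub>M borel_EE)"
        by (intro sets_pair_measure_cong N11_sets \<mu>11)
      ultimately show "(\<lambda>(x, y). ?f (fst y) * k (fst y - fst x, shift_pts (fst x) \<mu>)) \<in> borel_measurable (\<mu> \<Otimes>\<^sub>M \<mu>)"
        by (simp add: case_prod_beta' cong: measurable_cong_sets)
    qed
    also have "\<dots> = (\<integral>\<^sup>+y. ?f (fst y) * (\<integral>\<^sup>+x. k (fst y - fst x, shift_pts (fst x) \<mu>) \<partial>\<mu>) \<partial>\<mu>)"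
      using k2 by (intro nn_integral_cong nn_integral_cmult measurable_N11[OF \<mu>11]) (simp add: N11_space_eq[OF \<mu>11])
    also have "\<dots> = (\<integral>\<^sup>+x. G2 (fst x, shift_pts (fst x) \<mu>) \<partial>\<mu>)"
      unfolding G2_def
      using nn_integral_shift[OF \<mu>11 k2'[OF shift(1)]] by (intro nn_integral_cong) (simp add: shift_shift[OF \<mu>11])
    finally show ?thesis .
  qed
  have "ennreal lam * (\<integral>\<^sup>+t. \<integral>\<^sup>+\<omega>. G1 (t, Xt \<omega>) \<partial>P \<partial>lborel) =
      ennreal lam * (\<integral>\<^sup>+t. \<integral>\<^sup>+\<omega>. G2 (t, Xt \<omega>) \<partial>P \<partial>lborel)"
    using palm_version_nn_integral[OF palm X G1] palm_version_nn_integral[OF palm X G2] pointwise X\<omega>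
    by (simp cong: nn_integral_cong)
  then have eq: "(\<integral>\<^sup>+t. \<integral>\<^sup>+\<omega>. G1 (t, Xt \<omega>) \<partial>P \<partial>lborel) = (\<integral>\<^sup>+t. \<integral>\<^sup>+\<omega>. G2 (t, Xt \<omega>) \<partial>P \<partial>lborel)"
    using lam by (simp add: ennreal_mult_cancel_left)
  have GXt: "(\<lambda>(\<omega>, t). G (t, Xt \<omega>)) \<in> borel_measurable (P \<Otimes>\<^sub>M lborel)"
    if "G \<in> borel_measurable ?S" for G :: "(real ^ 'd) \<times> 'd point measure \<Rightarrow> ennreal"
    unfolding case_prod_beta'
    by (intro measurable_compose[OF _ that] measurable_Pair measurable_compose[OF measurable_fst Xt]) simp
  have kXt: "(\<lambda>x. k (fst x, Xt \<omega>)) \<in> borel_measurable borel_EE" if "\<omega> \<in> space P" for \<omega>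
    using Xt\<omega>[OF that] by (intro measurable_compose[OF _ k]) simp
  have "(\<integral>\<^sup>+t. \<integral>\<^sup>+\<omega>. G1 (t, Xt \<omega>) \<partial>P \<partial>lborel) = (\<integral>\<^sup>+\<omega>. \<integral>\<^sup>+t. G1 (t, Xt \<omega>) \<partial>lborel \<partial>P)"
    using PL.Fubini'[OF GXt[OF G1]] by simp
  also have "\<dots> = (\<integral>\<^sup>+\<omega>. \<integral>\<^sup>+x. k (fst x, Xt \<omega>) \<partial>Xt \<omega> \<partial>P)"
  proof (rule nn_integral_cong)
    fix \<omega> assume \<omega>: "\<omega> \<in> space P"
    interpret sigma_finite_measure "Xt \<omega>" by (rule N11_sigma_finite[OF Xt\<omega>(2)[OF \<omega>]])
    interpret pair_sigma_finite "Xt \<omega>" "lborel :: (real ^ 'd) measure" ..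
    have kf: "(\<lambda>q. ?f (fst (fst q) + snd q) * k (fst (fst q), Xt \<omega>)) \<in> borel_measurable (borel_EE \<Otimes>\<^sub>M lborel)"
      by (intro borel_measurable_times_ennreal measurable_compose[OF _ fm] measurable_compose[OF measurable_fst kXt[OF \<omega>]]
           borel_measurable_add measurable_compose[OF measurable_fst fst_measurable_EE]) simp
    have "sets (Xt \<omega> \<Otimes>\<^sub>M (lborel :: (real ^ 'd) measure)) = sets (borel_EE \<Otimes>\<^sub>M lborel)"
      by (intro sets_pair_measure_cong N11_sets Xt\<omega>(2) \<omega> refl)
    then have "(borel_measurable (Xt \<omega> \<Otimes>\<^sub>M (lborel :: (real ^ 'd) measure)) :: (_ \<Rightarrow> ennreal) set) = borel_measurable (borel_EE \<Otimes>\<^sub>M lborel)"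
      by (rule measurable_cong_sets) simp
    with kf have "(\<lambda>(x, t). ?f (fst x + t) * k (fst x, Xt \<omega>)) \<in> borel_measurable (Xt \<omega> \<Otimes>\<^sub>M lborel)"
      by (simp only: case_prod_beta')
    from Fubini'[OF this]
    have "(\<integral>\<^sup>+t. G1 (t, Xt \<omega>) \<partial>lborel) = (\<integral>\<^sup>+x. \<integral>\<^sup>+t. ?f (fst x + t) * k (fst x, Xt \<omega>) \<partial>lborel \<partial>Xt \<omega>)"
      by (simp add: G1_def)
    also have "\<dots> = (\<integral>\<^sup>+x. (\<integral>\<^sup>+t. ?f (fst x + t) \<partial>lborel) * k (fst x, Xt \<omega>) \<partial>Xt \<omega>)"
      by (intro nn_integral_cong nn_integral_multc) simp
    also have "\<dots> = (\<integral>\<^sup>+x. k (fst x, Xt \<omega>) \<partial>Xt \<omega>)"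
      by (simp add: nn_integral_translated_cube)
    finally show "(\<integral>\<^sup>+t. G1 (t, Xt \<omega>) \<partial>lborel) = (\<integral>\<^sup>+x. k (fst x, Xt \<omega>) \<partial>Xt \<omega>)" .
  qed
  finally have 1: "(\<integral>\<^sup>+t. \<integral>\<^sup>+\<omega>. G1 (t, Xt \<omega>) \<partial>P \<partial>lborel) = (\<integral>\<^sup>+\<omega>. \<integral>\<^sup>+x. k (fst x, Xt \<omega>) \<partial>Xt \<omega> \<partial>P)" .
  have "(\<integral>\<^sup>+t. \<integral>\<^sup>+\<omega>. G2 (t, Xt \<omega>) \<partial>P \<partial>lborel) = (\<integral>\<^sup>+\<omega>. \<integral>\<^sup>+t. G2 (t, Xt \<omega>) \<partial>lborel \<partial>P)"
    using PL.Fubini'[OF GXt[OF G2]] by simp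
  also have "\<dots> = (\<integral>\<^sup>+\<omega>. \<integral>\<^sup>+x. k (- fst x, shift_pts (fst x) (Xt \<omega>)) \<partial>Xt \<omega> \<partial>P)"
    using nn_integral_translated_cube[of "0 :: real ^ 'd"]
    by (simp add: G2_def nn_integral_multc del: nn_integral_indicator)
  finally show ?thesis using 1 eq by simp
qed

section \<open>Conditioning on a large score\<close>

text \<open>This is b(\<mu>(z)), and 0 if there is no point at z. The integral form avoids the
  unspecified value of \<open>score\<close> and makes joint measurability in position and
  configuration a statement about kernels.\<close>

definition mark :: "(real \<Rightarrow> ennreal) \<Rightarrow> real ^ 'd \<Rightarrow> ('d::finite) point measure \<Rightarrow> ennreal" where
  "mark b z \<mu> = (\<integral>\<^sup>+x. indicator {z} (fst x) * b (snd x) \<partial>\<mu>)"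

lemma mark_integrand_measurable [measurable]:
  fixes b :: "real \<Rightarrow> ennreal"
  assumes b: "b \<in> borel_measurable borel"
  shows "(\<lambda>x. indicator {z :: real ^ 'd} (fst x) * b (snd x)) \<in> borel_measurable (borel_EE :: ('d::finite) point measure)"
  by (intro borel_measurable_times_ennreal measurable_compose[OF fst_measurable_EE borel_measurable_indicator]
      measurable_compose[OF snd_measurable_EE b]) simp

lemma mark_atom:
  assumes \<mu>: "\<mu> \<in> N11" and x: "(t, s) \<in> atoms \<mu>" and b: "b \<in> borel_measurable borel"
  shows "mark b t \<mu> = b s"
proof -
  have "mark b t \<mu> = atom_sum \<mu> (\<lambda>x. indicator {t} (fst x) * b (snd x))"
    unfolding mark_def by (rule N11_atom_sum[OF \<mu> mark_integrand_measurable[OF b], symmetric])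
  also have "\<dots> = (\<integral>\<^sup>+x. b s * indicator {(t, s)} x \<partial>count_space (atoms \<mu>))"
    unfolding atom_sum_def
  proof (rule nn_integral_cong)
    fix y assume y: "y \<in> space (count_space (atoms \<mu>))"
    show "indicator {t} (fst y) * b (snd y) = b s * indicator {(t, s)} y"
    proof (cases "fst y = t")
      case True
      then have "snd y = s" using y N11_atoms_unique[OF \<mu> _ x, of "snd y"] by (cases y) simp
      then show ?thesis using True by (cases y) simp
    qed (auto simp: indicator_def)
  qed
  also have "\<dots> = b s"
    using x by (subst nn_integral_cmult_indicator) auto
  finally show ?thesis .
qed

lemma mark_eq_0:
  assumes \<mu>: "\<mu> \<in> N11" and "\<And>s. (z, s) \<in> atoms \<mu> \<Longrightarrow> b s = 0"
  shows "mark b z \<mu> = 0"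
proof -
  have "AE x in \<mu>. indicator {z} (fst x) * b (snd x) = 0"
    using N11_AE_atoms[OF \<mu>] by eventually_elim (use assms(2) in \<open>auto simp: indicator_def\<close>)
  then have "mark b z \<mu> = (\<integral>\<^sup>+x. 0 \<partial>\<mu>)" unfolding mark_def by (rule nn_integral_cong_AE)
  then show ?thesis by simp
qed

lemma mark_shift:
  assumes "\<mu> \<in> N11" "b \<in> borel_measurable borel"
  shows "mark b z (shift_pts w \<mu>) = mark b (z + w) \<mu>"
proof -
  have "indicator {z} (t - w) = (indicator {z + w} t :: ennreal)" for t
    by (simp add: indicator_def diff_eq_eq)
  then show ?thesis
    using nn_integral_shift[OF assms(1) mark_integrand_measurable[OF assms(2), of z], of w] by (simp add: mark_def)
qed

lemma mark_scaling:
  assumes "\<mu> \<in> N11" "0 < u" "b \<in> borel_measurable borel" "0 < v"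
  shows "mark b 0 (scaling v u \<mu>) = mark (\<lambda>s. b (s / u)) 0 \<mu>"
proof -
  have "indicator {0} (t /\<^sub>R v) = (indicator {0} t :: ennreal)" for t :: "real ^ 'a"
    using assms(4) by (simp add: indicator_def)
  then show ?thesis
    using nn_integral_scaling[OF assms(1,2) mark_integrand_measurable[OF assms(3), of 0], of v] by (simp add: mark_def)
qed

lemma mark_measurable_pair:
  assumes [measurable]: "b \<in> borel_measurable borel"
  shows "(\<lambda>p. mark b (fst p) (snd p)) \<in> borel_measurable (borel \<Otimes>\<^sub>M N11_space)"
proof -
  let ?S = "(borel :: (real ^ 'a) measure) \<Otimes>\<^sub>M (N11_space :: 'a point measure measure)"
  \<comment> \<open>The singleton must not move with the argument: membership in {z} is expressed by
    the difference being 0, which is measurable jointly in t and z.\<close>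
  have "(\<lambda>q. indicator {0} (fst (snd q) - fst (fst q)) * b (snd (snd q))) \<in> borel_measurable (?S \<Otimes>\<^sub>M borel_EE)"
    by (intro borel_measurable_times_ennreal measurable_compose[OF _ borel_measurable_indicator[of _ "borel :: (real ^ 'a) measure"]]
        measurable_compose[OF measurable_snd measurable_compose[OF snd_measurable_EE assms]]
        borel_measurable_diff measurable_compose[OF measurable_snd fst_measurable_EE]
        measurable_compose[OF measurable_fst measurable_fst]) simp_all
  moreover have "indicator {0} (t - z) = (indicator {z} t :: ennreal)" for z t :: "real ^ 'a"
    by (simp add: indicator_def)
  ultimately have "(\<lambda>q. indicator {fst (fst q)} (fst (snd q)) * b (snd (snd q))) \<in> borel_measurable (?S \<Otimes>\<^sub>M borel_EE)"
    by simp
  from kernel_nn_integral_measurable_pair[OF measurable_snd this] show ?thesis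
    by (simp add: mark_def)
qed

lemma mark_measurable [measurable]:
  assumes "b \<in> borel_measurable borel"
  shows "mark b z \<in> borel_measurable N11_space"
  using measurable_Pair2[OF mark_measurable_pair[OF assms], of z] by simp

section \<open>Events of a large score at a position\<close>

lemma score_atom: "\<mu> \<in> N11 \<Longrightarrow> (t, s) \<in> atoms \<mu> \<Longrightarrow> score \<mu> t = s"
  unfolding score_def by (rule the_equality) (assumption, rule N11_atoms_unique)

lemma half_column_sets [measurable]:
  "0 \<le> u \<Longrightarrow> {t} \<times> {u<..} \<in> sets (borel_EE :: ('d::finite) point measure)"
  by (auto simp: sets_borel_EE EE_def intro!: borel_Times)

lemma N11_ex_atom:
  assumes "\<mu> \<in> N11" "emeasure \<mu> A \<noteq> 0" "A \<in> sets borel_EE" obtains x where "x \<in> atoms \<mu>" "x \<in> A"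
proof -
  have "\<exists>x\<in>atoms \<mu>. x \<in> A"
  proof (rule ccontr)
    assume "\<not> ?thesis"
    then have "A \<subseteq> EE - atoms \<mu>" using sets.sets_into_space[OF assms(3)] by auto
    then have "emeasure \<mu> A = 0"
      using N11_diffuse_part_null[OF assms(1)] emeasure_mono[of A "EE - atoms \<mu>" \<mu>] by (auto simp: null_sets_def)
    then show False using assms(2) by simp
  qed
  then show ?thesis using that by blast
qed

lemma emeasure_half_column:
  assumes "\<mu> \<in> N11" "(t, s) \<in> atoms \<mu>" "0 \<le> u" "u < s"
  shows "emeasure \<mu> ({t} \<times> {u<..}) = 1"
proof (rule antisym)
  have "emeasure \<mu> ({t} \<times> {u<..}) \<le> emeasure \<mu> ({t} \<times> {0<..})"
    using assms by (intro emeasure_mono) (auto simp: N11_sets)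
  also have "\<dots> \<le> 1" by (rule N11_column[OF assms(1)])
  finally show "emeasure \<mu> ({t} \<times> {u<..}) \<le> 1" .
  have "1 = emeasure \<mu> {(t, s)}" using N11_atom_one[OF assms(1,2)] by simp
  also have "\<dots> \<le> emeasure \<mu> ({t} \<times> {u<..})"
    using assms by (intro emeasure_mono) (auto simp: N11_sets)
  finally show "1 \<le> emeasure \<mu> ({t} \<times> {u<..})" .
qed

text \<open>Where \<open>\<mu>\<close> has no point at position \<open>t\<close>, its score there is the junk value \<^term>\<open>THE s::real. False\<close>,
  so beyond that level a large score really comes from a point.\<close>

lemma score_greater_iff:
  assumes \<mu>: "\<mu> \<in> N11" and u: "0 \<le> u" "(THE s. False) \<le> u"
  shows "u < score \<mu> t \<longleftrightarrow> emeasure \<mu> ({t} \<times> {u<..}) \<noteq> 0"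
proof (cases "\<exists>s. (t, s) \<in> atoms \<mu>")
  case True
  then obtain s where s: "(t, s) \<in> atoms \<mu>" by blast
  show ?thesis
  proof
    assume "u < score \<mu> t"
    then show "emeasure \<mu> ({t} \<times> {u<..}) \<noteq> 0"
      using emeasure_half_column[OF \<mu> s u(1)] score_atom[OF \<mu> s] by simp
  next
    assume "emeasure \<mu> ({t} \<times> {u<..}) \<noteq> 0"
    from N11_ex_atom[OF \<mu> this half_column_sets[OF u(1)]] obtain s' where "(t, s') \<in> atoms \<mu>" "u < s'" by auto
    then show "u < score \<mu> t" using score_atom[OF \<mu>] by simp
  qed
next
  case False
  then have "score \<mu> t = (THE s. False)" by (simp add: score_def)
  moreover have "emeasure \<mu> ({t} \<times> {u<..}) = 0"
    using False N11_ex_atom[OF \<mu> _ half_column_sets[OF u(1)], of t] by fastforce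
  ultimately show ?thesis using u by simp
qed

text \<open>The identity to be proved with soft indicators of both scores. If b is the indicator of
  the scores above 1 and the law has a point of such a score at the origin almost surely, the factor
  \<open>mark b 0 \<mu>\<close> is 1 and the claim remains. Keeping this factor makes the expression
  symmetric in the two points.\<close>

definition exchange :: "(real \<Rightarrow> ennreal) \<Rightarrow> ('d::finite) point measure measure \<Rightarrow> bool" where
  "exchange b \<nu> \<longleftrightarrow> (\<forall>h \<in> borel_measurable (borel \<Otimes>\<^sub>M N11_space).
     (\<integral>\<^sup>+\<mu>. mark b 0 \<mu> * (\<integral>\<^sup>+x. b (snd x) * h (fst x, \<mu>) \<partial>\<mu>) \<partial>\<nu>) =
     (\<integral>\<^sup>+\<mu>. mark b 0 \<mu> * (\<integral>\<^sup>+x. b (snd x) * h (- fst x, shift_pts (fst x) \<mu>) \<partial>\<mu>) \<partial>\<nu>))"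

text \<open>Re-centring at a point x turns the mark at 0 into the mark at x, and the mark at the
  reflected position into the mark at 0. The product of the two marks is therefore the same from
  either point, and only the argument of h changes. The shift commutes with the scaling once its
  vector is divided by v.\<close>

lemma palm_exchange_scaled:
  fixes h :: "(real ^ 'd) \<times> ('d::finite) point measure \<Rightarrow> ennreal"
  assumes palm: "palm_version M X lam P Xt" and X: "marked_point_process M X" and lam: "0 < lam"
    and uv: "0 < u" "0 < v" and b [measurable]: "b \<in> borel_measurable borel"
    and h: "h \<in> borel_measurable (borel \<Otimes>\<^sub>M N11_space)"
  shows "(\<integral>\<^sup>+\<omega>. mark b 0 (scaling v u (Xt \<omega>)) *
      (\<integral>\<^sup>+x. b (snd x) * h (fst x, scaling v u (Xt \<omega>)) \<partial>scaling v u (Xt \<omega>)) \<partial>P) =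
    (\<integral>\<^sup>+\<omega>. mark b 0 (scaling v u (Xt \<omega>)) *
      (\<integral>\<^sup>+x. b (snd x) * h (- fst x, shift_pts (fst x) (scaling v u (Xt \<omega>))) \<partial>scaling v u (Xt \<omega>)) \<partial>P)"
proof -
  have Xt: "Xt \<in> P \<rightarrow>\<^sub>M N10_space" using palm by (simp add: palm_version_def marked_point_process_def)
  have Xt\<omega>: "Xt \<omega> \<in> N11" if "\<omega> \<in> space P" for \<omega>
    using measurable_space[OF Xt that] N10_N11 by auto
  define b' where "b' s = b (s / u)" for s
  have b' [measurable]: "b' \<in> borel_measurable borel" unfolding b'_def by measurable
  let ?T = "scaling v u :: 'd point measure \<Rightarrow> _"
  \<comment> \<open>The second factor is the mark at the position of the other point. For points of
    the configuration it equals b of their scaled score, by simplicity.\<close>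
  define k where "k p = mark b' 0 (snd p) * (mark b' (fst p) (snd p) * h (fst p /\<^sub>R v, ?T (snd p)))" for p
  have k11: "k \<in> borel_measurable (borel \<Otimes>\<^sub>M N11_space)"
    unfolding k_def
    by (intro borel_measurable_times_ennreal mark_measurable_pair b' measurable_compose[OF measurable_snd mark_measurable]
        measurable_compose[OF _ h] measurable_Pair measurable_compose[OF measurable_snd scaling_measurable] uv)
      measurable
  have "(\<lambda>p. (fst p, snd p)) \<in> borel \<Otimes>\<^sub>M N10_space \<rightarrow>\<^sub>M borel \<Otimes>\<^sub>M N11_space"
    by (intro measurable_Pair measurable_compose[OF measurable_snd N10_space_N11_space]) simp
  from measurable_compose[OF this k11] have k: "k \<in> borel_measurable (borel \<Otimes>\<^sub>M N10_space)"
    by simp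
  have lhs: "(\<integral>\<^sup>+x. k (fst x, \<mu>) \<partial>\<mu>) = mark b 0 (?T \<mu>) * (\<integral>\<^sup>+x. b (snd x) * h (fst x, ?T \<mu>) \<partial>?T \<mu>)"
    and rhs: "(\<integral>\<^sup>+x. k (- fst x, shift_pts (fst x) \<mu>) \<partial>\<mu>) =
      mark b 0 (?T \<mu>) * (\<integral>\<^sup>+x. b (snd x) * h (- fst x, shift_pts (fst x) (?T \<mu>)) \<partial>?T \<mu>)"
    if \<mu>: "\<mu> \<in> N11" for \<mu>
  proof -
    have T: "?T \<mu> \<in> N11" by (rule scaling_N11[OF \<mu> uv])
    have m0: "mark b 0 (?T \<mu>) = mark b' 0 \<mu>"
      unfolding b'_def by (rule mark_scaling[OF \<mu> uv(1) b uv(2)])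
    have AE: "AE x in \<mu>. mark b' (fst x) \<mu> = b' (snd x)"
      using N11_AE_atoms[OF \<mu>] by eventually_elim (use mark_atom[OF \<mu> _ b'] in auto)
    have m1: "(\<lambda>x. b (snd x) * h (fst x, ?T \<mu>)) \<in> borel_measurable borel_EE"
      using T by (intro borel_measurable_times_ennreal measurable_compose[OF _ h] measurable_Pair) simp_all
    have m2: "(\<lambda>x. b (snd x) * h (- fst x, shift_pts (fst x) (?T \<mu>))) \<in> borel_measurable borel_EE"
      using T by (intro borel_measurable_times_ennreal measurable_compose[OF _ h] measurable_Pair shift_measurable) simp_all
    have div: "(\<lambda>x. (fst x /\<^sub>R v, snd x / u)) \<in> borel_EE \<rightarrow>\<^sub>M borel_EE"
      using rescale_measurable[OF uv(1), of 0 v] by (simp add: rescale_def[abs_def])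
    have "(\<integral>\<^sup>+x. k (fst x, \<mu>) \<partial>\<mu>) = (\<integral>\<^sup>+x. mark b' 0 \<mu> * (b' (snd x) * h (fst x /\<^sub>R v, ?T \<mu>)) \<partial>\<mu>)"
      unfolding k_def using AE by (intro nn_integral_cong_AE) auto
    also have "\<dots> = mark b' 0 \<mu> * (\<integral>\<^sup>+x. b' (snd x) * h (fst x /\<^sub>R v, ?T \<mu>) \<partial>\<mu>)"
      using measurable_compose[OF div m1] by (intro nn_integral_cmult measurable_N11[OF \<mu>]) (simp add: b'_def)
    finally show "(\<integral>\<^sup>+x. k (fst x, \<mu>) \<partial>\<mu>) = mark b 0 (?T \<mu>) * (\<integral>\<^sup>+x. b (snd x) * h (fst x, ?T \<mu>) \<partial>?T \<mu>)"
      by (simp add: m0 nn_integral_scaling[OF \<mu> uv(1) m1] b'_def)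
    have "(\<integral>\<^sup>+x. k (- fst x, shift_pts (fst x) \<mu>) \<partial>\<mu>) =
        (\<integral>\<^sup>+x. mark b' 0 \<mu> * (b' (snd x) * h (- (fst x /\<^sub>R v), shift_pts (fst x /\<^sub>R v) (?T \<mu>))) \<partial>\<mu>)"
      unfolding k_def using AE
      by (intro nn_integral_cong_AE) (auto simp: mark_shift[OF \<mu> b'] scaling_shift[OF \<mu> uv] mult_ac)
    also have "\<dots> = mark b' 0 \<mu> * (\<integral>\<^sup>+x. b' (snd x) * h (- (fst x /\<^sub>R v), shift_pts (fst x /\<^sub>R v) (?T \<mu>)) \<partial>\<mu>)"
      using measurable_compose[OF div m2] by (intro nn_integral_cmult measurable_N11[OF \<mu>]) (simp add: b'_def)
    finally show "(\<integral>\<^sup>+x. k (- fst x, shift_pts (fst x) \<mu>) \<partial>\<mu>) =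
      mark b 0 (?T \<mu>) * (\<integral>\<^sup>+x. b (snd x) * h (- fst x, shift_pts (fst x) (?T \<mu>)) \<partial>?T \<mu>)"
      by (simp add: m0 nn_integral_scaling[OF \<mu> uv(1) m2] b'_def)
  qed
  show ?thesis
    using palm_exchange[OF palm X lam k] by (simp add: lhs rhs Xt\<omega> cong: nn_integral_cong)
qed

section \<open>Laws of the rescaled Palm version given a large score at the origin\<close>

definition tail_law ::
  "'v measure \<Rightarrow> ('v \<Rightarrow> ('d::finite) point measure) \<Rightarrow> real \<Rightarrow> real \<Rightarrow> 'd point measure measure" where
  "tail_law P Xt v u = distr (uniform_measure P {\<omega> \<in> space P. u < score (Xt \<omega>) 0}) N11_space
     (\<lambda>\<omega>. scaling v u (Xt \<omega>))"

text \<open>What the conditioned laws and the law of the tail configuration share. Approximations of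
  functionals have to be good only on configurations with a point of score above 1 at the
  origin.\<close>

definition anchored :: "('d::finite) point measure measure \<Rightarrow> bool" where
  "anchored \<nu> \<longleftrightarrow> prob_space \<nu> \<and> sets \<nu> = sets N11_space \<and> (AE \<mu> in \<nu>. emeasure \<mu> ({0} \<times> {1<..}) = 1)"

lemma score_event_sets:
  assumes Xt: "Xt \<in> P \<rightarrow>\<^sub>M N11_space" and u: "0 \<le> u" "(THE s. False) \<le> u"
  shows "{\<omega> \<in> space P. u < score (Xt \<omega>) 0} \<in> sets P"
proof -
  have "{\<omega> \<in> space P. u < score (Xt \<omega>) 0} = {\<omega> \<in> space P. emeasure (Xt \<omega>) ({0} \<times> {u<..}) \<noteq> 0}"
    using score_greater_iff[OF _ u] measurable_space[OF Xt] by auto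
  also have "\<dots> \<in> sets P"
    using measurable_compose[OF Xt N11_emeasure_measurable[OF half_column_sets[OF u(1)]]] by measurable
  finally show ?thesis .
qed

text \<open>Off the conditioning event a score at the origin is at most u, hence at most 1 after
  scaling, and the factor \<open>mark b 0\<close> vanishes. Each conditional integral is thus the
  unconditional one divided by the probability of the event, the same on both sides.\<close>

lemma tail_law_exchange:
  fixes Xt :: "'v \<Rightarrow> ('d::finite) point measure"
  assumes palm: "palm_version M X lam P Xt" and X: "marked_point_process M X" and lam: "0 < lam"
    and uv: "0 < u" "0 < v" "(THE s. False) \<le> u"
    and b [measurable]: "b \<in> borel_measurable borel" and b0: "\<And>s. s \<le> 1 \<Longrightarrow> b s = 0"
  shows "exchange b (tail_law P Xt v u)"
  unfolding exchange_def
proof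
  fix h :: "(real ^ 'd) \<times> 'd point measure \<Rightarrow> ennreal"
  assume h: "h \<in> borel_measurable (borel \<Otimes>\<^sub>M N11_space)"
  have Xt10: "Xt \<in> P \<rightarrow>\<^sub>M N10_space" using palm by (simp add: palm_version_def marked_point_process_def)
  then have Xt: "Xt \<in> P \<rightarrow>\<^sub>M N11_space" by (simp add: measurable_N10_space_iff)
  let ?A = "{\<omega> \<in> space P. u < score (Xt \<omega>) 0}" and ?T = "scaling v u :: 'd point measure \<Rightarrow> _"
  have A: "?A \<in> sets P" using score_event_sets[OF Xt] uv by simp
  have TXt: "(\<lambda>\<omega>. ?T (Xt \<omega>)) \<in> P \<rightarrow>\<^sub>M N11_space"
    using measurable_compose[OF Xt scaling_measurable[OF uv(1,2)]] .
  have cond: "(\<integral>\<^sup>+\<mu>. mark b 0 \<mu> * \<Phi> \<mu> \<partial>tail_law P Xt v u) =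
      (\<integral>\<^sup>+\<omega>. mark b 0 (?T (Xt \<omega>)) * \<Phi> (?T (Xt \<omega>)) \<partial>P) / emeasure P ?A"
    if \<Phi>: "\<Phi> \<in> borel_measurable N11_space" for \<Phi>
  proof -
    have m: "(\<lambda>\<mu>. mark b 0 \<mu> * \<Phi> \<mu>) \<in> borel_measurable N11_space" using \<Phi> by measurable
    have "(\<integral>\<^sup>+\<mu>. mark b 0 \<mu> * \<Phi> \<mu> \<partial>tail_law P Xt v u) =
        (\<integral>\<^sup>+\<omega>. mark b 0 (?T (Xt \<omega>)) * \<Phi> (?T (Xt \<omega>)) \<partial>uniform_measure P ?A)"
      unfolding tail_law_def using TXt m by (intro nn_integral_distr) simp_all
    also have "\<dots> = (\<integral>\<^sup>+\<omega>. mark b 0 (?T (Xt \<omega>)) * \<Phi> (?T (Xt \<omega>)) * indicator ?A \<omega> \<partial>P) / emeasure P ?A"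
      using measurable_compose[OF TXt m] A by (intro nn_integral_uniform_measure)
    also have "(\<integral>\<^sup>+\<omega>. mark b 0 (?T (Xt \<omega>)) * \<Phi> (?T (Xt \<omega>)) * indicator ?A \<omega> \<partial>P) =
        (\<integral>\<^sup>+\<omega>. mark b 0 (?T (Xt \<omega>)) * \<Phi> (?T (Xt \<omega>)) \<partial>P)"
    proof (rule nn_integral_cong)
      fix \<omega> assume \<omega>: "\<omega> \<in> space P"
      then have N: "Xt \<omega> \<in> N11" using measurable_space[OF Xt] by simp
      have "mark b 0 (?T (Xt \<omega>)) = 0" if "\<omega> \<notin> ?A"
        unfolding mark_scaling[OF N uv(1) b uv(2)]
      proof (rule mark_eq_0[OF N])
        fix s assume "(0, s) \<in> atoms (Xt \<omega>)"
        then have "s \<le> u" using that score_atom[OF N] \<omega> by auto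
        then show "b (s / u) = 0" using uv by (intro b0) simp
      qed
      then show "mark b 0 (?T (Xt \<omega>)) * \<Phi> (?T (Xt \<omega>)) * indicator ?A \<omega> = mark b 0 (?T (Xt \<omega>)) * \<Phi> (?T (Xt \<omega>))"
        by (auto simp: indicator_def)
    qed
    finally show ?thesis .
  qed
  have m1: "(\<lambda>q. b (snd (snd q)) * h (fst (snd q), fst q)) \<in> borel_measurable (N11_space \<Otimes>\<^sub>M borel_EE)"
    by (intro borel_measurable_times_ennreal measurable_compose[OF _ h] measurable_Pair) measurable
  have m2: "(\<lambda>q. b (snd (snd q)) * h (- fst (snd q), shift_pts (fst (snd q)) (fst q))) \<in> borel_measurable (N11_space \<Otimes>\<^sub>M borel_EE)"
    by (intro borel_measurable_times_ennreal measurable_compose[OF _ h] measurable_Pair shift_measurable) measurable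
  have id: "(\<lambda>\<mu>. \<mu>) \<in> N11_space \<rightarrow>\<^sub>M N11_space" by simp
  show "(\<integral>\<^sup>+\<mu>. mark b 0 \<mu> * (\<integral>\<^sup>+x. b (snd x) * h (fst x, \<mu>) \<partial>\<mu>) \<partial>tail_law P Xt v u) =
     (\<integral>\<^sup>+\<mu>. mark b 0 \<mu> * (\<integral>\<^sup>+x. b (snd x) * h (- fst x, shift_pts (fst x) \<mu>) \<partial>\<mu>) \<partial>tail_law P Xt v u)"
    using kernel_nn_integral_measurable_pair[OF id m1] kernel_nn_integral_measurable_pair[OF id m2]
      palm_exchange_scaled[OF palm X lam uv(1,2) b h]
    by (simp add: cond)
qed

lemma tail_law_anchored:
  assumes Xt: "Xt \<in> P \<rightarrow>\<^sub>M N11_space" and P: "prob_space P"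
    and uv: "0 < u" "0 < v" "(THE s. False) \<le> u"
    and pos: "emeasure P {\<omega> \<in> space P. u < score (Xt \<omega>) 0} \<noteq> 0"
  shows "anchored (tail_law P Xt v u)"
proof -
  let ?A = "{\<omega> \<in> space P. u < score (Xt \<omega>) 0}" and ?T = "scaling v u :: 'b point measure \<Rightarrow> _"
  interpret P: prob_space P by fact
  have A: "?A \<in> sets P" using score_event_sets[OF Xt] uv by simp
  have TXt: "(\<lambda>\<omega>. ?T (Xt \<omega>)) \<in> uniform_measure P ?A \<rightarrow>\<^sub>M N11_space"
    using measurable_compose[OF Xt scaling_measurable[OF uv(1,2)]] by simp
  interpret U: prob_space "uniform_measure P ?A"
    using pos by (intro prob_space_uniform_measure) auto
  have "AE \<omega> in uniform_measure P ?A. emeasure (?T (Xt \<omega>)) ({0} \<times> {1<..}) = 1"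
  proof (rule AE_uniform_measureI[OF A], intro AE_I2 impI)
    fix \<omega> assume \<omega>: "\<omega> \<in> space P" "\<omega> \<in> ?A"
    then have N: "Xt \<omega> \<in> N11" using measurable_space[OF Xt] by simp
    have "emeasure (Xt \<omega>) ({0} \<times> {u<..}) \<noteq> 0"
      using score_greater_iff[OF N, of u 0] \<omega> uv by simp
    from N11_ex_atom[OF N this half_column_sets] uv obtain s where s: "(0, s) \<in> atoms (Xt \<omega>)" "u < s" by auto
    have "emeasure (?T (Xt \<omega>)) ({0} \<times> {1<..}) = (\<integral>\<^sup>+x. indicator ({0} \<times> {1<..}) x \<partial>?T (Xt \<omega>))"
      using N11_sets[OF scaling_N11[OF N uv(1,2)]] by simp
    also have "\<dots> = (\<integral>\<^sup>+x. indicator ({0} \<times> {1<..}) (fst x /\<^sub>R v, snd x / u) \<partial>Xt \<omega>)"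
      by (intro nn_integral_scaling N uv) simp
    also have "\<dots> = (\<integral>\<^sup>+x. indicator ({0} \<times> {u<..}) x \<partial>Xt \<omega>)"
      using uv by (intro nn_integral_cong) (auto simp: indicator_def field_simps)
    also have "\<dots> = 1"
      using emeasure_half_column[OF N s(1) _ s(2)] uv by (simp add: N11_sets[OF N])
    finally show "emeasure (?T (Xt \<omega>)) ({0} \<times> {1<..}) = 1" .
  qed
  then have "AE \<mu> in tail_law P Xt v u. emeasure \<mu> ({0} \<times> {1<..}) = 1"
    unfolding tail_law_def by (subst AE_distr_iff[OF TXt]) measurable
  moreover have "prob_space (tail_law P Xt v u)"
    unfolding tail_law_def by (rule U.prob_space_distr[OF TXt])
  ultimately show ?thesis unfolding anchored_def by (simp add: tail_law_def)
qed

section \<open>Vaguely continuous functionals\<close>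

text \<open>A convenient subclass of \<open>test_functions\<close>. Continuity on the whole vector
  space permits free composition and products, and nonnegativity lets Bochner and Lebesgue integrals
  be exchanged without further conditions.\<close>

definition local_fun :: "(('d::finite) point \<Rightarrow> real) \<Rightarrow> bool" where
  "local_fun f \<longleftrightarrow> continuous_on UNIV f \<and> (\<exists>C. \<forall>x. 0 \<le> f x \<and> f x \<le> C) \<and>
     (\<exists>R \<epsilon>. 0 < \<epsilon> \<and> (\<forall>x. f x \<noteq> 0 \<longrightarrow> x \<in> window R \<epsilon>))"

lemma local_funI:
  assumes "continuous_on UNIV f" "\<And>x. 0 \<le> f x" "\<And>x. f x \<le> C" "0 < \<epsilon>" "\<And>x. f x \<noteq> 0 \<Longrightarrow> x \<in> window R \<epsilon>"
  shows "local_fun f"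
  using assms unfolding local_fun_def by blast

lemma local_fun_nonneg: "local_fun f \<Longrightarrow> 0 \<le> f x"
  unfolding local_fun_def by blast

lemma local_fun_measurable: "local_fun f \<Longrightarrow> f \<in> borel_measurable borel_EE"
  by (intro measurable_EE borel_measurable_continuous_onI) (simp add: local_fun_def)

lemma local_fun_test:
  fixes f :: "('d::finite) point \<Rightarrow> real"
  assumes "local_fun f" shows "f \<in> test_functions"
proof -
  obtain C R \<epsilon> where C: "\<And>x. 0 \<le> f x" "\<And>x. f x \<le> C" and \<epsilon>: "0 < \<epsilon>" "\<And>x. f x \<noteq> 0 \<Longrightarrow> x \<in> window R \<epsilon>"
    using assms unfolding local_fun_def by blast
  let ?S = "{x \<in> EE. f x \<noteq> 0}" and ?K = "cball 0 R \<times> {\<epsilon>..} :: 'd point set"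
  have "window R \<epsilon> \<subseteq> ?K" by (auto simp: window_def)
  then have "?S \<subseteq> ?K" using \<epsilon>(2) by blast
  moreover have "closed ?K" by (intro closed_Times closed_cball closed_atLeast)
  ultimately have cl: "closure ?S \<subseteq> ?K" by (rule closure_minimal)
  have "EE \<inter> closure ?S \<in> sets borel_EE"
    by (auto simp: sets_borel_EE EE_borel)
  \<comment> \<open>The closure may reach the level \<epsilon> itself, while \<open>B11\<close> asks
    for scores strictly above a positive level; hence \<epsilon> / 2.\<close>
  moreover have "EE \<inter> closure ?S \<subseteq> cball 0 R \<times> {\<epsilon> / 2<..}"
    using cl \<epsilon>(1) by fastforce
  ultimately have "EE \<inter> closure ?S \<in> B11"
    unfolding B11_def using \<epsilon>(1)
    by (intro CollectI conjI exI[of _ "cball 0 R"] exI[of _ "\<epsilon> / 2"]) auto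
  moreover have "bounded (f ` EE)"
    unfolding bounded_iff using C by (intro exI[of _ C]) auto
  moreover have "continuous_on EE f"
    using assms continuous_on_subset unfolding local_fun_def by blast
  ultimately show ?thesis by (simp add: test_functions_def)
qed

lemma N11_integrable_bounded:
  assumes \<mu>: "\<mu> \<in> N11" and f: "f \<in> borel_measurable borel_EE"
    and \<epsilon>: "0 < \<epsilon>" and C: "\<And>x. x \<in> EE \<Longrightarrow> \<bar>f x\<bar> \<le> C * indicator (window R \<epsilon>) x"
  shows "integrable \<mu> (f :: ('d::finite) point \<Rightarrow> real)"
proof (rule Bochner_Integration.integrable_bound)
  show "integrable \<mu> (\<lambda>x. C * indicator (window R \<epsilon>) x)"
    using N11_window_finite[OF \<mu> \<epsilon>, of R] \<epsilon>
    by (intro integrable_mult_right integrable_real_indicator) (simp_all add: N11_sets[OF \<mu>] window_sets)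
  show "f \<in> borel_measurable \<mu>" by (rule measurable_N11[OF \<mu> f])
  show "AE x in \<mu>. norm (f x) \<le> norm (C * indicator (window R \<epsilon>) x)"
    using C by (intro AE_I2) (fastforce simp: N11_space_eq[OF \<mu>] intro: order_trans)
qed

lemma local_fun_integrable:
  assumes \<mu>: "\<mu> \<in> N11" and f: "local_fun f" shows "integrable \<mu> f"
proof -
  obtain C R \<epsilon> where C: "\<And>x. 0 \<le> f x" "\<And>x. f x \<le> C" and \<epsilon>: "0 < \<epsilon>" "\<And>x. f x \<noteq> 0 \<Longrightarrow> x \<in> window R \<epsilon>"
    using f unfolding local_fun_def by blast
  have "\<bar>f x\<bar> \<le> C * indicator (window R \<epsilon>) x" for x
    using C[of x] \<epsilon>(2)[of x] by (cases "x \<in> window R \<epsilon>") auto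
  then show ?thesis
    by (intro N11_integrable_bounded[OF \<mu> local_fun_measurable[OF f] \<epsilon>(1), of C R])
qed

lemma local_fun_nn_integral:
  assumes "\<mu> \<in> N11" "local_fun f" shows "(\<integral>\<^sup>+x. ennreal (f x) \<partial>\<mu>) = ennreal (\<integral>x. f x \<partial>\<mu>)"
  using assms by (intro nn_integral_eq_integral local_fun_integrable AE_I2 local_fun_nonneg)

lemma local_fun_integral_nonneg: "local_fun f \<Longrightarrow> 0 \<le> (\<integral>x. f x \<partial>\<mu>)"
  by (intro integral_nonneg_AE AE_I2 local_fun_nonneg)

lemma topspace_vague [simp]: "topspace vague_topology = N11"
proof
  show "topspace vague_topology \<subseteq> N11"
    unfolding vague_topology_def topology_generated_by_topspace by blast
  \<comment> \<open>A generated topology has the union of its generators as underlying space; the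
    zero test function with the open set \<open>UNIV\<close> contributes all of
    \<open>N11\<close>.\<close>
  have "local_fun (\<lambda>x. 0 :: real)" by (intro local_funI[of _ 0 1]) auto
  then have "{\<mu> \<in> N11. (\<integral>x. 0 \<partial>\<mu>) \<in> (UNIV :: real set)} \<in>
      {{\<mu> \<in> N11. (\<integral>x. f x \<partial>\<mu>) \<in> U} | f U. f \<in> test_functions \<and> open U}"
    using local_fun_test open_UNIV by blast
  then show "N11 \<subseteq> topspace vague_topology"
    unfolding vague_topology_def topology_generated_by_topspace by auto
qed

text \<open>The \<sigma>-algebra of \<open>N11_space\<close> is generated by evaluations of sets and
  not by vaguely open sets, so measurability is carried along with continuity instead of being
  deduced from it.\<close>

definition tame :: "(('d::finite) point measure \<Rightarrow> real) \<Rightarrow> bool" where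
  "tame F \<longleftrightarrow> continuous_map vague_topology euclideanreal F \<and> F \<in> borel_measurable N11_space"

lemma tame_measurable: "tame F \<Longrightarrow> F \<in> borel_measurable N11_space"
  by (simp add: tame_def)

lemma tame_cong:
  assumes "tame F" "\<And>\<mu>. \<mu> \<in> N11 \<Longrightarrow> F \<mu> = G \<mu>" shows "tame G"
  using assms continuous_map_eq[of vague_topology euclideanreal F G] measurable_cong[of N11_space F G borel]
  by (simp add: tame_def)

lemma tame_integral:
  assumes f: "local_fun f" shows "tame (\<lambda>\<mu>. \<integral>x. f x \<partial>\<mu>)"
  unfolding tame_def
proof
  show "continuous_map vague_topology euclideanreal (\<lambda>\<mu>. \<integral>x. f x \<partial>\<mu>)"
    unfolding continuous_map_def
  proof (intro conjI allI impI)
    fix U :: "real set" assume "openin euclideanreal U"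
    then have "{\<mu> \<in> N11. (\<integral>x. f x \<partial>\<mu>) \<in> U} \<in>
        {{\<mu> \<in> N11. (\<integral>x. f x \<partial>\<mu>) \<in> U} | f U. f \<in> test_functions \<and> open U}"
      using local_fun_test[OF f] by auto
    then show "openin vague_topology {\<mu> \<in> topspace vague_topology. (\<integral>x. f x \<partial>\<mu>) \<in> U}"
      unfolding topspace_vague unfolding vague_topology_def by (rule topology_generated_by_Basis)
  qed simp
  have "(\<lambda>\<mu>. \<integral>\<^sup>+x. ennreal (f x) \<partial>\<mu>) \<in> borel_measurable N11_space"
    using measurable_compose[OF measurable_snd measurable_compose[OF local_fun_measurable[OF f] measurable_ennreal]]
    by (intro kernel_nn_integral_measurable) (simp_all add: case_prod_beta')
  then have "(\<lambda>\<mu>. enn2real (\<integral>\<^sup>+x. ennreal (f x) \<partial>\<mu>)) \<in> borel_measurable N11_space" by measurable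
  then show "(\<lambda>\<mu>. \<integral>x. f x \<partial>\<mu>) \<in> borel_measurable N11_space"
    by (rule measurable_cong[THEN iffD1, rotated])
      (simp add: local_fun_nn_integral[OF _ f] local_fun_integral_nonneg[OF f])
qed

lemma tame_const: "tame (\<lambda>\<mu>. c)"
  by (simp add: tame_def)

lemma tame_mult: "tame F \<Longrightarrow> tame G \<Longrightarrow> tame (\<lambda>\<mu>. F \<mu> * G \<mu>)"
  by (auto simp: tame_def intro: continuous_map_real_mult)

lemma tame_add: "tame F \<Longrightarrow> tame G \<Longrightarrow> tame (\<lambda>\<mu>. F \<mu> + G \<mu>)"
  by (auto simp: tame_def intro: continuous_map_add)

lemma tame_sum: "(\<And>j. j \<in> J \<Longrightarrow> tame (F j)) \<Longrightarrow> tame (\<lambda>\<mu>. \<Sum>j\<in>J. F j \<mu>)"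
  by (induction J rule: infinite_finite_induct) (auto intro: tame_add tame_const)

lemma tame_compose:
  assumes "tame F" "continuous_on UNIV \<phi>" shows "tame (\<lambda>\<mu>. \<phi> (F \<mu>))"
  using assms continuous_map_compose[of vague_topology euclideanreal F euclideanreal \<phi>]
    measurable_compose[of F N11_space borel \<phi> borel]
  by (simp add: tame_def comp_def borel_measurable_continuous_onI)

section \<open>Limits of integrals under weak convergence\<close>

lemma anchored_space: "anchored \<nu> \<Longrightarrow> space \<nu> = N11"
  using sets_eq_imp_space_eq[of \<nu> N11_space] by (simp add: anchored_def)

lemma anchored_integrable:
  assumes "anchored \<nu>" "F \<in> borel_measurable N11_space" "\<And>\<mu>. \<mu> \<in> N11 \<Longrightarrow> \<bar>F \<mu>\<bar> \<le> C"
  shows "integrable \<nu> (F :: _ \<Rightarrow> real)"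
proof -
  interpret prob_space \<nu> using assms(1) by (simp add: anchored_def)
  have "F \<in> borel_measurable \<nu>" using assms(1,2) by (simp add: anchored_def cong: measurable_cong_sets)
  then show ?thesis
    using assms(3) anchored_space[OF assms(1)] by (intro integrable_const_bound[of _ C]) auto
qed

lemma weak_limit_tame:
  assumes "weakly_converges vague_topology \<nu>s \<nu> G" "tame F" "\<And>\<mu>. \<mu> \<in> N11 \<Longrightarrow> \<bar>F \<mu>\<bar> \<le> C"
  shows "((\<lambda>i. \<integral>\<mu>. F \<mu> \<partial>\<nu>s i) \<longlongrightarrow> (\<integral>\<mu>. F \<mu> \<partial>\<nu>)) G"
proof -
  have "bounded (F ` topspace vague_topology)"
    unfolding bounded_iff using assms(3) by (intro exI[of _ C]) auto
  then show ?thesis using assms(1,2) unfolding weakly_converges_def tame_def by blast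
qed

text \<open>F itself need not be continuous. The error bound D is continuous, so a small integral
  under the limit law forces small integrals under the approximating laws eventually, and F differs
  from the continuous H by at most D in mean under all of them. Anchoring lets the bound be checked
  only where a point of score above 1 sits at the origin.\<close>

lemma weak_limit_approx:
  fixes F :: "('d::finite) point measure \<Rightarrow> real"
  assumes W: "weakly_converges vague_topology \<nu>s \<nu> G"
    and anch: "eventually (\<lambda>i. anchored (\<nu>s i)) G" "anchored \<nu>"
    and F: "F \<in> borel_measurable N11_space" "\<And>\<mu>. \<mu> \<in> N11 \<Longrightarrow> \<bar>F \<mu>\<bar> \<le> C"
    and approx: "\<And>e. 0 < e \<Longrightarrow> \<exists>H D C'. tame H \<and> tame D \<and> (\<forall>\<mu>\<in>N11. \<bar>H \<mu>\<bar> \<le> C' \<and> \<bar>D \<mu>\<bar> \<le> C') \<and>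
      (\<forall>\<mu>\<in>N11. emeasure \<mu> ({0} \<times> {1<..}) = 1 \<longrightarrow> \<bar>F \<mu> - H \<mu>\<bar> \<le> D \<mu>) \<and> (\<integral>\<mu>. D \<mu> \<partial>\<nu>) < e"
  shows "((\<lambda>i. \<integral>\<mu>. F \<mu> \<partial>\<nu>s i) \<longlongrightarrow> (\<integral>\<mu>. F \<mu> \<partial>\<nu>)) G"
proof (rule tendstoI)
  fix e :: real assume "0 < e"
  then have e3: "0 < e / 3" by simp
  from approx[OF e3] obtain H D C' where
    HDC: "tame H \<and> tame D \<and> (\<forall>\<mu>\<in>N11. \<bar>H \<mu>\<bar> \<le> C' \<and> \<bar>D \<mu>\<bar> \<le> C') \<and>
      (\<forall>\<mu>\<in>N11. emeasure \<mu> ({0} \<times> {1<..}) = 1 \<longrightarrow> \<bar>F \<mu> - H \<mu>\<bar> \<le> D \<mu>) \<and> (\<integral>\<mu>. D \<mu> \<partial>\<nu>) < e / 3"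
    by (elim exE) (rule that)
  have H: "tame H" "\<And>\<mu>. \<mu> \<in> N11 \<Longrightarrow> \<bar>H \<mu>\<bar> \<le> C'"
    and D: "tame D" "\<And>\<mu>. \<mu> \<in> N11 \<Longrightarrow> \<bar>D \<mu>\<bar> \<le> C'"
    and HD: "\<And>\<mu>. \<mu> \<in> N11 \<Longrightarrow> emeasure \<mu> ({0} \<times> {1<..}) = 1 \<Longrightarrow> \<bar>F \<mu> - H \<mu>\<bar> \<le> D \<mu>"
    and De: "(\<integral>\<mu>. D \<mu> \<partial>\<nu>) < e / 3"
    using HDC by blast+
  have close: "\<bar>(\<integral>\<mu>. F \<mu> \<partial>\<kappa>) - (\<integral>\<mu>. H \<mu> \<partial>\<kappa>)\<bar> \<le> (\<integral>\<mu>. D \<mu> \<partial>\<kappa>)" if \<kappa>: "anchored \<kappa>" for \<kappa>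
  proof -
    have int: "integrable \<kappa> F" "integrable \<kappa> H" "integrable \<kappa> D"
      using anchored_integrable[OF \<kappa>] F H(2) D(2) tame_measurable[OF H(1)] tame_measurable[OF D(1)] by blast+
    have AE: "AE \<mu> in \<kappa>. \<bar>F \<mu> - H \<mu>\<bar> \<le> D \<mu>"
    proof -
      have "AE \<mu> in \<kappa>. emeasure \<mu> ({0} \<times> {1<..}) = 1" using \<kappa> by (simp add: anchored_def)
      then show ?thesis using AE_space[of \<kappa>]
        by eventually_elim (simp add: anchored_space[OF \<kappa>] HD)
    qed
    have "\<bar>\<integral>\<mu>. F \<mu> - H \<mu> \<partial>\<kappa>\<bar> \<le> (\<integral>\<mu>. \<bar>F \<mu> - H \<mu>\<bar> \<partial>\<kappa>)" by (rule integral_abs_bound)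
    also have "\<dots> \<le> (\<integral>\<mu>. D \<mu> \<partial>\<kappa>)"
      using int AE by (intro integral_mono_AE integrable_abs Bochner_Integration.integrable_diff)
    finally show ?thesis using int by simp
  qed
  have "eventually (\<lambda>i. (\<integral>\<mu>. D \<mu> \<partial>\<nu>s i) < e / 3) G"
    using weak_limit_tame[OF W D] De by (rule order_tendstoD(2))
  moreover have "eventually (\<lambda>i. dist (\<integral>\<mu>. H \<mu> \<partial>\<nu>s i) (\<integral>\<mu>. H \<mu> \<partial>\<nu>) < e / 3) G"
    by (rule tendstoD[OF weak_limit_tame[OF W H] e3])
  ultimately show "eventually (\<lambda>i. dist (\<integral>\<mu>. F \<mu> \<partial>\<nu>s i) (\<integral>\<mu>. F \<mu> \<partial>\<nu>) < e) G"
    using anch(1)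
  proof eventually_elim
    case (elim i)
    then show ?case using close[OF elim(3)] close[OF anch(2)] De unfolding dist_real_def by linarith
  qed
qed

section \<open>Functionals that are Lipschitz under shifts\<close>

lemma local_fun_shift:
  fixes f :: "('d::finite) point \<Rightarrow> real"
  assumes "local_fun f" shows "local_fun (\<lambda>x. f (fst x - z, snd x))"
proof -
  obtain C R \<epsilon> where C: "\<And>x. 0 \<le> f x" "\<And>x. f x \<le> C" and \<epsilon>: "0 < \<epsilon>" "\<And>x. f x \<noteq> 0 \<Longrightarrow> x \<in> window R \<epsilon>"
    using assms unfolding local_fun_def by blast
  show ?thesis
  proof (rule local_funI[OF _ C(1) C(2) \<epsilon>(1)])
    have "continuous_on UNIV f" using assms by (simp add: local_fun_def)
    then show "continuous_on UNIV (\<lambda>x. f (fst x - z, snd x))"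
      by (rule continuous_on_compose2) (auto intro!: continuous_intros)
    fix x assume "f (fst x - z, snd x) \<noteq> 0"
    then have "norm (fst x - z) < R" "\<epsilon> < snd x" using \<epsilon>(2)[of "(fst x - z, snd x)"] by (auto simp: mem_window)
    then show "x \<in> window (R + norm z) \<epsilon>"
      using norm_triangle_sub[of "fst x" z] by (cases x) (simp add: mem_window)
  qed
qed

lemma integral_shift:
  fixes f :: "('d::finite) point \<Rightarrow> real"
  assumes "\<mu> \<in> N11" "f \<in> borel_measurable borel_EE"
  shows "(\<integral>x. f x \<partial>shift_pts z \<mu>) = (\<integral>x. f (fst x - z, snd x) \<partial>\<mu>)"
proof -
  have "rescale z 1 1 \<in> \<mu> \<rightarrow>\<^sub>M borel_EE" by (intro measurable_N11[OF assms(1)] rescale_measurable) simp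
  from integral_distr[OF this assms(2)] show ?thesis
    by (simp add: shift_eq_distr[OF assms(1)] rescale_def)
qed

definition mass :: "real \<Rightarrow> real \<Rightarrow> ('d::finite) point measure \<Rightarrow> real" where
  "mass R \<epsilon> \<mu> = measure \<mu> (window R \<epsilon>)"

lemma mass_nonneg: "0 \<le> mass R \<epsilon> \<mu>"
  by (simp add: mass_def)

lemma mass_mono:
  assumes "\<mu> \<in> N11" "R \<le> R'" "0 < \<epsilon>'" "\<epsilon>' \<le> \<epsilon>" shows "mass R \<epsilon> \<mu> \<le> mass R' \<epsilon>' \<mu>"
  unfolding mass_def measure_def using N11_window_finite[OF assms(1,3), of R'] assms
  by (intro enn2real_mono emeasure_mono window_mono) (simp_all add: N11_sets window_sets)

lemma integral_window_bound:
  fixes f :: "('d::finite) point \<Rightarrow> real"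
  assumes \<mu>: "\<mu> \<in> N11" and f: "f \<in> borel_measurable borel_EE"
    and \<epsilon>: "0 < \<epsilon>" and C: "\<And>x. x \<in> EE \<Longrightarrow> \<bar>f x\<bar> \<le> C * indicator (window R \<epsilon>) x"
  shows "\<bar>\<integral>x. f x \<partial>\<mu>\<bar> \<le> C * mass R \<epsilon> \<mu>"
proof -
  have sets: "window R \<epsilon> \<in> sets \<mu>" using \<epsilon> by (simp add: N11_sets[OF \<mu>] window_sets)
  have int: "integrable \<mu> (\<lambda>x. C * indicator (window R \<epsilon>) x)"
    using N11_window_finite[OF \<mu> \<epsilon>, of R] sets by (intro integrable_mult_right integrable_real_indicator) simp_all
  have "\<bar>\<integral>x. f x \<partial>\<mu>\<bar> \<le> (\<integral>x. \<bar>f x\<bar> \<partial>\<mu>)" by (rule integral_abs_bound)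
  also have "\<dots> \<le> (\<integral>x. C * indicator (window R \<epsilon>) x \<partial>\<mu>)"
    using C N11_integrable_bounded[OF \<mu> f \<epsilon> C] int
    by (intro integral_mono integrable_abs) (simp_all add: N11_space_eq[OF \<mu>])
  also have "\<dots> = C * mass R \<epsilon> \<mu>"
    using sets by (simp add: mass_def)
  finally show ?thesis .
qed

text \<open>Moving the frame by z - w may change the contribution of every nearby point, so the
  Lipschitz constant in the shift is proportional to the number of points in a window and cannot be
  uniform in the configuration. The radius R keeps all shifted supports inside one window.\<close>

definition shift_lipschitz :: "(('d::finite) point measure \<Rightarrow> real) \<Rightarrow> bool" where
  "shift_lipschitz \<Psi> \<longleftrightarrow> (\<forall>\<mu>\<in>N11. 0 \<le> \<Psi> \<mu> \<and> \<Psi> \<mu> \<le> 1) \<and> (\<forall>z. tame (\<lambda>\<mu>. \<Psi> (shift_pts z \<mu>))) \<and>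
     (\<forall>R. \<exists>L R' \<epsilon>. 0 \<le> L \<and> 0 < \<epsilon> \<and> (\<forall>\<mu>\<in>N11. \<forall>z w. norm z \<le> R \<longrightarrow> norm w \<le> R \<longrightarrow>
        \<bar>\<Psi> (shift_pts z \<mu>) - \<Psi> (shift_pts w \<mu>)\<bar> \<le> L * norm (z - w) * mass R' \<epsilon> \<mu>))"

lemma shift_lipschitz_bounds: "shift_lipschitz \<Psi> \<Longrightarrow> \<mu> \<in> N11 \<Longrightarrow> 0 \<le> \<Psi> \<mu> \<and> \<Psi> \<mu> \<le> 1"
  by (simp add: shift_lipschitz_def)

lemma shift_lipschitz_tame_shift: "shift_lipschitz \<Psi> \<Longrightarrow> tame (\<lambda>\<mu>. \<Psi> (shift_pts z \<mu>))"
  by (simp add: shift_lipschitz_def)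

lemma shift_lipschitz_measurable: "shift_lipschitz \<Psi> \<Longrightarrow> \<Psi> \<in> borel_measurable N11_space"
  using tame_measurable[OF tame_cong[OF shift_lipschitz_tame_shift[of \<Psi> 0]], of \<Psi>] by (simp add: shift_0)

lemma shift_lipschitz_mult:
  assumes 1: "shift_lipschitz \<Psi>" and 2: "shift_lipschitz \<Phi>"
  shows "shift_lipschitz (\<lambda>\<mu>. \<Psi> \<mu> * \<Phi> \<mu>)"
  unfolding shift_lipschitz_def
proof (intro conjI allI ballI)
  fix \<mu> :: "'a point measure" assume "\<mu> \<in> N11"
  then show "0 \<le> \<Psi> \<mu> * \<Phi> \<mu>" "\<Psi> \<mu> * \<Phi> \<mu> \<le> 1"
    using shift_lipschitz_bounds[OF 1] shift_lipschitz_bounds[OF 2] by (simp_all add: mult_le_one)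
next
  fix z show "tame (\<lambda>\<mu>. \<Psi> (shift_pts z \<mu>) * \<Phi> (shift_pts z \<mu>))"
    by (intro tame_mult shift_lipschitz_tame_shift 1 2)
next
  fix R
  from 1 obtain L1 R1 \<epsilon>1 where L1: "0 \<le> L1" "0 < \<epsilon>1"
    "\<And>\<mu> z w. \<mu> \<in> N11 \<Longrightarrow> norm z \<le> R \<Longrightarrow> norm w \<le> R \<Longrightarrow>
      \<bar>\<Psi> (shift_pts z \<mu>) - \<Psi> (shift_pts w \<mu>)\<bar> \<le> L1 * norm (z - w) * mass R1 \<epsilon>1 \<mu>"
    unfolding shift_lipschitz_def by metis
  from 2 obtain L2 R2 \<epsilon>2 where L2: "0 \<le> L2" "0 < \<epsilon>2"
    "\<And>\<mu> z w. \<mu> \<in> N11 \<Longrightarrow> norm z \<le> R \<Longrightarrow> norm w \<le> R \<Longrightarrow>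
      \<bar>\<Phi> (shift_pts z \<mu>) - \<Phi> (shift_pts w \<mu>)\<bar> \<le> L2 * norm (z - w) * mass R2 \<epsilon>2 \<mu>"
    unfolding shift_lipschitz_def by metis
  have "\<bar>\<Psi> (shift_pts z \<mu>) * \<Phi> (shift_pts z \<mu>) - \<Psi> (shift_pts w \<mu>) * \<Phi> (shift_pts w \<mu>)\<bar> \<le>
      (L1 + L2) * norm (z - w) * mass (max R1 R2) (min \<epsilon>1 \<epsilon>2) \<mu>"
    if \<mu>: "\<mu> \<in> N11" and zw: "norm z \<le> R" "norm w \<le> R" for \<mu> z w
  proof -
    let ?m = "mass (max R1 R2) (min \<epsilon>1 \<epsilon>2) \<mu>"
    have b: "\<bar>\<Psi> (shift_pts z \<mu>)\<bar> \<le> 1" "\<bar>\<Phi> (shift_pts w \<mu>)\<bar> \<le> 1"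
      using shift_lipschitz_bounds[OF 1 shift_N11[OF \<mu>]] shift_lipschitz_bounds[OF 2 shift_N11[OF \<mu>]] by simp_all
    have "\<bar>\<Psi> (shift_pts z \<mu>) * \<Phi> (shift_pts z \<mu>) - \<Psi> (shift_pts w \<mu>) * \<Phi> (shift_pts w \<mu>)\<bar> =
        \<bar>\<Psi> (shift_pts z \<mu>) * (\<Phi> (shift_pts z \<mu>) - \<Phi> (shift_pts w \<mu>)) +
          (\<Psi> (shift_pts z \<mu>) - \<Psi> (shift_pts w \<mu>)) * \<Phi> (shift_pts w \<mu>)\<bar>"
      by (simp add: algebra_simps)
    also have "\<dots> \<le> 1 * \<bar>\<Phi> (shift_pts z \<mu>) - \<Phi> (shift_pts w \<mu>)\<bar> + \<bar>\<Psi> (shift_pts z \<mu>) - \<Psi> (shift_pts w \<mu>)\<bar> * 1"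
      using b by (intro order_trans[OF abs_triangle_ineq] add_mono) (auto simp only: abs_mult intro!: mult_right_mono mult_left_mono)
    also have "\<dots> \<le> L2 * norm (z - w) * mass R2 \<epsilon>2 \<mu> + L1 * norm (z - w) * mass R1 \<epsilon>1 \<mu>"
      using L1(3)[OF \<mu> zw] L2(3)[OF \<mu> zw] by simp
    also have "\<dots> \<le> L2 * norm (z - w) * ?m + L1 * norm (z - w) * ?m"
      using L1(1,2) L2(1,2) by (intro add_mono mult_left_mono mass_mono \<mu>) auto
    finally show ?thesis by (simp add: algebra_simps)
  qed
  then show "\<exists>L R' \<epsilon>. 0 \<le> L \<and> 0 < \<epsilon> \<and> (\<forall>\<mu>\<in>N11. \<forall>z w. norm z \<le> R \<longrightarrow> norm w \<le> R \<longrightarrow>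
      \<bar>\<Psi> (shift_pts z \<mu>) * \<Phi> (shift_pts z \<mu>) - \<Psi> (shift_pts w \<mu>) * \<Phi> (shift_pts w \<mu>)\<bar> \<le> L * norm (z - w) * mass R' \<epsilon> \<mu>)"
    using L1(1,2) L2(1,2)
    by (intro exI[of _ "L1 + L2"] exI[of _ "max R1 R2"] exI[of _ "min \<epsilon>1 \<epsilon>2"]) auto
qed

text \<open>Two shifted copies of f differ by at most K times the distance of the shift vectors, and
  only on the window of radius \<open>Rf + R\<close> that contains both supports. Integration
  contributes the mass of this window, and \<phi> the factor K'.\<close>

lemma shift_lipschitz_integral:
  fixes f :: "('d::finite) point \<Rightarrow> real"
  assumes f: "local_fun f" and K: "0 \<le> K" "\<And>t t' s. \<bar>f (t, s) - f (t', s)\<bar> \<le> K * norm (t - t')"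
    and \<phi>: "continuous_on UNIV \<phi>" "\<And>x. 0 \<le> \<phi> x" "\<And>x. \<phi> x \<le> 1"
    and K': "0 \<le> K'" "\<And>x y. \<bar>\<phi> x - \<phi> y\<bar> \<le> K' * \<bar>x - y\<bar>"
  shows "shift_lipschitz (\<lambda>\<mu>. \<phi> (\<integral>x. f x \<partial>\<mu>))"
  unfolding shift_lipschitz_def
proof (intro conjI allI ballI)
  fix z
  show "tame (\<lambda>\<mu>. \<phi> (\<integral>x. f x \<partial>shift_pts z \<mu>))"
    by (rule tame_cong[OF tame_compose[OF tame_integral[OF local_fun_shift[OF f, of z]] \<phi>(1)]])
      (simp add: integral_shift local_fun_measurable[OF f])
next
  fix R
  obtain Rf \<epsilon> where \<epsilon>: "0 < \<epsilon>" "\<And>x. f x \<noteq> 0 \<Longrightarrow> x \<in> window Rf \<epsilon>"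
    using f unfolding local_fun_def by blast
  have "\<bar>\<phi> (\<integral>x. f x \<partial>shift_pts z \<mu>) - \<phi> (\<integral>x. f x \<partial>shift_pts w \<mu>)\<bar> \<le>
      K' * K * norm (z - w) * mass (Rf + R) \<epsilon> \<mu>"
    if \<mu>: "\<mu> \<in> N11" and zw: "norm z \<le> R" "norm w \<le> R" for \<mu> z w
  proof -
    have zero: "f (fst x - y, snd x) = 0" if "x \<notin> window (Rf + R) \<epsilon>" "norm y \<le> R" for x y
    proof (rule ccontr)
      assume "f (fst x - y, snd x) \<noteq> 0"
      then have "norm (fst x - y) < Rf" "\<epsilon> < snd x" using \<epsilon>(2)[of "(fst x - y, snd x)"] by (auto simp: mem_window)
      then have "x \<in> window (Rf + R) \<epsilon>"
        using norm_triangle_sub[of "fst x" y] that(2) by (cases x) (simp add: mem_window)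
      then show False using that(1) by simp
    qed
    have bound: "\<bar>f (fst x - z, snd x) - f (fst x - w, snd x)\<bar> \<le> K * norm (z - w) * indicator (window (Rf + R) \<epsilon>) x" for x
      using zero[of x] zw K(2)[of "fst x - z" "snd x" "fst x - w"]
      by (cases "x \<in> window (Rf + R) \<epsilon>") (auto simp: norm_minus_commute)
    have "\<bar>(\<integral>x. f x \<partial>shift_pts z \<mu>) - (\<integral>x. f x \<partial>shift_pts w \<mu>)\<bar> =
        \<bar>\<integral>x. f (fst x - z, snd x) - f (fst x - w, snd x) \<partial>\<mu>\<bar>"
      using local_fun_integrable[OF \<mu> local_fun_shift[OF f]]
      by (simp add: integral_shift[OF \<mu> local_fun_measurable[OF f]])
    also have "\<dots> \<le> K * norm (z - w) * mass (Rf + R) \<epsilon> \<mu>"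
      using bound local_fun_measurable[OF local_fun_shift[OF f]]
      by (intro integral_window_bound \<mu> \<epsilon> borel_measurable_diff) auto
    finally have "K' * \<bar>(\<integral>x. f x \<partial>shift_pts z \<mu>) - (\<integral>x. f x \<partial>shift_pts w \<mu>)\<bar> \<le> K' * (K * norm (z - w) * mass (Rf + R) \<epsilon> \<mu>)"
      using K'(1) by (rule mult_left_mono)
    with K'(2)[of "\<integral>x. f x \<partial>shift_pts z \<mu>" "\<integral>x. f x \<partial>shift_pts w \<mu>"] show ?thesis
      by (simp add: mult.assoc)
  qed
  then show "\<exists>L R' \<epsilon>. 0 \<le> L \<and> 0 < \<epsilon> \<and> (\<forall>\<mu>\<in>N11. \<forall>z w. norm z \<le> R \<longrightarrow> norm w \<le> R \<longrightarrow>
      \<bar>\<phi> (\<integral>x. f x \<partial>shift_pts z \<mu>) - \<phi> (\<integral>x. f x \<partial>shift_pts w \<mu>)\<bar> \<le> L * norm (z - w) * mass R' \<epsilon> \<mu>)"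
    using K(1) K'(1) \<epsilon>(1)
    by (intro exI[of _ "K' * K"] exI[of _ "Rf + R"] exI[of _ \<epsilon>]) auto
qed (use \<phi> in auto)

section \<open>A partition of unity subordinate to a fine net of a ball\<close>

lemma partition_of_unity_ball:
  fixes R \<delta> :: real
  assumes "0 < \<delta>"
  obtains J and \<theta> :: "'a::euclidean_space \<Rightarrow> 'a \<Rightarrow> real"
  where "finite J" "J \<subseteq> cball 0 R" "\<And>j. continuous_on UNIV (\<theta> j)" "\<And>j t. 0 \<le> \<theta> j t"
    "\<And>j t. j \<in> J \<Longrightarrow> \<theta> j t \<le> 1"
    "\<And>j t. \<theta> j t \<noteq> 0 \<Longrightarrow> norm (t - j) < \<delta>" "\<And>t. norm t \<le> R \<Longrightarrow> (\<Sum>j\<in>J. \<theta> j t) = 1"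
proof -
  have "seq_compact (cball 0 R :: 'a set)" by (simp add: compact_imp_seq_compact)
  from seq_compact_imp_totally_bounded[OF this, rule_format, OF half_gt_zero[OF assms]]
  obtain J :: "'a set" where
    "finite J \<and> J \<subseteq> cball 0 R \<and> cball 0 R \<subseteq> (\<Union>j\<in>J. ball j (\<delta> / 2))"
    by (rule exE)
  then have J: "finite J" "J \<subseteq> cball 0 R" "cball 0 R \<subseteq> (\<Union>j\<in>J. ball j (\<delta> / 2))" by simp_all
  define \<psi> where "\<psi> j t = max 0 (\<delta> - norm (t - j))" for j t :: 'a
  define \<sigma> where "\<sigma> t = (\<Sum>j\<in>J. \<psi> j t)" for t
  \<comment> \<open>Cones of height \<delta> over a \<delta>/2-net are normalised by their sum.
    Inside the ball some centre is closer than \<delta>/2, so the sum is at least \<delta>/2 and the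
    maximum changes nothing; outside, the maximum keeps the denominator away from 0 and the
    functions continuous everywhere.\<close>
  define \<theta> where "\<theta> j t = \<psi> j t / max (\<delta> / 2) (\<sigma> t)" for j t
  have \<psi>0: "0 \<le> \<psi> j t" for j t by (simp add: \<psi>_def)
  have \<psi>\<sigma>: "\<psi> j t \<le> \<sigma> t" if "j \<in> J" for j t
    unfolding \<sigma>_def using J(1) that \<psi>0 by (intro member_le_sum) auto
  have pos: "0 < max (\<delta> / 2) (\<sigma> t)" for t using assms by simp
  show ?thesis
  proof (rule that[of J \<theta>])
    have c\<psi>: "continuous_on UNIV (\<psi> j)" for j unfolding \<psi>_def by (intro continuous_intros)
    then have "continuous_on UNIV \<sigma>" unfolding \<sigma>_def by (intro continuous_on_sum)
    then show "continuous_on UNIV (\<theta> j)" for j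
      unfolding \<theta>_def using c\<psi> pos by (intro continuous_on_divide continuous_on_max continuous_on_const) (auto simp: less_imp_neq[symmetric] order.strict_implies_not_eq)
    show "0 \<le> \<theta> j t" for j t using \<psi>0 pos[of t] by (simp add: \<theta>_def)
    show "\<theta> j t \<le> 1" if "j \<in> J" for j t
      using \<psi>\<sigma>[OF that, of t] pos[of t] by (simp add: \<theta>_def)
    show "norm (t - j) < \<delta>" if "\<theta> j t \<noteq> 0" for j t
      using that by (auto simp: \<theta>_def \<psi>_def max_def split: if_splits)
    show "(\<Sum>j\<in>J. \<theta> j t) = 1" if t: "norm t \<le> R" for t
    proof -
      obtain j where j: "j \<in> J" "dist j t < \<delta> / 2" using J(3) t by force
      from j(2) have "norm (t - j) < \<delta> / 2" by (simp add: dist_norm norm_minus_commute)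
      then have "\<delta> / 2 \<le> \<psi> j t" unfolding \<psi>_def by linarith
      then have "\<delta> / 2 \<le> \<sigma> t" using \<psi>\<sigma>[OF j(1), of t] by simp
      then show ?thesis using assms by (simp add: \<theta>_def sum_divide_distrib[symmetric] flip: \<sigma>_def)
    qed
  qed (use J in auto)
qed

section \<open>Passage to the limit\<close>

text \<open>\<open>Suc n\<close> instead of n places all supports, including the one for index 0, in
  the unit ball, so one window dominates the whole sequence.\<close>

definition tent :: "nat \<Rightarrow> 'a::real_normed_vector \<Rightarrow> real" where
  "tent n t = max 0 (1 - real (Suc n) * norm t)"

lemma tent_bounds: "0 \<le> tent n t" "tent n t \<le> 1"
  by (simp_all add: tent_def)

lemma tent_0 [simp]: "tent n 0 = 1"
  by (simp add: tent_def)

lemma tent_support: assumes "tent n t \<noteq> 0" shows "norm t < 1"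
proof -
  have "real (Suc n) * norm t < 1" using assms by (auto simp: tent_def max_def split: if_splits)
  moreover have "1 * norm t \<le> real (Suc n) * norm t" by (intro mult_right_mono) auto
  ultimately show ?thesis by simp
qed

lemma tent_tendsto: "(\<lambda>n. tent n t) \<longlonglongrightarrow> indicator {0} t"
proof (cases "t = 0")
  case False
  obtain N where N: "1 / norm t < real N" using reals_Archimedean2 by blast
  have "tent n t = 0" if "N \<le> n" for n
  proof -
    have "1 / norm t \<le> real (Suc n)" using N that by linarith
    then show ?thesis using False by (simp add: tent_def field_simps)
  qed
  then have "eventually (\<lambda>n. tent n t = 0) sequentially" by (auto simp: eventually_sequentially)
  then show ?thesis using False by (simp add: tendsto_eventually)
qed simp

text \<open>Equal to 1 from level 1 on, so it dominates every b with values in [0, 1] that vanishes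
  on scores up to 1, and it counts an anchor in full. It starts at the positive level 1/2, as
  required for support in a window.\<close>

definition soft_level :: "real \<Rightarrow> real" where
  "soft_level s = min 1 (max 0 (2 * s - 1))"

lemma soft_level_bounds: "0 \<le> soft_level s" "soft_level s \<le> 1"
  by (simp_all add: soft_level_def)

lemma soft_level_support: "soft_level s \<noteq> 0 \<Longrightarrow> 1 / 2 < s"
  by (auto simp: soft_level_def)

lemma soft_level_continuous: "continuous_on UNIV soft_level"
  unfolding soft_level_def by (intro continuous_intros)

lemma local_fun_product:
  fixes a :: "real ^ 'd \<Rightarrow> real" and b :: "real \<Rightarrow> real"
  assumes a: "continuous_on UNIV a" "\<And>t. 0 \<le> a t" "\<And>t. a t \<le> 1" "\<And>t. a t \<noteq> 0 \<Longrightarrow> norm t < R"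
    and b: "continuous_on UNIV b" "\<And>s. 0 \<le> b s" "\<And>s. b s \<le> 1" "\<And>s. b s \<noteq> 0 \<Longrightarrow> \<epsilon> < s"
    and \<epsilon>: "0 < \<epsilon>"
  shows "local_fun (\<lambda>x. a (fst x) * b (snd x))"
proof (rule local_funI[OF _ _ _ \<epsilon>])
  show "continuous_on UNIV (\<lambda>x. a (fst x) * b (snd x))"
    by (intro continuous_on_mult continuous_on_compose2[OF a(1)] continuous_on_compose2[OF b(1)] continuous_intros) auto
  fix x
  show "0 \<le> a (fst x) * b (snd x)" "a (fst x) * b (snd x) \<le> 1" using a b by (simp_all add: mult_le_one)
  assume "a (fst x) * b (snd x) \<noteq> 0"
  then have "norm (fst x) < R" "\<epsilon> < snd x" using a(4)[of "fst x"] b(4)[of "snd x"] by auto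
  then show "x \<in> window R \<epsilon>" by (cases x) (simp add: mem_window)
qed

lemma tent_continuous: "continuous_on UNIV (tent n)"
  unfolding tent_def by (intro continuous_intros)

text \<open>A point of score above 1 at the origin contributes exactly 1 to the soft count; whatever
  exceeds 1 is due to other points close to the origin. Clipping makes this excess a bounded vaguely
  continuous functional.\<close>

definition anchor_defect :: "nat \<Rightarrow> ('d::finite) point measure \<Rightarrow> real" where
  "anchor_defect n \<mu> = min 1 (max 0 ((\<integral>x. tent n (fst x) * soft_level (snd x) \<partial>\<mu>) - 1))"

lemma local_fun_tent_soft: "local_fun (\<lambda>x :: ('d::finite) point. tent n (fst x) * soft_level (snd x))"
  by (intro local_fun_product[where R=1 and \<epsilon>="1/2"] tent_continuous soft_level_continuous tent_bounds
      soft_level_bounds soft_level_support tent_support) auto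

lemma anchor_defect_tame: "tame (anchor_defect n)"
  unfolding anchor_defect_def[abs_def]
  by (rule tame_compose[where \<phi>="\<lambda>y. min 1 (max 0 (y - 1))", OF tame_integral[OF local_fun_tent_soft]])
    (intro continuous_intros)

lemma anchor_defect_bounds: "0 \<le> anchor_defect n \<mu>" "anchor_defect n \<mu> \<le> 1"
  by (simp_all add: anchor_defect_def)

text \<open>The tents shrink to the origin, so by dominated convergence only the column over 0
  remains in the limit. Its mass is at most 1 by simplicity, and no excess is left.\<close>

lemma anchor_defect_tendsto:
  assumes \<mu>: "\<mu> \<in> N11" shows "(\<lambda>n. anchor_defect n \<mu>) \<longlonglongrightarrow> 0"
proof -
  let ?I = "\<integral>x. indicator {0} (fst x) * soft_level (snd x) \<partial>\<mu>"
  let ?C = "{0} \<times> {1/2<..} :: ('a::finite) point set"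
  have C: "?C \<in> sets \<mu>" by (simp add: N11_sets[OF \<mu>])
  have "emeasure \<mu> ?C \<le> emeasure \<mu> ({0} \<times> {0<..})"
    by (intro emeasure_mono) (auto simp: N11_sets[OF \<mu>])
  also have "\<dots> \<le> 1" by (rule N11_column[OF \<mu>])
  finally have C1: "emeasure \<mu> ?C \<le> 1" .
  then have C_fin: "emeasure \<mu> ?C < \<infinity>" by (rule order_le_less_trans) simp
  have lim_meas: "(\<lambda>x. indicator {0} (fst x) * soft_level (snd x)) \<in> borel_measurable \<mu>"
    by (intro measurable_N11[OF \<mu>] borel_measurable_times
        measurable_compose[OF fst_measurable_EE borel_measurable_indicator]
        measurable_compose[OF snd_measurable_EE borel_measurable_continuous_onI[OF soft_level_continuous]]) simp
  have lim: "(\<lambda>n. \<integral>x. tent n (fst x) * soft_level (snd x) \<partial>\<mu>) \<longlonglongrightarrow> ?I"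
  proof (rule integral_dominated_convergence[where w="indicator (window 1 (1/2))"])
    show "integrable \<mu> (indicator (window 1 (1/2)) :: _ \<Rightarrow> real)"
      using N11_window_finite[OF \<mu>, of "1/2" 1] by (simp add: N11_sets[OF \<mu>] window_sets)
    show "(\<lambda>x. tent n (fst x) * soft_level (snd x)) \<in> borel_measurable \<mu>" for n
      by (rule measurable_N11[OF \<mu> local_fun_measurable[OF local_fun_tent_soft]])
    show "AE x in \<mu>. (\<lambda>n. tent n (fst x) * soft_level (snd x)) \<longlonglongrightarrow> indicator {0} (fst x) * soft_level (snd x)"
      by (intro AE_I2 tendsto_mult tent_tendsto tendsto_const)
    show "AE x in \<mu>. norm (tent n (fst x) * soft_level (snd x)) \<le> indicator (window 1 (1/2)) x" for n
    proof (rule AE_I2)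
      fix x :: "'a point"
      show "norm (tent n (fst x) * soft_level (snd x)) \<le> indicator (window 1 (1/2)) x"
      proof (cases "x \<in> window 1 (1/2)")
        case True
        then show ?thesis using tent_bounds[of n "fst x"] soft_level_bounds[of "snd x"]
          by (simp add: abs_mult mult_le_one)
      next
        case False
        then have "tent n (fst x) = 0 \<or> soft_level (snd x) = 0"
          using tent_support[of n "fst x"] soft_level_support[of "snd x"] by (cases x) (auto simp: mem_window)
        then show ?thesis by auto
      qed
    qed
  qed (rule lim_meas)
  have "?I \<le> 1"
  proof -
    have "?I \<le> (\<integral>x. indicator ?C x \<partial>\<mu>)"
    proof (rule integral_mono')
      show "integrable \<mu> (indicator ?C :: _ \<Rightarrow> real)" using C C_fin by simp
      show "indicator {0} (fst x) * soft_level (snd x) \<le> indicator ?C x" for x :: "'a point"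
        using soft_level_bounds[of "snd x"] soft_level_support[of "snd x"] by (cases x) (auto simp: indicator_def)
    qed simp
    also have "\<dots> = measure \<mu> ?C" using C by simp
    also have "\<dots> \<le> 1" using C1 enn2real_mono[of "emeasure \<mu> ?C" 1] by (simp add: measure_def)
    finally show ?thesis .
  qed
  then have "min 1 (max 0 (?I - 1)) = 0" by simp
  moreover have "(\<lambda>n. anchor_defect n \<mu>) \<longlonglongrightarrow> min 1 (max 0 (?I - 1))"
    unfolding anchor_defect_def by (intro tendsto_min tendsto_max tendsto_diff tendsto_const lim)
  ultimately show ?thesis by simp
qed

text \<open>The anchor (0, s) contributes b(s) to the sum of tent times b. The surplus of that sum
  comes from other points near the origin, and since b is at most \<open>soft_level\<close>, it is
  at most the surplus of the soft count over 1.\<close>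

lemma anchor_approx:
  fixes b :: "real \<Rightarrow> real"
  assumes \<mu>: "\<mu> \<in> N11" and anchor: "emeasure \<mu> ({0} \<times> {1<..}) = 1"
    and b: "continuous_on UNIV b" "\<And>s. 0 \<le> b s" "\<And>s. b s \<le> 1" "\<And>s. b s \<noteq> 0 \<Longrightarrow> 1 < s"
  shows "\<bar>enn2real (mark (\<lambda>s. ennreal (b s)) 0 \<mu>) - min 1 (\<integral>x. tent n (fst x) * b (snd x) \<partial>\<mu>)\<bar> \<le> anchor_defect n \<mu>"
proof -
  obtain s where s: "(0, s) \<in> atoms \<mu>" "1 < s"
    using N11_ex_atom[OF \<mu>, of "{0} \<times> {1<..}"] anchor by auto
  let ?x = "(0, s)" and ?g = "\<lambda>x. tent n (fst x) * soft_level (snd x)" and ?b = "\<lambda>x. tent n (fst x) * b (snd x)"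
  have one: "emeasure \<mu> {?x} = 1" "{?x} \<in> sets \<mu>"
    using N11_atom_one[OF \<mu> s(1)] s(1) by (auto simp: N11_sets[OF \<mu>] atoms_def singleton_sets)
  have lf: "local_fun ?b"
    by (rule local_fun_product[where R=1 and \<epsilon>=1]) (use b tent_continuous tent_bounds tent_support in auto)
  have int: "integrable \<mu> ?b" "integrable \<mu> ?g"
    using local_fun_integrable[OF \<mu>] lf local_fun_tent_soft by blast+
  have ind: "integrable \<mu> (\<lambda>x. c * indicator {?x} x)" "(\<integral>x. c * indicator {?x} x \<partial>\<mu>) = c" for c :: real
    using one by (simp_all add: measure_def)
  have b_le: "b r \<le> soft_level r" for r
    using b(3)[of r] b(4)[of r] soft_level_bounds(1)[of r] by (cases "b r = 0") (auto simp: soft_level_def)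
  have "b s = (\<integral>x. b s * indicator {?x} x \<partial>\<mu>)" by (rule ind(2)[symmetric])
  also have "\<dots> \<le> (\<integral>x. ?b x \<partial>\<mu>)"
    using mult_nonneg_nonneg[OF tent_bounds(1) b(2)] by (intro integral_mono ind int) (auto simp: indicator_def)
  finally have 1: "b s \<le> (\<integral>x. ?b x \<partial>\<mu>)" .
  have "1 - b s = (\<integral>x. (1 - b s) * indicator {?x} x \<partial>\<mu>)" by (rule ind(2)[symmetric])
  also have "\<dots> \<le> (\<integral>x. ?g x - ?b x \<partial>\<mu>)"
  proof (intro integral_mono ind Bochner_Integration.integrable_diff int)
    fix x :: "'a point"
    have "soft_level s = 1" using s(2) by (simp add: soft_level_def)
    then show "(1 - b s) * indicator {?x} x \<le> ?g x - ?b x"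
      using mult_left_mono[OF b_le[of "snd x"] tent_bounds(1)[of n "fst x"]]
      by (cases "x = ?x") (auto simp: indicator_def)
  qed
  finally have 2: "1 - b s \<le> (\<integral>x. ?g x \<partial>\<mu>) - (\<integral>x. ?b x \<partial>\<mu>)" using int by simp
  \<comment> \<open>Here c is b(s), p the sum with weight b and q the sum with weight
    \<open>soft_level\<close>. The second hypothesis says p - c \<le> q - 1, and clipping p at 1
    only brings it closer to c, which is at most 1.\<close>
  have clip: "\<bar>c - min 1 p\<bar> \<le> min 1 (max 0 (q - 1))"
    if "c \<le> p" "1 - c \<le> q - p" "0 \<le> c" "c \<le> 1" for c p q :: real
    using that by linarith
  have bm: "(\<lambda>s. ennreal (b s)) \<in> borel_measurable borel"
    using borel_measurable_continuous_onI[OF b(1)] by simp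
  have "mark (\<lambda>s. ennreal (b s)) 0 \<mu> = ennreal (b s)" by (rule mark_atom[OF \<mu> s(1) bm])
  then show ?thesis
    using clip[OF 1 2 b(2,3)] b(2) by (simp add: anchor_defect_def)
qed

lemma anchored_bounded_convergence:
  assumes \<nu>: "anchored \<nu>" and F: "\<And>n. F n \<in> borel_measurable N11_space" "\<And>n \<mu>. \<mu> \<in> N11 \<Longrightarrow> \<bar>F n \<mu>\<bar> \<le> (C::real)"
    and lim: "\<And>\<mu>. \<mu> \<in> N11 \<Longrightarrow> (\<lambda>n. F n \<mu>) \<longlonglongrightarrow> 0"
  shows "(\<lambda>n. \<integral>\<mu>. F n \<mu> \<partial>\<nu>) \<longlonglongrightarrow> 0"
proof -
  interpret prob_space \<nu> using \<nu> by (simp add: anchored_def)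
  have "(\<lambda>n. \<integral>\<mu>. F n \<mu> \<partial>\<nu>) \<longlonglongrightarrow> (\<integral>\<mu>. 0 \<partial>\<nu>)"
  proof (rule integral_dominated_convergence[where w="\<lambda>_. C"])
    show "F n \<in> borel_measurable \<nu>" for n
      using F(1) \<nu> by (simp add: anchored_def cong: measurable_cong_sets)
  qed (use lim F(2) in \<open>auto simp: anchored_space[OF \<nu>]\<close>)
  then show ?thesis by simp
qed

text \<open>The parameter c is used with values 0 and 1, for the configuration itself and for the
  configuration seen from the point of summation. One limit statement thus serves both sides of the
  identity.\<close>

definition site_sum ::
  "(('d::finite) point \<Rightarrow> real) \<Rightarrow> real \<Rightarrow> ('d point measure \<Rightarrow> real) \<Rightarrow> 'd point measure \<Rightarrow> real" where
  "site_sum w c \<Psi> \<mu> = (\<integral>x. w x * \<Psi> (shift_pts (c *\<^sub>R fst x) \<mu>) \<partial>\<mu>)"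

lemma site_integrand_measurable:
  assumes \<Psi>: "shift_lipschitz \<Psi>" and w: "local_fun w"
  shows "(\<lambda>q. w (snd q) * \<Psi> (shift_pts (c *\<^sub>R fst (snd q)) (fst q))) \<in> borel_measurable (N11_space \<Otimes>\<^sub>M borel_EE)"
  by (intro borel_measurable_times measurable_compose[OF measurable_snd local_fun_measurable[OF w]]
      measurable_compose[OF _ shift_lipschitz_measurable[OF \<Psi>]] shift_measurable borel_measurable_scaleR
      measurable_compose[OF measurable_snd fst_measurable_EE]) simp_all

lemma site_integrand_measurable1:
  assumes "\<mu> \<in> N11" "shift_lipschitz \<Psi>" "local_fun w"
  shows "(\<lambda>x. w x * \<Psi> (shift_pts (c *\<^sub>R fst x) \<mu>)) \<in> borel_measurable borel_EE"
  using measurable_Pair2[OF site_integrand_measurable[OF assms(2,3)], of \<mu>] assms(1) by simp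

lemma site_integrable:
  assumes \<mu>: "\<mu> \<in> N11" and \<Psi>: "shift_lipschitz \<Psi>" and w: "local_fun w"
  shows "integrable \<mu> (\<lambda>x. w x * \<Psi> (shift_pts (c *\<^sub>R fst x) \<mu>))"
proof (rule Bochner_Integration.integrable_bound[OF local_fun_integrable[OF \<mu> w]])
  show "(\<lambda>x. w x * \<Psi> (shift_pts (c *\<^sub>R fst x) \<mu>)) \<in> borel_measurable \<mu>"
    by (rule measurable_N11[OF \<mu> site_integrand_measurable1[OF \<mu> \<Psi> w]])
  have "w x * \<Psi> (shift_pts z \<mu>) \<le> w x * 1" for x z
    using shift_lipschitz_bounds[OF \<Psi> shift_N11[OF \<mu>]] local_fun_nonneg[OF w] by (intro mult_left_mono) auto
  then show "AE x in \<mu>. norm (w x * \<Psi> (shift_pts (c *\<^sub>R fst x) \<mu>)) \<le> norm (w x)"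
    using shift_lipschitz_bounds[OF \<Psi> shift_N11[OF \<mu>]] local_fun_nonneg[OF w] by (intro AE_I2) (simp add: abs_mult)
qed

lemma site_sum_nn_integral:
  assumes \<mu>: "\<mu> \<in> N11" and \<Psi>: "shift_lipschitz \<Psi>" and w: "local_fun w"
  shows "(\<integral>\<^sup>+x. ennreal (w x * \<Psi> (shift_pts (c *\<^sub>R fst x) \<mu>)) \<partial>\<mu>) = ennreal (site_sum w c \<Psi> \<mu>)"
  unfolding site_sum_def
  using shift_lipschitz_bounds[OF \<Psi> shift_N11[OF \<mu>]] local_fun_nonneg[OF w]
  by (intro nn_integral_eq_integral site_integrable[OF assms] AE_I2) simp

lemma site_sum_nonneg:
  assumes \<mu>: "\<mu> \<in> N11" and \<Psi>: "shift_lipschitz \<Psi>" and w: "local_fun w"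
  shows "0 \<le> site_sum w c \<Psi> \<mu>"
  unfolding site_sum_def using shift_lipschitz_bounds[OF \<Psi> shift_N11[OF \<mu>]] local_fun_nonneg[OF w]
  by (intro integral_nonneg_AE AE_I2) simp

lemma site_sum_measurable:
  assumes \<Psi>: "shift_lipschitz \<Psi>" and w: "local_fun w"
  shows "site_sum w c \<Psi> \<in> borel_measurable N11_space"
proof -
  have id: "(\<lambda>\<mu>. \<mu>) \<in> N11_space \<rightarrow>\<^sub>M N11_space" by simp
  have "(\<lambda>\<mu>. \<integral>\<^sup>+x. ennreal (w x * \<Psi> (shift_pts (c *\<^sub>R fst x) \<mu>)) \<partial>\<mu>) \<in> borel_measurable N11_space"
    using kernel_nn_integral_measurable_pair[OF id measurable_compose[OF site_integrand_measurable[OF \<Psi> w] measurable_ennreal]]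
    by simp
  then have "(\<lambda>\<mu>. enn2real (\<integral>\<^sup>+x. ennreal (w x * \<Psi> (shift_pts (c *\<^sub>R fst x) \<mu>)) \<partial>\<mu>)) \<in> borel_measurable N11_space"
    by measurable
  then show ?thesis
    by (rule measurable_cong[THEN iffD1, rotated])
      (simp add: site_sum_nn_integral[OF _ \<Psi> w] site_sum_nonneg[OF _ \<Psi> w])
qed

text \<open>The integration variable in the argument of \<Psi> obstructs continuity. Replacing the
  shift by nearby net points, weighted by a partition of unity, leaves a finite sum of products of
  an integral of a test function and \<Psi> at a fixed shift, all vaguely continuous.\<close>

definition site_sum_approx ::
  "(('d::finite) point \<Rightarrow> real) \<Rightarrow> real \<Rightarrow> ('d point measure \<Rightarrow> real) \<Rightarrow>
   (real ^ 'd) set \<Rightarrow> (real ^ 'd \<Rightarrow> real ^ 'd \<Rightarrow> real) \<Rightarrow> 'd point measure \<Rightarrow> real" where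
  "site_sum_approx w c \<Psi> J \<theta> \<mu> =
     (\<Sum>j\<in>J. (\<integral>x. w x * \<theta> j (fst x) \<partial>\<mu>) * \<Psi> (shift_pts (c *\<^sub>R j) \<mu>))"

lemma local_fun_times:
  fixes w :: "('d::finite) point \<Rightarrow> real" and \<theta> :: "real ^ 'd \<Rightarrow> real"
  assumes w: "local_fun w" "\<And>x. w x \<le> 1" and \<theta>: "continuous_on UNIV \<theta>" "\<And>t. 0 \<le> \<theta> t" "\<And>t. \<theta> t \<le> 1"
  shows "local_fun (\<lambda>x. w x * \<theta> (fst x))"
proof -
  obtain R \<epsilon> where \<epsilon>: "0 < \<epsilon>" "\<And>x. w x \<noteq> 0 \<Longrightarrow> x \<in> window R \<epsilon>"
    using w(1) unfolding local_fun_def by blast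
  show ?thesis
  proof (rule local_funI[OF _ _ _ \<epsilon>(1)])
    show "continuous_on UNIV (\<lambda>x. w x * \<theta> (fst x))"
      using w(1) by (intro continuous_on_mult continuous_on_compose2[OF \<theta>(1)] continuous_intros)
        (auto simp: local_fun_def)
    show "0 \<le> w x * \<theta> (fst x)" "w x * \<theta> (fst x) \<le> 1" for x
      using w \<theta> local_fun_nonneg[OF w(1)] by (simp_all add: mult_le_one)
    show "x \<in> window R \<epsilon>" if "w x * \<theta> (fst x) \<noteq> 0" for x
      using that \<epsilon>(2) by auto
  qed
qed

text \<open>At most as many summands as there are points in the window, each at most 1. If there are
  more than N points, the cutoff makes every summand vanish, since the shift vectors used have norm
  at most R.\<close>

lemma site_sum_bound:
  assumes \<mu>: "\<mu> \<in> N11" and \<Psi>: "shift_lipschitz \<Psi>" and c: "\<bar>c\<bar> \<le> 1"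
    and w: "local_fun w" "\<And>x. w x \<le> 1" "\<And>x. w x \<noteq> 0 \<Longrightarrow> x \<in> window R 1"
    and cut: "\<And>z. norm z \<le> R \<Longrightarrow> N < mass R 1 \<mu> \<Longrightarrow> \<Psi> (shift_pts z \<mu>) = 0" and N: "0 \<le> N"
  shows "site_sum w c \<Psi> \<mu> \<le> N"
proof (cases "mass R 1 \<mu> \<le> N")
  case True
  have "\<bar>site_sum w c \<Psi> \<mu>\<bar> \<le> 1 * mass R 1 \<mu>"
    unfolding site_sum_def
  proof (rule integral_window_bound[OF \<mu> site_integrand_measurable1[OF \<mu> \<Psi> w(1)]])
    fix x
    show "\<bar>w x * \<Psi> (shift_pts (c *\<^sub>R fst x) \<mu>)\<bar> \<le> 1 * indicator (window R 1) x"
      using w(2)[of x] w(3)[of x] local_fun_nonneg[OF w(1), of x]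
        shift_lipschitz_bounds[OF \<Psi> shift_N11[OF \<mu>], of "c *\<^sub>R fst x"]
      by (cases "w x = 0") (auto simp: abs_mult mult_le_one)
  qed simp
  then show ?thesis using True by simp
next
  case False
  have zero: "w x * \<Psi> (shift_pts (c *\<^sub>R fst x) \<mu>) = 0" for x
  proof (cases "w x = 0")
    case False
    then have "norm (fst x) < R" using w(3)[of x] by (cases x) (simp add: mem_window)
    moreover have "\<bar>c\<bar> * norm (fst x) \<le> 1 * norm (fst x)" using c by (intro mult_right_mono) auto
    ultimately show ?thesis using cut \<open>\<not> mass R 1 \<mu> \<le> N\<close> by simp
  qed simp
  have "site_sum w c \<Psi> \<mu> = (\<integral>x. 0 \<partial>\<mu>)"
    unfolding site_sum_def by (intro Bochner_Integration.integral_cong refl zero)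
  then show ?thesis using N by simp
qed

text \<open>Only net points closer than \<delta> receive weight at a given t, so each summand moves
  by at most L \<delta> m, and by at most 1 because \<Psi> has values in [0, 1]. The cutoff leaves
  at most N summands; beyond it both sums vanish, the net lying in the ball where the cutoff
  acts.\<close>

lemma site_sum_approx_error:
  fixes \<Psi> :: "('d::finite) point measure \<Rightarrow> real"
  assumes \<mu>: "\<mu> \<in> N11" and \<Psi>: "shift_lipschitz \<Psi>" and c: "\<bar>c\<bar> \<le> 1"
    and w: "local_fun w" "\<And>x. w x \<le> 1" "\<And>x. w x \<noteq> 0 \<Longrightarrow> x \<in> window R 1"
    and cut: "\<And>z. norm z \<le> R \<Longrightarrow> N < mass R 1 \<mu> \<Longrightarrow> \<Psi> (shift_pts z \<mu>) = 0" and N: "0 \<le> N"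
    and L: "0 \<le> L" "\<And>z z'. norm z \<le> R \<Longrightarrow> norm z' \<le> R \<Longrightarrow>
        \<bar>\<Psi> (shift_pts z \<mu>) - \<Psi> (shift_pts z' \<mu>)\<bar> \<le> L * norm (z - z') * m" and m: "0 \<le> m" and \<delta>: "0 < \<delta>"
    and J: "finite J" "J \<subseteq> cball 0 R" and \<theta>: "\<And>j. continuous_on UNIV (\<theta> j)" "\<And>j t. 0 \<le> \<theta> j t"
      "\<And>j t. j \<in> J \<Longrightarrow> \<theta> j t \<le> 1" "\<And>j t. \<theta> j t \<noteq> 0 \<Longrightarrow> norm (t - j) < \<delta>"
      "\<And>t. norm t \<le> R \<Longrightarrow> (\<Sum>j\<in>J. \<theta> j t) = 1"
  shows "\<bar>site_sum w c \<Psi> \<mu> - site_sum_approx w c \<Psi> J \<theta> \<mu>\<bar> \<le> N * min 1 (L * \<delta> * m)"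
proof -
  let ?e = "min 1 (L * \<delta> * m)"
  let ?P = "\<lambda>t. \<Psi> (shift_pts (c *\<^sub>R t) \<mu>)"
  let ?q = "\<lambda>x. w x * ?P (fst x) - (\<Sum>j\<in>J. w x * \<theta> j (fst x) * ?P j)"
  have e: "0 \<le> ?e" using L(1) m \<delta> by simp
  have cR: "norm (c *\<^sub>R t) \<le> R" if "norm t \<le> R" for t :: "real ^ 'd"
  proof -
    have "\<bar>c\<bar> * norm t \<le> 1 * norm t" using c by (intro mult_right_mono) auto
    then show ?thesis using that by simp
  qed
  have P: "0 \<le> ?P t" "?P t \<le> 1" for t
    using shift_lipschitz_bounds[OF \<Psi> shift_N11[OF \<mu>]] by auto
  have w\<theta>: "local_fun (\<lambda>x. w x * \<theta> j (fst x))" if "j \<in> J" for j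
    using local_fun_times[OF w(1,2) \<theta>(1,2) \<theta>(3)] that by simp
  have int: "integrable \<mu> (\<lambda>x. w x * \<theta> j (fst x) * ?P j)" if "j \<in> J" for j
    using local_fun_integrable[OF \<mu> w\<theta>[OF that]] by (rule integrable_mult_left)
  have eq: "site_sum w c \<Psi> \<mu> - site_sum_approx w c \<Psi> J \<theta> \<mu> = (\<integral>x. ?q x \<partial>\<mu>)"
    unfolding site_sum_def site_sum_approx_def
    using site_integrable[OF \<mu> \<Psi> w(1), of c] int by simp
  have q_meas: "?q \<in> borel_measurable borel_EE"
    by (intro borel_measurable_diff site_integrand_measurable1[OF \<mu> \<Psi> w(1)] borel_measurable_sum
        borel_measurable_times[OF local_fun_measurable[OF w\<theta>] borel_measurable_const])
  have fst_lt: "norm (fst x) < R" if "w x \<noteq> 0" for x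
    using w(3)[OF that] by (cases x) (simp add: mem_window)
  show ?thesis
  proof (cases "mass R 1 \<mu> \<le> N")
    case True
    have "\<bar>\<integral>x. ?q x \<partial>\<mu>\<bar> \<le> ?e * mass R 1 \<mu>"
    proof (rule integral_window_bound[OF \<mu> q_meas])
      fix x :: "'d point"
      show "\<bar>?q x\<bar> \<le> ?e * indicator (window R 1) x"
      proof (cases "w x = 0")
        case True
        then show ?thesis using e by simp
      next
        case False
        then have x: "x \<in> window R 1" "norm (fst x) \<le> R" using w(3) fst_lt[of x] by auto
        have part: "\<bar>w x * \<theta> j (fst x) * (?P (fst x) - ?P j)\<bar> \<le> w x * \<theta> j (fst x) * ?e"
          if j: "j \<in> J" for j
        proof (cases "\<theta> j (fst x) = 0")
          case False
          have "norm j \<le> R" using j J(2) by auto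
          then have "\<bar>?P (fst x) - ?P j\<bar> \<le> L * norm (c *\<^sub>R fst x - c *\<^sub>R j) * m"
            using x(2) by (intro L(2) cR)
          also have "norm (c *\<^sub>R fst x - c *\<^sub>R j) = \<bar>c\<bar> * norm (fst x - j)"
            by (simp flip: scaleR_diff_right)
          also have "L * (\<bar>c\<bar> * norm (fst x - j)) * m \<le> L * (1 * \<delta>) * m"
            using \<theta>(4)[OF False] c L(1) m by (intro mult_right_mono mult_left_mono mult_mono) auto
          finally have "\<bar>?P (fst x) - ?P j\<bar> \<le> ?e"
            using P[of "fst x"] P[of j] by auto
          then show ?thesis
            using local_fun_nonneg[OF w(1), of x] \<theta>(2)[of j "fst x"]
            by (simp add: abs_mult mult_left_mono)
        qed simp
        \<comment> \<open>The weights sum to 1 at the position of x, so the undiscretised term can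
          also be spread over the net and compared term by term.\<close>
        have "?q x = (\<Sum>j\<in>J. w x * \<theta> j (fst x) * (?P (fst x) - ?P j))"
          using \<theta>(5)[OF x(2)]
          by (simp add: right_diff_distrib sum_subtractf flip: sum_distrib_left sum_distrib_right)
        then have "\<bar>?q x\<bar> \<le> (\<Sum>j\<in>J. w x * \<theta> j (fst x) * ?e)"
          using part by (auto intro!: order_trans[OF sum_abs] sum_mono)
        also have "\<dots> = w x * ?e"
          using \<theta>(5)[OF x(2)] by (simp flip: sum_distrib_left sum_distrib_right)
        also have "\<dots> \<le> 1 * ?e" using w(2) e by (intro mult_right_mono) auto
        finally show ?thesis using x(1) by simp
      qed
    qed simp
    also have "\<dots> \<le> ?e * N" using True e by (intro mult_left_mono)
    finally show ?thesis by (simp add: eq mult.commute)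
  next
    case False
    have zero: "?q x = 0" for x
    proof -
      have "?P j = 0" if "j \<in> J" for j
        using cut[OF cR] that J(2) False by auto
      moreover have "w x * ?P (fst x) = 0"
        using cut[OF cR, of "fst x"] fst_lt[of x] False by (cases "w x = 0") auto
      ultimately show ?thesis by simp
    qed
    have "(\<integral>x. ?q x \<partial>\<mu>) = (\<integral>x. 0 \<partial>\<mu>)"
      by (intro Bochner_Integration.integral_cong refl zero)
    then show ?thesis using N e by (simp add: eq)
  qed
qed

text \<open>\<open>mass\<close> jumps when points cross the boundary of a window. The majorant is
  continuous because it is an integral of a test function: 1 on the window, fading out between
  radius R and R + 1 and between the levels \<epsilon> and \<epsilon>/2. It serves in the error
  bound, in the cutoff and in the exhaustion by sets of finite measure.\<close>

lemma plateau:
  fixes R \<epsilon> :: real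
  assumes "0 < \<epsilon>"
  obtains g :: "('d::finite) point \<Rightarrow> real"
  where "local_fun g" "\<And>\<mu>. \<mu> \<in> N11 \<Longrightarrow> mass R \<epsilon> \<mu> \<le> (\<integral>x. g x \<partial>\<mu>)"
    "\<And>t t' s. \<bar>g (t, s) - g (t', s)\<bar> \<le> norm (t - t')"
proof -
  define p where "p t = max 0 (min 1 (R + 1 - norm t))" for t :: "real ^ 'd"
  define q where "q s = min 1 (max 0 (2 * s / \<epsilon> - 1))" for s
  let ?g = "\<lambda>x. p (fst x) * q (snd x)"
  have p: "continuous_on UNIV p" "0 \<le> p t" "p t \<le> 1" "p t \<noteq> 0 \<Longrightarrow> norm t < R + 1" for t
    by (auto simp: p_def intro!: continuous_intros split: if_splits)
  have q: "continuous_on UNIV q" "0 \<le> q s" "q s \<le> 1" for s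
    using assms by (auto simp: q_def intro!: continuous_intros)
  have q4: "\<epsilon> / 2 < s" if "q s \<noteq> 0" for s
  proof (rule ccontr)
    assume "\<not> ?thesis"
    then have "2 * s / \<epsilon> \<le> 1" using assms by (simp add: field_simps)
    then show False using that by (simp add: q_def)
  qed
  have g: "local_fun ?g"
    using assms by (intro local_fun_product[OF p q q4]) auto
  have ge: "indicator (window R \<epsilon>) x \<le> ?g x" for x
  proof (cases "x \<in> window R \<epsilon>")
    case True
    then have "norm (fst x) < R" "\<epsilon> < snd x" by (cases x; simp add: mem_window)+
    then have "p (fst x) = 1" "1 \<le> 2 * snd x / \<epsilon> - 1" using assms by (auto simp: p_def field_simps)
    then show ?thesis by (simp add: q_def indicator_def)
  qed (use p q in simp)
  show ?thesis
  proof (rule that[OF g])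
    fix \<mu> :: "'d point measure" assume \<mu>: "\<mu> \<in> N11"
    have sets: "window R \<epsilon> \<in> sets \<mu>" using assms by (simp add: N11_sets[OF \<mu>] window_sets)
    have "mass R \<epsilon> \<mu> = (\<integral>x. indicator (window R \<epsilon>) x \<partial>\<mu>)" using sets by (simp add: mass_def)
    also have "\<dots> \<le> (\<integral>x. ?g x \<partial>\<mu>)"
      using ge N11_window_finite[OF \<mu> assms, of R] sets
      by (intro integral_mono local_fun_integrable[OF \<mu> g] integrable_real_indicator) simp_all
    finally show "mass R \<epsilon> \<mu> \<le> (\<integral>x. ?g x \<partial>\<mu>)" .
  next
    fix t t' s
    have "\<bar>p t - p t'\<bar> \<le> \<bar>norm t - norm t'\<bar>" unfolding p_def by linarith
    also have "\<dots> \<le> norm (t - t')" by (rule norm_triangle_ineq3)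
    finally have "\<bar>p t - p t'\<bar> * q s \<le> norm (t - t') * 1" using q by (intro mult_mono) auto
    then show "\<bar>?g (t, s) - ?g (t', s)\<bar> \<le> norm (t - t')"
      using q(2)[of s] by (simp add: abs_mult flip: left_diff_distrib)
  qed
qed

section \<open>Convergence of the weighted sums and passage of the exchange identity to the
  limit\<close>

lemma mark_le_1:
  assumes "\<mu> \<in> N11" "b \<in> borel_measurable borel" "\<And>s. b s \<le> 1" shows "mark b z \<mu> \<le> 1"
proof (cases "\<exists>s. (z, s) \<in> atoms \<mu>")
  case True
  then obtain s where "(z, s) \<in> atoms \<mu>" by blast
  then show ?thesis using mark_atom[OF assms(1) _ assms(2)] assms(3) by simp
next
  case False
  then show ?thesis using mark_eq_0[OF assms(1), of z b] by simp
qed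

lemma weak_limit_site_sum:
  fixes \<Psi> :: "('d::finite) point measure \<Rightarrow> real" and a :: "real ^ 'd \<Rightarrow> real" and b :: "real \<Rightarrow> real"
  assumes W: "weakly_converges vague_topology \<nu>s \<nu> G"
    and anch: "eventually (\<lambda>i. anchored (\<nu>s i)) G" "anchored \<nu>"
    and a: "continuous_on UNIV a" "\<And>t. 0 \<le> a t" "\<And>t. a t \<le> 1" "\<And>t. a t \<noteq> 0 \<Longrightarrow> norm t < R"
    and b: "continuous_on UNIV b" "\<And>s. 0 \<le> b s" "\<And>s. b s \<le> 1" "\<And>s. b s \<noteq> 0 \<Longrightarrow> 1 < s"
    and \<Psi>: "shift_lipschitz \<Psi>" and c: "\<bar>c\<bar> \<le> 1"
    and cut: "\<And>\<mu> z. \<mu> \<in> N11 \<Longrightarrow> norm z \<le> R \<Longrightarrow> N < mass R 1 \<mu> \<Longrightarrow> \<Psi> (shift_pts z \<mu>) = 0" and N: "0 \<le> N"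
  defines "F \<equiv> \<lambda>\<mu>. enn2real (mark (\<lambda>s. ennreal (b s)) 0 \<mu>) * site_sum (\<lambda>x. a (fst x) * b (snd x)) c \<Psi> \<mu>"
  shows "((\<lambda>i. \<integral>\<mu>. F \<mu> \<partial>\<nu>s i) \<longlongrightarrow> (\<integral>\<mu>. F \<mu> \<partial>\<nu>)) G"
proof -
  let ?w = "\<lambda>x. a (fst x) * b (snd x)" and ?B = "\<lambda>\<mu>. enn2real (mark (\<lambda>s. ennreal (b s)) 0 \<mu>)"
  have w: "local_fun ?w" by (rule local_fun_product[OF a b]) simp_all
  have w1: "?w x \<le> 1" for x using a b by (simp add: mult_le_one)
  have ww: "x \<in> window R 1" if "?w x \<noteq> 0" for x
    using that a(4)[of "fst x"] b(4)[of "snd x"] by (cases x) (auto simp: mem_window)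
  have bm: "(\<lambda>s. ennreal (b s)) \<in> borel_measurable borel"
    using borel_measurable_continuous_onI[OF b(1)] by simp
  have B: "0 \<le> ?B \<mu>" "?B \<mu> \<le> 1" if "\<mu> \<in> N11" for \<mu>
    using mark_le_1[OF that bm, of 0] b(3) enn2real_mono[of "mark (\<lambda>s. ennreal (b s)) 0 \<mu>" 1] by auto
  have site: "0 \<le> site_sum ?w c \<Psi> \<mu>" "site_sum ?w c \<Psi> \<mu> \<le> N" if "\<mu> \<in> N11" for \<mu>
    using site_sum_nonneg[OF that \<Psi> w] site_sum_bound[OF that \<Psi> c w w1 ww cut[OF that] N] by auto
  from \<Psi> obtain L R' \<epsilon> where L: "0 \<le> L" "0 < \<epsilon>"
    "\<And>\<mu> z z'. \<mu> \<in> N11 \<Longrightarrow> norm z \<le> R \<Longrightarrow> norm z' \<le> R \<Longrightarrow>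
      \<bar>\<Psi> (shift_pts z \<mu>) - \<Psi> (shift_pts z' \<mu>)\<bar> \<le> L * norm (z - z') * mass R' \<epsilon> \<mu>"
    unfolding shift_lipschitz_def by metis
  obtain g :: "'d point \<Rightarrow> real" where g: "local_fun g" "\<And>\<mu>. \<mu> \<in> N11 \<Longrightarrow> mass R' \<epsilon> \<mu> \<le> (\<integral>x. g x \<partial>\<mu>)"
    using plateau[OF L(2), of R'] by metis
  define D where "D n \<mu> = min 1 (L * (1 / real (Suc n)) * (\<integral>x. g x \<partial>\<mu>))" for n and \<mu> :: "'d point measure"
  \<comment> \<open>One term for the mark at the origin, the other for discretising the shift. Each
    factor is at most 1 and tends to 0 for every configuration, so the integral under the limit law
    tends to 0 by bounded convergence.\<close>
  define E where "E n \<mu> = N * anchor_defect n \<mu> + N * D n \<mu>" for n and \<mu> :: "'d point measure"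
  have D: "0 \<le> D n \<mu>" "D n \<mu> \<le> 1" for n \<mu>
    using L(1) local_fun_integral_nonneg[OF g(1), of \<mu>] by (simp_all add: D_def)
  have "tame (D n)" for n
    unfolding D_def[abs_def]
    by (rule tame_compose[where \<phi>="\<lambda>y. min 1 (L * (1 / real (Suc n)) * y)", OF tame_integral[OF g(1)]])
      (intro continuous_intros)
  then have E_tame: "tame (E n)" for n
    unfolding E_def[abs_def] by (intro tame_add tame_mult tame_const anchor_defect_tame)
  have E_bounds: "0 \<le> E n \<mu>" "E n \<mu> \<le> N + N" for n \<mu>
  proof -
    have "N * anchor_defect n \<mu> \<le> N" "N * D n \<mu> \<le> N"
      using N D[of n \<mu>] anchor_defect_bounds[of n \<mu>] by (auto intro!: mult_left_le)
    then show "0 \<le> E n \<mu>" "E n \<mu> \<le> N + N"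
      using N D[of n \<mu>] anchor_defect_bounds[of n \<mu>] by (simp_all add: E_def)
  qed
  have "(\<lambda>n. D n \<mu>) \<longlonglongrightarrow> 0" for \<mu>
  proof -
    have "(\<lambda>n. L * (1 / real (Suc n)) * (\<integral>x. g x \<partial>\<mu>)) \<longlonglongrightarrow> L * 0 * (\<integral>x. g x \<partial>\<mu>)"
      using LIMSEQ_Suc[OF lim_1_over_n] by (intro tendsto_mult tendsto_const) simp
    then have "(\<lambda>n. min 1 (L * (1 / real (Suc n)) * (\<integral>x. g x \<partial>\<mu>))) \<longlonglongrightarrow> min 1 (L * 0 * (\<integral>x. g x \<partial>\<mu>))"
      by (intro tendsto_min tendsto_const)
    then show ?thesis by (simp add: D_def)
  qed
  then have "(\<lambda>n. E n \<mu>) \<longlonglongrightarrow> N * 0 + N * 0" if "\<mu> \<in> N11" for \<mu>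
    unfolding E_def using anchor_defect_tendsto[OF that] by (intro tendsto_add tendsto_mult tendsto_const)
  then have E_lim: "(\<lambda>n. \<integral>\<mu>. E n \<mu> \<partial>\<nu>) \<longlonglongrightarrow> 0"
    using E_bounds by (intro anchored_bounded_convergence[OF anch(2), where C="N + N"] tame_measurable[OF E_tame]) auto
  show ?thesis
  proof (rule weak_limit_approx[OF W anch, where C=N])
    show "F \<in> borel_measurable N11_space"
      unfolding F_def
      by (intro borel_measurable_times site_sum_measurable[OF \<Psi> w] borel_measurable_enn2real mark_measurable[OF bm])
    show "\<bar>F \<mu>\<bar> \<le> N" if "\<mu> \<in> N11" for \<mu>
    proof -
      have "?B \<mu> * site_sum ?w c \<Psi> \<mu> \<le> 1 * N" using B[OF that] site[OF that] by (intro mult_mono) auto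
      then show ?thesis using B[OF that] site[OF that] by (simp add: F_def)
    qed
    fix e :: real assume "0 < e"
    then have "eventually (\<lambda>n. (\<integral>\<mu>. E n \<mu> \<partial>\<nu>) < e) sequentially" by (intro order_tendstoD(2)[OF E_lim])
    then obtain n where n: "(\<integral>\<mu>. E n \<mu> \<partial>\<nu>) < e" by (auto simp: eventually_sequentially)
    have E_abs: "\<bar>E n \<mu>\<bar> \<le> N + N" for \<mu> using E_bounds[of n \<mu>] by simp
    \<comment> \<open>The mesh of the net is tied to the index of the tent so that the
      discretisation error is exactly what \<open>D n\<close> majorises.\<close>
    let ?\<delta> = "1 / real (Suc n)"
    have \<delta>: "0 < ?\<delta>" by simp
    obtain J and \<theta> :: "real ^ 'd \<Rightarrow> real ^ 'd \<Rightarrow> real" where J: "finite J" "J \<subseteq> cball 0 R"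
      and \<theta>: "\<And>j. continuous_on UNIV (\<theta> j)" "\<And>j t. 0 \<le> \<theta> j t" "\<And>j t. j \<in> J \<Longrightarrow> \<theta> j t \<le> 1"
        "\<And>j t. \<theta> j t \<noteq> 0 \<Longrightarrow> norm (t - j) < ?\<delta>" "\<And>t. norm t \<le> R \<Longrightarrow> (\<Sum>j\<in>J. \<theta> j t) = 1"
      using partition_of_unity_ball[OF \<delta>, of R] by metis
    let ?S = "site_sum_approx ?w c \<Psi> J \<theta>" and ?b = "\<lambda>\<mu> :: 'd point measure. min 1 (\<integral>x. tent n (fst x) * b (snd x) \<partial>\<mu>)"
    have tb: "local_fun (\<lambda>x :: 'd point. tent n (fst x) * b (snd x))"
      by (rule local_fun_product[where R=1 and \<epsilon>=1]) (use b tent_continuous tent_bounds tent_support in auto)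
    have H_tame: "tame (\<lambda>\<mu>. ?b \<mu> * ?S \<mu>)"
      unfolding site_sum_approx_def
      by (intro tame_mult tame_sum tame_integral local_fun_times w w1 \<theta> shift_lipschitz_tame_shift[OF \<Psi>]
          tame_compose[where \<phi>="min 1", OF tame_integral[OF tb]] continuous_intros)
    have b01: "0 \<le> ?b \<mu>" "?b \<mu> \<le> 1" for \<mu> using local_fun_integral_nonneg[OF tb] by simp_all
    have err: "\<bar>site_sum ?w c \<Psi> \<mu> - ?S \<mu>\<bar> \<le> N * D n \<mu>" if \<mu>: "\<mu> \<in> N11" for \<mu>
    proof -
      have "\<bar>site_sum ?w c \<Psi> \<mu> - ?S \<mu>\<bar> \<le> N * min 1 (L * ?\<delta> * mass R' \<epsilon> \<mu>)"
        by (rule site_sum_approx_error[OF \<mu> \<Psi> c w w1 ww cut[OF \<mu>] N L(1) L(3)[OF \<mu>] mass_nonneg \<delta> J \<theta>])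
      also have "\<dots> \<le> N * D n \<mu>"
        unfolding D_def using g(2)[OF \<mu>] L(1) N by (intro mult_left_mono min.mono) auto
      finally show ?thesis .
    qed
    have H_bound: "\<bar>?b \<mu> * ?S \<mu>\<bar> \<le> N + N" if \<mu>: "\<mu> \<in> N11" for \<mu>
    proof -
      have "N * D n \<mu> \<le> N" using D[of n \<mu>] N by (intro mult_left_le) auto
      then have "\<bar>?S \<mu>\<bar> \<le> N + N" using err[OF \<mu>] site[OF \<mu>] by linarith
      then have "?b \<mu> * \<bar>?S \<mu>\<bar> \<le> 1 * (N + N)" using b01[of \<mu>] by (intro mult_mono) auto
      then show ?thesis using b01(1)[of \<mu>] by (simp add: abs_mult)
    qed
    have FH: "\<bar>F \<mu> - ?b \<mu> * ?S \<mu>\<bar> \<le> E n \<mu>" if \<mu>: "\<mu> \<in> N11" and one: "emeasure \<mu> ({0} \<times> {1<..}) = 1" for \<mu>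
    proof -
      \<comment> \<open>The factors are replaced one at a time: the mark while the sum, at most N,
        is kept, then the sum while the soft mark, at most 1, is kept. No bound on the discretised
        sum enters.\<close>
      have eq: "F \<mu> - ?b \<mu> * ?S \<mu> = (?B \<mu> - ?b \<mu>) * site_sum ?w c \<Psi> \<mu> + ?b \<mu> * (site_sum ?w c \<Psi> \<mu> - ?S \<mu>)"
        by (simp add: F_def algebra_simps)
      have "\<bar>F \<mu> - ?b \<mu> * ?S \<mu>\<bar> \<le> \<bar>?B \<mu> - ?b \<mu>\<bar> * site_sum ?w c \<Psi> \<mu> + ?b \<mu> * \<bar>site_sum ?w c \<Psi> \<mu> - ?S \<mu>\<bar>"
        using abs_triangle_ineq[of "(?B \<mu> - ?b \<mu>) * site_sum ?w c \<Psi> \<mu>" "?b \<mu> * (site_sum ?w c \<Psi> \<mu> - ?S \<mu>)"]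
        unfolding eq abs_mult abs_of_nonneg[OF site(1)[OF \<mu>]] abs_of_nonneg[OF b01(1)[of \<mu>]] .
      also have "\<dots> \<le> anchor_defect n \<mu> * N + 1 * (N * D n \<mu>)"
        by (intro add_mono mult_mono[OF anchor_approx[OF \<mu> one b] site(2)[OF \<mu>] anchor_defect_bounds(1) site(1)[OF \<mu>]]
            mult_mono[OF b01(2) err[OF \<mu>]]) simp_all
      finally show ?thesis by (simp add: E_def mult.commute)
    qed
    show "\<exists>H D C'. tame H \<and> tame D \<and> (\<forall>\<mu>\<in>N11. \<bar>H \<mu>\<bar> \<le> C' \<and> \<bar>D \<mu>\<bar> \<le> C') \<and>
      (\<forall>\<mu>\<in>N11. emeasure \<mu> ({0} \<times> {1<..}) = 1 \<longrightarrow> \<bar>F \<mu> - H \<mu>\<bar> \<le> D \<mu>) \<and> (\<integral>\<mu>. D \<mu> \<partial>\<nu>) < e"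
      by (intro exI[of _ "\<lambda>\<mu>. ?b \<mu> * ?S \<mu>"] exI[of _ "E n"] exI[of _ "N + N"] conjI ballI impI
          H_tame E_tame H_bound E_abs FH n)
  qed
qed

lemma mark_ennreal_finite:
  assumes "\<mu> \<in> N11" "continuous_on UNIV b" "\<And>s. b s \<le> 1"
  shows "ennreal (enn2real (mark (\<lambda>s. ennreal (b s)) 0 \<mu>)) = mark (\<lambda>s. ennreal (b s)) 0 \<mu>"
proof -
  have "mark (\<lambda>s. ennreal (b s)) 0 \<mu> \<le> 1"
    using borel_measurable_continuous_onI[OF assms(2)] assms(3) by (intro mark_le_1[OF assms(1)]) simp_all
  also have "\<dots> < top" by simp
  finally show ?thesis by simp
qed

lemma site_functional_nn:
  fixes a :: "real ^ 'd \<Rightarrow> real" and b :: "real \<Rightarrow> real" and \<Psi> :: "('d::finite) point measure \<Rightarrow> real"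
  assumes \<mu>: "\<mu> \<in> N11" and \<Psi>: "shift_lipschitz \<Psi>"
    and w: "local_fun (\<lambda>x. a (fst x) * b (snd x))" and a: "\<And>t. 0 \<le> a t"
    and b: "continuous_on UNIV b" "\<And>s. b s \<le> 1" "\<And>s. 0 \<le> b s"
  shows "ennreal (enn2real (mark (\<lambda>s. ennreal (b s)) 0 \<mu>) * site_sum (\<lambda>x. a (fst x) * b (snd x)) c \<Psi> \<mu>) =
    mark (\<lambda>s. ennreal (b s)) 0 \<mu> *
      (\<integral>\<^sup>+x. ennreal (b (snd x)) * ennreal (a (fst x) * \<Psi> (shift_pts (c *\<^sub>R fst x) \<mu>)) \<partial>\<mu>)"
proof -
  have "ennreal (b (snd x)) * ennreal (a (fst x) * \<Psi> (shift_pts (c *\<^sub>R fst x) \<mu>)) =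
      ennreal (a (fst x) * b (snd x) * \<Psi> (shift_pts (c *\<^sub>R fst x) \<mu>))" for x
    using b(3) by (simp add: mult_ac flip: ennreal_mult')
  then show ?thesis
    using site_sum_nonneg[OF \<mu> \<Psi> w, of c]
    by (simp add: site_sum_nn_integral[OF \<mu> \<Psi> w] ennreal_mult mark_ennreal_finite[OF \<mu> b(1,2)])
qed

text \<open>Both sides are integrals of bounded functionals of the type just treated, with c = 0 on
  the left and c = 1 on the right. They agree for the approximating laws eventually, so their limits
  agree; nonnegativity makes the translation between real and extended integrals faithful.\<close>

lemma limit_exchange:
  fixes \<Psi> :: "('d::finite) point measure \<Rightarrow> real" and a :: "real ^ 'd \<Rightarrow> real" and b :: "real \<Rightarrow> real"
  assumes W: "weakly_converges vague_topology \<nu>s \<nu> G" and G: "G \<noteq> bot"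
    and anch: "eventually (\<lambda>i. anchored (\<nu>s i)) G" "anchored \<nu>"
    and ex: "eventually (\<lambda>i. exchange (\<lambda>s. ennreal (b s)) (\<nu>s i)) G"
    and a: "continuous_on UNIV a" "\<And>t. 0 \<le> a t" "\<And>t. a t \<le> 1" "\<And>t. a t \<noteq> 0 \<Longrightarrow> norm t < R"
    and b: "continuous_on UNIV b" "\<And>s. 0 \<le> b s" "\<And>s. b s \<le> 1" "\<And>s. b s \<noteq> 0 \<Longrightarrow> 1 < s"
    and \<Psi>: "shift_lipschitz \<Psi>"
    and cut: "\<And>\<mu> z. \<mu> \<in> N11 \<Longrightarrow> norm z \<le> R \<Longrightarrow> N < mass R 1 \<mu> \<Longrightarrow> \<Psi> (shift_pts z \<mu>) = 0" and N: "0 \<le> N"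
  shows "(\<integral>\<^sup>+\<mu>. mark (\<lambda>s. ennreal (b s)) 0 \<mu> *
      (\<integral>\<^sup>+x. ennreal (b (snd x)) * ennreal (a (fst x) * \<Psi> \<mu>) \<partial>\<mu>) \<partial>\<nu>) =
    (\<integral>\<^sup>+\<mu>. mark (\<lambda>s. ennreal (b s)) 0 \<mu> *
      (\<integral>\<^sup>+x. ennreal (b (snd x)) * ennreal (a (- fst x) * \<Psi> (shift_pts (fst x) \<mu>)) \<partial>\<mu>) \<partial>\<nu>)"
proof -
  let ?F = "\<lambda>a c \<mu>. enn2real (mark (\<lambda>s. ennreal (b s)) 0 \<mu>) * site_sum (\<lambda>x. a (fst x) * b (snd x)) c \<Psi> \<mu>"
  let ?I = "\<lambda>a c \<kappa>. \<integral>\<^sup>+\<mu>. mark (\<lambda>s. ennreal (b s)) 0 \<mu> *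
      (\<integral>\<^sup>+x. ennreal (b (snd x)) * ennreal (a (fst x) * \<Psi> (shift_pts (c *\<^sub>R fst x) \<mu>)) \<partial>\<mu>) \<partial>\<kappa>"
  \<comment> \<open>The right-hand side evaluates a at the reflected position. The reflection
    preserves continuity, bounds and the ball containing the support, so it is absorbed into the
    weight.\<close>
  define a' where "a' t = a (- t)" for t
  have a': "continuous_on UNIV a'" "\<And>t. 0 \<le> a' t" "\<And>t. a' t \<le> 1" "\<And>t. a' t \<noteq> 0 \<Longrightarrow> norm t < R"
    using a(2,3) a(4)[of "- t" for t] unfolding a'_def
    by (auto intro!: continuous_on_compose2[OF a(1)] continuous_intros)
  have conv: "((\<lambda>i. \<integral>\<mu>. ?F \<alpha> c \<mu> \<partial>\<nu>s i) \<longlongrightarrow> (\<integral>\<mu>. ?F \<alpha> c \<mu> \<partial>\<nu>)) G"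
    and int: "anchored \<kappa> \<Longrightarrow> ennreal (\<integral>\<mu>. ?F \<alpha> c \<mu> \<partial>\<kappa>) = ?I \<alpha> c \<kappa>"
    and nonneg: "anchored \<kappa> \<Longrightarrow> 0 \<le> (\<integral>\<mu>. ?F \<alpha> c \<mu> \<partial>\<kappa>)"
    if \<alpha>: "continuous_on UNIV \<alpha>" "\<And>t. 0 \<le> \<alpha> t" "\<And>t. \<alpha> t \<le> 1" "\<And>t. \<alpha> t \<noteq> 0 \<Longrightarrow> norm t < R"
      and c: "\<bar>c\<bar> \<le> 1" for \<alpha> :: "real ^ 'd \<Rightarrow> real" and c :: real and \<kappa>
  proof -
    let ?w = "\<lambda>x. \<alpha> (fst x) * b (snd x)"
    show "((\<lambda>i. \<integral>\<mu>. ?F \<alpha> c \<mu> \<partial>\<nu>s i) \<longlongrightarrow> (\<integral>\<mu>. ?F \<alpha> c \<mu> \<partial>\<nu>)) G"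
      by (rule weak_limit_site_sum[OF W anch \<alpha> b \<Psi> c cut N])
    have w: "local_fun ?w" by (rule local_fun_product[OF \<alpha> b]) simp_all
    have w1: "?w x \<le> 1" for x using \<alpha> b by (simp add: mult_le_one)
    have ww: "x \<in> window R 1" if "?w x \<noteq> 0" for x
      using that \<alpha>(4)[of "fst x"] b(4)[of "snd x"] by (cases x) (auto simp: mem_window)
    have site: "0 \<le> site_sum ?w c \<Psi> \<mu>" "site_sum ?w c \<Psi> \<mu> \<le> N" if "\<mu> \<in> N11" for \<mu>
      using site_sum_nonneg[OF that \<Psi> w] site_sum_bound[OF that \<Psi> c w w1 ww cut[OF that] N] by auto
    have bm: "(\<lambda>s. ennreal (b s)) \<in> borel_measurable borel"
      using borel_measurable_continuous_onI[OF b(1)] by simp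
    have F0: "0 \<le> ?F \<alpha> c \<mu>" if "\<mu> \<in> N11" for \<mu> using site(1)[OF that] by simp
    have F_le: "\<bar>?F \<alpha> c \<mu>\<bar> \<le> 1 * N" if "\<mu> \<in> N11" for \<mu>
    proof -
      have "enn2real (mark (\<lambda>s. ennreal (b s)) 0 \<mu>) \<le> 1"
        using mark_le_1[OF that bm, of 0] b(3) enn2real_mono[of "mark (\<lambda>s. ennreal (b s)) 0 \<mu>" 1] by auto
      then have "?F \<alpha> c \<mu> \<le> 1 * N" using site[OF that] by (intro mult_mono) auto
      then show ?thesis using F0[OF that] by simp
    qed
    have F_meas: "?F \<alpha> c \<in> borel_measurable N11_space"
      by (intro borel_measurable_times site_sum_measurable[OF \<Psi> w] borel_measurable_enn2real mark_measurable[OF bm])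
    assume \<kappa>: "anchored \<kappa>"
    have AE0: "AE \<mu> in \<kappa>. 0 \<le> ?F \<alpha> c \<mu>"
      by (rule AE_I2) (simp add: anchored_space[OF \<kappa>] F0)
    then show "0 \<le> (\<integral>\<mu>. ?F \<alpha> c \<mu> \<partial>\<kappa>)" by (rule integral_nonneg_AE)
    have "ennreal (\<integral>\<mu>. ?F \<alpha> c \<mu> \<partial>\<kappa>) = (\<integral>\<^sup>+\<mu>. ennreal (?F \<alpha> c \<mu>) \<partial>\<kappa>)"
      by (rule nn_integral_eq_integral[OF anchored_integrable[OF \<kappa> F_meas F_le] AE0, symmetric])
    also have "\<dots> = ?I \<alpha> c \<kappa>"
      by (intro nn_integral_cong site_functional_nn[OF _ \<Psi> w \<alpha>(2) b(1,3,2)]) (simp add: anchored_space[OF \<kappa>])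
    finally show "ennreal (\<integral>\<mu>. ?F \<alpha> c \<mu> \<partial>\<kappa>) = ?I \<alpha> c \<kappa>" .
  qed
  have I0: "?I a 0 \<kappa> = (\<integral>\<^sup>+\<mu>. mark (\<lambda>s. ennreal (b s)) 0 \<mu> *
      (\<integral>\<^sup>+x. ennreal (b (snd x)) * ennreal (a (fst x) * \<Psi> \<mu>) \<partial>\<mu>) \<partial>\<kappa>)" if "anchored \<kappa>" for \<kappa>
    by (intro nn_integral_cong) (simp add: anchored_space[OF that] shift_0)
  have "eventually (\<lambda>i. (\<integral>\<mu>. ?F a' 1 \<mu> \<partial>\<nu>s i) = (\<integral>\<mu>. ?F a 0 \<mu> \<partial>\<nu>s i)) G"
    using anch(1) ex
  proof eventually_elim
    case (elim i)
    have am: "a \<in> borel_measurable borel" by (rule borel_measurable_continuous_onI[OF a(1)])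
    have "(\<lambda>p. ennreal (a (fst p) * \<Psi> (snd p))) \<in> borel_measurable (borel \<Otimes>\<^sub>M N11_space)"
      by (intro measurable_compose[OF _ measurable_ennreal] borel_measurable_times measurable_compose[OF measurable_fst am]
          measurable_compose[OF measurable_snd shift_lipschitz_measurable[OF \<Psi>]])
    from bspec[OF elim(2)[unfolded exchange_def] this]
    have "?I a 0 (\<nu>s i) = ?I a' 1 (\<nu>s i)" unfolding I0[OF elim(1)] by (simp add: a'_def)
    then have "ennreal (\<integral>\<mu>. ?F a 0 \<mu> \<partial>\<nu>s i) = ennreal (\<integral>\<mu>. ?F a' 1 \<mu> \<partial>\<nu>s i)"
      using int[OF a, of 0] int[OF a', of 1] elim(1) by simp
    then show ?case using nonneg[OF a, of 0] nonneg[OF a', of 1] elim(1) by simp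
  qed
  with conv[OF a', of 1] have "((\<lambda>i. \<integral>\<mu>. ?F a 0 \<mu> \<partial>\<nu>s i) \<longlongrightarrow> (\<integral>\<mu>. ?F a' 1 \<mu> \<partial>\<nu>)) G"
    by (simp cong: tendsto_cong)
  from tendsto_unique[OF G conv[OF a, of 0] this]
  have "(\<integral>\<mu>. ?F a 0 \<mu> \<partial>\<nu>) = (\<integral>\<mu>. ?F a' 1 \<mu> \<partial>\<nu>)" by simp
  then have "?I a 0 \<nu> = ?I a' 1 \<nu>" using int[OF a, of 0 \<nu>] int[OF a', of 1 \<nu>] anch(2) by simp
  then show ?thesis unfolding I0[OF anch(2)] by (simp add: a'_def)
qed

text \<open>Collects what the limit argument asks of the conditioned laws, each property for large u
  only.\<close>

lemma tail_law_eventually: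
  fixes Xt :: "'v \<Rightarrow> ('d::finite) point measure"
  assumes palm: "palm_version M X lam P Xt" and X: "marked_point_process M X" and lam: "0 < lam"
    and r: "\<And>u. 0 < u \<Longrightarrow> 0 < r u"
    and tail: "tail_configuration P Xt r Q Y"
  defines "\<nu> \<equiv> distr Q N11_space Y"
  shows "weakly_converges vague_topology (\<lambda>u. tail_law P Xt (r u) u) \<nu> at_top"
    and "anchored \<nu>"
    and "eventually (\<lambda>u. anchored (tail_law P Xt (r u) u)) at_top"
    and "\<And>b. b \<in> borel_measurable borel \<Longrightarrow> (\<And>s. s \<le> 1 \<Longrightarrow> b s = 0) \<Longrightarrow>
      eventually (\<lambda>u. exchange b (tail_law P Xt (r u) u)) at_top"
proof -
  have P: "prob_space P" and Xt: "Xt \<in> P \<rightarrow>\<^sub>M N11_space"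
    using palm by (simp_all add: palm_version_def marked_point_process_def measurable_N10_space_iff)
  interpret Q: prob_space Q using tail by (simp add: tail_configuration_def)
  have Y: "Y \<in> Q \<rightarrow>\<^sub>M N11_space" using tail by (simp add: tail_configuration_def)
  show W: "weakly_converges vague_topology (\<lambda>u. tail_law P Xt (r u) u) \<nu> at_top"
    using tail by (simp add: tail_configuration_def tail_law_def \<nu>_def)
  have "(\<lambda>\<mu>. emeasure \<mu> ({0} \<times> {1<..})) \<in> borel_measurable (N11_space :: 'd point measure measure)"
    by (intro N11_emeasure_measurable half_column_sets) simp
  then have "{\<mu> \<in> space N11_space. emeasure \<mu> ({0} \<times> {1<..}) = 1} \<in> sets (N11_space :: 'd point measure measure)"
    by measurable
  then have "AE \<mu> in distr Q N11_space Y. emeasure \<mu> ({0} \<times> {1<..}) = 1"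
    using tail by (subst AE_distr_iff[OF Y]) (simp_all add: tail_configuration_def)
  then show \<nu>: "anchored \<nu>"
    using Q.prob_space_distr[OF Y] by (simp add: anchored_def \<nu>_def)
  \<comment> \<open>Beyond this level u is positive and exceeds the unspecified score of an empty
    position, so the conditioning event consists of configurations with a point at the
    origin.\<close>
  let ?c = "max 1 (THE s. False) :: real"
  have large: "eventually (\<lambda>u. ?c \<le> u) at_top" by (rule eventually_ge_at_top)
  show "eventually (\<lambda>u. exchange b (tail_law P Xt (r u) u)) at_top"
    if "b \<in> borel_measurable borel" "\<And>s. s \<le> 1 \<Longrightarrow> b s = 0" for b
    using large by eventually_elim (intro tail_law_exchange[OF palm X lam] that r, auto)
  \<comment> \<open>Testing the weak convergence with the constant 1 shows that the conditioning
    event has positive probability for large u: an event of probability 0 would give the zero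
    measure, while the limit has mass 1.\<close>
  have "((\<lambda>u. \<integral>\<mu>. 1 \<partial>tail_law P Xt (r u) u :: real) \<longlongrightarrow> (\<integral>\<mu>. 1 \<partial>\<nu>)) at_top"
    by (rule weak_limit_tame[OF W tame_const, where C=1]) simp
  moreover have "(\<integral>\<mu>. 1 \<partial>\<nu>) = (1::real)"
    using \<nu> prob_space.prob_space[of \<nu>] by (simp add: anchored_def)
  ultimately have "eventually (\<lambda>u. 0 < (\<integral>\<mu>. 1 \<partial>tail_law P Xt (r u) u :: real)) at_top"
    by (intro order_tendstoD(1)) auto
  then show "eventually (\<lambda>u. anchored (tail_law P Xt (r u) u)) at_top"
    using large
  proof eventually_elim
    case (elim u)
    let ?A = "{\<omega> \<in> space P. u < score (Xt \<omega>) 0}"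
    have u: "0 < u" "(THE s. False) \<le> u" "0 < r u" using elim(2) r by auto
    have A: "?A \<in> sets P" using score_event_sets[OF Xt] u by simp
    have TXt: "(\<lambda>\<omega>. scaling (r u) u (Xt \<omega>)) \<in> uniform_measure P ?A \<rightarrow>\<^sub>M N11_space"
      using measurable_compose[OF Xt scaling_measurable[OF u(1,3)]] by simp
    have "emeasure P ?A \<noteq> 0"
    proof
      assume zero: "emeasure P ?A = 0"
      have "emeasure (tail_law P Xt (r u) u) N11 = emeasure (uniform_measure P ?A) (space P)"
        unfolding tail_law_def using sets.top[of "N11_space :: 'd point measure measure"] measurable_space[OF TXt]
        by (subst emeasure_distr[OF TXt]) (auto intro!: arg_cong[where f="emeasure _"])
      also have "\<dots> = 0" using A zero by (subst emeasure_uniform_measure) (auto simp: Int_absorb2)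
      finally have "(\<integral>\<mu>. 1 \<partial>tail_law P Xt (r u) u) = (0::real)"
        by (simp add: measure_def tail_law_def)
      then show False using elim(1) by simp
    qed
    then show ?case by (rule tail_law_anchored[OF Xt P u(1,3,2)])
  qed
qed

section \<open>Campbell measures\<close>

text \<open>With sums over the points of a random configuration written as integrals against one
  measure on pairs, monotone limits and changes of variables act on a single integral.\<close>

definition campbell :: "('d::finite) point measure measure \<Rightarrow> ('d point measure \<times> 'd point) measure" where
  "campbell \<nu> = measure_of (N11 \<times> EE) (sets (N11_space \<Otimes>\<^sub>M borel_EE))
     (\<lambda>A. \<integral>\<^sup>+\<mu>. \<integral>\<^sup>+x. indicator A (\<mu>, x) \<partial>\<mu> \<partial>\<nu>)"

lemma space_N11_pair: "space (N11_space \<Otimes>\<^sub>M borel_EE) = N11 \<times> (EE :: ('d::finite) point set)"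
  by (simp add: space_pair_measure)

lemma sets_campbell [measurable_cong, simp]: "sets (campbell \<nu>) = sets (N11_space \<Otimes>\<^sub>M borel_EE)"
  unfolding campbell_def space_N11_pair[symmetric] by (rule sets.sets_measure_of_eq)

lemma space_campbell [simp]: "space (campbell \<nu>) = N11 \<times> EE"
  using sets_eq_imp_space_eq[OF sets_campbell[of \<nu>]] by (simp add: space_N11_pair)

lemma N11_section_measurable:
  assumes "f \<in> borel_measurable (N11_space \<Otimes>\<^sub>M borel_EE)" "\<mu> \<in> N11"
  shows "(\<lambda>x. f (\<mu>, x)) \<in> borel_measurable \<mu>"
  using measurable_N11[OF assms(2) measurable_Pair2[OF assms(1)]] assms(2) by simp

lemma N11_sum_measurable:
  assumes "f \<in> borel_measurable (N11_space \<Otimes>\<^sub>M borel_EE)" "sets \<nu> = sets N11_space"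
  shows "(\<lambda>\<mu>. \<integral>\<^sup>+x. f (\<mu>, x) \<partial>\<mu>) \<in> borel_measurable \<nu>"
proof -
  have "(\<lambda>\<mu>. \<mu>) \<in> N11_space \<rightarrow>\<^sub>M N11_space" by simp
  from kernel_nn_integral_measurable_pair[OF this assms(1)] show ?thesis
    using assms(2) by (simp cong: measurable_cong_sets)
qed

lemma emeasure_campbell:
  assumes \<nu>: "sets \<nu> = sets N11_space" and A: "A \<in> sets (N11_space \<Otimes>\<^sub>M borel_EE)"
  shows "emeasure (campbell \<nu>) A = (\<integral>\<^sup>+\<mu>. \<integral>\<^sup>+x. indicator A (\<mu>, x) \<partial>\<mu> \<partial>\<nu>)"
proof (rule emeasure_measure_of[OF campbell_def])
  show "sets (N11_space \<Otimes>\<^sub>M borel_EE) \<subseteq> Pow (N11 \<times> EE)"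
    using sets.space_closed[of "N11_space \<Otimes>\<^sub>M borel_EE"] by (simp add: space_N11_pair)
  show "A \<in> sets (campbell \<nu>)" using A by simp
  show "positive (sets (campbell \<nu>)) (\<lambda>A. \<integral>\<^sup>+\<mu>. \<integral>\<^sup>+x. indicator A (\<mu>, x) \<partial>\<mu> \<partial>\<nu>)"
    by (simp add: positive_def)
  have space: "space \<nu> = N11" using sets_eq_imp_space_eq[OF \<nu>] by simp
  show "countably_additive (sets (campbell \<nu>)) (\<lambda>A. \<integral>\<^sup>+\<mu>. \<integral>\<^sup>+x. indicator A (\<mu>, x) \<partial>\<mu> \<partial>\<nu>)"
    unfolding countably_additive_def
  proof (intro allI impI)
    fix B :: "nat \<Rightarrow> _" assume B: "range B \<subseteq> sets (campbell \<nu>)" "disjoint_family B"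
    have Bi: "(indicator (B i) :: _ \<Rightarrow> ennreal) \<in> borel_measurable (N11_space \<Otimes>\<^sub>M borel_EE)" for i
      using B(1) by (intro borel_measurable_indicator) auto
    have "(\<Sum>i. \<integral>\<^sup>+\<mu>. \<integral>\<^sup>+x. indicator (B i) (\<mu>, x) \<partial>\<mu> \<partial>\<nu>) = (\<integral>\<^sup>+\<mu>. (\<Sum>i. \<integral>\<^sup>+x. indicator (B i) (\<mu>, x) \<partial>\<mu>) \<partial>\<nu>)"
      by (rule nn_integral_suminf[symmetric]) (rule N11_sum_measurable[OF Bi \<nu>])
    also have "\<dots> = (\<integral>\<^sup>+\<mu>. \<integral>\<^sup>+x. (\<Sum>i. indicator (B i) (\<mu>, x)) \<partial>\<mu> \<partial>\<nu>)"
      by (intro nn_integral_cong nn_integral_suminf[symmetric] N11_section_measurable Bi) (simp add: space)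
    also have "\<dots> = (\<integral>\<^sup>+\<mu>. \<integral>\<^sup>+x. indicator (\<Union>i. B i) (\<mu>, x) \<partial>\<mu> \<partial>\<nu>)"
      by (simp add: suminf_indicator[OF B(2)])
    finally show "(\<Sum>i. \<integral>\<^sup>+\<mu>. \<integral>\<^sup>+x. indicator (B i) (\<mu>, x) \<partial>\<mu> \<partial>\<nu>) = (\<integral>\<^sup>+\<mu>. \<integral>\<^sup>+x. indicator (\<Union>i. B i) (\<mu>, x) \<partial>\<mu> \<partial>\<nu>)" .
  qed
qed

lemma nn_integral_campbell:
  assumes \<nu>: "sets \<nu> = sets N11_space" and f: "f \<in> borel_measurable (N11_space \<Otimes>\<^sub>M borel_EE)"
  shows "(\<integral>\<^sup>+p. f p \<partial>campbell \<nu>) = (\<integral>\<^sup>+\<mu>. \<integral>\<^sup>+x. f (\<mu>, x) \<partial>\<mu> \<partial>\<nu>)"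
  using f
proof (induction rule: borel_measurable_induct)
  case (cong f g)
  have space: "space \<nu> = N11" using sets_eq_imp_space_eq[OF \<nu>] by simp
  have "(\<integral>\<^sup>+p. f p \<partial>campbell \<nu>) = (\<integral>\<^sup>+p. g p \<partial>campbell \<nu>)"
    using cong.hyps(3) by (intro nn_integral_cong) (simp add: space_N11_pair)
  moreover have "(\<integral>\<^sup>+\<mu>. \<integral>\<^sup>+x. f (\<mu>, x) \<partial>\<mu> \<partial>\<nu>) = (\<integral>\<^sup>+\<mu>. \<integral>\<^sup>+x. g (\<mu>, x) \<partial>\<mu> \<partial>\<nu>)"
    using cong.hyps(3) by (intro nn_integral_cong) (simp add: space N11_space_eq space_N11_pair)
  ultimately show ?case using cong.IH by simp
next
  case (set A)
  then have "(\<integral>\<^sup>+p. indicator A p \<partial>campbell \<nu>) = emeasure (campbell \<nu>) A"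
    by (intro nn_integral_indicator) simp
  then show ?case by (simp only: emeasure_campbell[OF \<nu> set])
next
  case (mult u c)
  have space: "space \<nu> = N11" using sets_eq_imp_space_eq[OF \<nu>] by simp
  have "(\<integral>\<^sup>+\<mu>. \<integral>\<^sup>+x. c * u (\<mu>, x) \<partial>\<mu> \<partial>\<nu>) = (\<integral>\<^sup>+\<mu>. c * (\<integral>\<^sup>+x. u (\<mu>, x) \<partial>\<mu>) \<partial>\<nu>)"
    by (intro nn_integral_cong nn_integral_cmult N11_section_measurable mult.hyps) (simp add: space)
  also have "\<dots> = c * (\<integral>\<^sup>+\<mu>. \<integral>\<^sup>+x. u (\<mu>, x) \<partial>\<mu> \<partial>\<nu>)"
    by (intro nn_integral_cmult N11_sum_measurable mult.hyps \<nu>)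
  finally show ?case using mult.hyps(2) mult.IH by (simp add: nn_integral_cmult)
next
  case (add u v)
  have space: "space \<nu> = N11" using sets_eq_imp_space_eq[OF \<nu>] by simp
  have "(\<integral>\<^sup>+\<mu>. \<integral>\<^sup>+x. v (\<mu>, x) + u (\<mu>, x) \<partial>\<mu> \<partial>\<nu>) =
      (\<integral>\<^sup>+\<mu>. (\<integral>\<^sup>+x. v (\<mu>, x) \<partial>\<mu>) + (\<integral>\<^sup>+x. u (\<mu>, x) \<partial>\<mu>) \<partial>\<nu>)"
    by (intro nn_integral_cong nn_integral_add N11_section_measurable add.hyps) (simp_all add: space)
  also have "\<dots> = (\<integral>\<^sup>+\<mu>. \<integral>\<^sup>+x. v (\<mu>, x) \<partial>\<mu> \<partial>\<nu>) + (\<integral>\<^sup>+\<mu>. \<integral>\<^sup>+x. u (\<mu>, x) \<partial>\<mu> \<partial>\<nu>)"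
    by (intro nn_integral_add N11_sum_measurable add.hyps \<nu>)
  finally show ?case using add.hyps(1,3) add.IH by (simp add: nn_integral_add)
next
  case (seq U)
  have space: "space \<nu> = N11" using sets_eq_imp_space_eq[OF \<nu>] by simp
  have inc: "U i p \<le> U j p" if "i \<le> j" for i j p
    using \<open>incseq U\<close> that by (cases p) (simp add: incseq_def le_fun_def)
  have "(\<integral>\<^sup>+\<mu>. \<integral>\<^sup>+x. (SUP i. U i (\<mu>, x)) \<partial>\<mu> \<partial>\<nu>) = (\<integral>\<^sup>+\<mu>. (SUP i. \<integral>\<^sup>+x. U i (\<mu>, x) \<partial>\<mu>) \<partial>\<nu>)"
  proof (rule nn_integral_cong)
    fix \<mu> assume "\<mu> \<in> space \<nu>"
    then have \<mu>: "\<mu> \<in> N11" by (simp add: space)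
    show "(\<integral>\<^sup>+x. (SUP i. U i (\<mu>, x)) \<partial>\<mu>) = (SUP i. \<integral>\<^sup>+x. U i (\<mu>, x) \<partial>\<mu>)"
    proof (rule nn_integral_monotone_convergence_SUP[of "\<lambda>i x. U i (\<mu>, x)" \<mu>])
      show "incseq (\<lambda>i x. U i (\<mu>, x))" unfolding incseq_def by (intro allI impI le_funI inc)
    qed (rule N11_section_measurable[OF seq.hyps(1) \<mu>])
  qed
  also have "\<dots> = (SUP i. \<integral>\<^sup>+\<mu>. \<integral>\<^sup>+x. U i (\<mu>, x) \<partial>\<mu> \<partial>\<nu>)"
  proof (rule nn_integral_monotone_convergence_SUP[of "\<lambda>i \<mu>. \<integral>\<^sup>+x. U i (\<mu>, x) \<partial>\<mu>" \<nu>])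
    show "incseq (\<lambda>i \<mu>. \<integral>\<^sup>+x. U i (\<mu>, x) \<partial>\<mu>)"
      unfolding incseq_def by (intro allI impI le_funI nn_integral_mono inc)
  qed (rule N11_sum_measurable[OF seq.hyps(1) \<nu>])
  also have "\<dots> = (SUP i. \<integral>\<^sup>+p. U i p \<partial>campbell \<nu>)" using seq.IH by simp
  also have "\<dots> = (\<integral>\<^sup>+p. (SUP i. U i p) \<partial>campbell \<nu>)"
    using nn_integral_monotone_convergence_SUP[OF \<open>incseq U\<close>, of "campbell \<nu>"] seq.hyps(1)
    by (simp cong: measurable_cong_sets)
  finally show ?case by (simp add: image_comp)
qed

section \<open>A generating class for the point measure space\<close>

text \<open>The approximating functionals are monotone only on \<open>N11\<close>, not on all
  measures, so they are set to 0 outside the space before monotone convergence is applied.\<close>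

lemma nn_integral_LIMSEQ_on_space:
  assumes mono: "\<And>x m n. x \<in> space M \<Longrightarrow> m \<le> n \<Longrightarrow> f m x \<le> f n x"
    and meas: "\<And>n. f n \<in> borel_measurable M"
    and lim: "\<And>x. x \<in> space M \<Longrightarrow> (\<lambda>n. f n x) \<longlonglongrightarrow> u x"
  shows "(\<lambda>n. \<integral>\<^sup>+x. f n x \<partial>M) \<longlonglongrightarrow> (\<integral>\<^sup>+x. u x \<partial>M)"
proof -
  let ?g = "\<lambda>n x. if x \<in> space M then f n x else 0" and ?v = "\<lambda>x. if x \<in> space M then u x else 0"
  have "(\<lambda>n. \<integral>\<^sup>+x. ?g n x \<partial>M) \<longlonglongrightarrow> (\<integral>\<^sup>+x. ?v x \<partial>M)"
  proof (rule nn_integral_LIMSEQ)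
    show "incseq ?g" using mono by (auto simp: incseq_def le_fun_def)
    show "?g n \<in> borel_measurable M" for n using meas[of n] by (simp cong: measurable_cong)
    show "(\<lambda>n. ?g n x) \<longlonglongrightarrow> ?v x" for x using lim by simp
  qed
  moreover have "(\<integral>\<^sup>+x. ?g n x \<partial>M) = (\<integral>\<^sup>+x. f n x \<partial>M)" for n by (intro nn_integral_cong) simp
  moreover have "(\<integral>\<^sup>+x. ?v x \<partial>M) = (\<integral>\<^sup>+x. u x \<partial>M)" by (intro nn_integral_cong) simp
  ultimately show ?thesis by simp
qed

text \<open>One profile for all monotone approximations below: of open sets through the distance to
  the complement, of the scores above 1, and of events that compare an integral with a constant. It
  increases in n and is Lipschitz in y.\<close>

definition ramp :: "nat \<Rightarrow> real \<Rightarrow> real" where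
  "ramp n y = min 1 (max 0 (real n * y))"

lemma ramp_bounds: "0 \<le> ramp n y" "ramp n y \<le> 1"
  by (simp_all add: ramp_def)

lemma ramp_pos: "ramp n y \<noteq> 0 \<Longrightarrow> 0 < y"
  by (rule ccontr) (simp add: ramp_def mult_nonneg_nonpos)

lemma ramp_continuous: "continuous_on UNIV (ramp n)"
  unfolding ramp_def by (intro continuous_intros)

lemma ramp_mono: "m \<le> n \<Longrightarrow> ramp m y \<le> ramp n y"
proof (cases "0 \<le> y")
  case True
  assume "m \<le> n"
  then have "real m * y \<le> real n * y" using True by (intro mult_right_mono) auto
  then show ?thesis unfolding ramp_def by linarith
qed (simp add: ramp_def mult_nonneg_nonpos)

lemma ramp_lipschitz: "\<bar>ramp n x - ramp n y\<bar> \<le> real n * \<bar>x - y\<bar>"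
proof -
  have "\<bar>ramp n x - ramp n y\<bar> \<le> \<bar>real n * x - real n * y\<bar>" unfolding ramp_def by linarith
  also have "\<dots> = real n * \<bar>x - y\<bar>" by (simp add: abs_mult flip: right_diff_distrib)
  finally show ?thesis .
qed

lemma ramp_tendsto: "(\<lambda>n. ramp n y) \<longlonglongrightarrow> indicator {0<..} y"
proof (cases "0 < y")
  case True
  obtain N where N: "1 / y < real N" using reals_Archimedean2 by blast
  have "ramp n y = 1" if "N \<le> n" for n
  proof -
    have "1 / y \<le> real n" using N that by linarith
    then show ?thesis using True by (simp add: ramp_def field_simps)
  qed
  then have "eventually (\<lambda>n. ramp n y = 1) sequentially" by (auto simp: eventually_sequentially)
  then show ?thesis using True by (simp add: tendsto_eventually)
next
  case False
  then have "ramp n y = 0" for n using ramp_pos by blast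
  then show ?thesis using False by simp
qed

section \<open>Lipschitz functions increasing to the indicator of an open set\<close>

definition bump :: "nat \<Rightarrow> 'a::metric_space set \<Rightarrow> 'a \<Rightarrow> real" where
  "bump n U x = ramp n (infdist x (- U))"

lemma bump_bounds: "0 \<le> bump n U x" "bump n U x \<le> 1"
  by (simp_all add: bump_def ramp_bounds)

lemma bump_support: assumes "bump n U x \<noteq> 0" shows "x \<in> U"
proof (rule ccontr)
  assume "x \<notin> U"
  then have "infdist x (- U) = 0" by (intro infdist_zero) simp
  then show False using assms by (simp add: bump_def ramp_def)
qed

lemma bump_continuous: "continuous_on UNIV (bump n U)"
  unfolding bump_def by (intro continuous_on_compose2[OF ramp_continuous] continuous_on_infdist continuous_on_id) auto

lemma bump_mono: "m \<le> n \<Longrightarrow> bump m U x \<le> bump n U x"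
  by (simp add: bump_def ramp_mono)

lemma bump_lipschitz: "\<bar>bump n U x - bump n U y\<bar> \<le> real n * dist x y"
proof -
  have "\<bar>bump n U x - bump n U y\<bar> \<le> real n * \<bar>infdist x (- U) - infdist y (- U)\<bar>"
    unfolding bump_def by (rule ramp_lipschitz)
  also have "\<dots> \<le> real n * dist x y" by (intro mult_left_mono infdist_triangle_abs) simp
  finally show ?thesis .
qed

text \<open>For an open proper subset the distance to the complement is positive exactly on the set.
  For the whole space it would be the distance to the empty set, which is 0 by convention, and the
  bumps would vanish.\<close>

lemma bump_tendsto:
  assumes "open U" "U \<noteq> UNIV" shows "(\<lambda>n. bump n U x) \<longlonglongrightarrow> indicator U x"
proof -
  have "closed (- U)" "- U \<noteq> {}" using assms by auto
  from in_closed_iff_infdist_zero[OF this, of x] infdist_nonneg[of x "- U"]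
  have "indicator {0<..} (infdist x (- U)) = (indicator U x :: real)" by (auto simp: indicator_def)
  then show ?thesis using ramp_tendsto[of "infdist x (- U)"] by (simp add: bump_def)
qed

text \<open>Events to which the limit identity can be carried by monotone convergence. Products of
  the approximating functionals make the class stable under intersection, as uniqueness of measures
  requires.\<close>

definition approximable :: "('d::finite) point measure set \<Rightarrow> bool" where
  "approximable C \<longleftrightarrow> C \<subseteq> N11 \<and> (\<exists>\<Psi>. (\<forall>n. shift_lipschitz (\<Psi> n)) \<and>
     (\<forall>\<mu>\<in>N11. (\<forall>m n. m \<le> n \<longrightarrow> \<Psi> m \<mu> \<le> \<Psi> n \<mu>) \<and> (\<lambda>n. \<Psi> n \<mu>) \<longlonglongrightarrow> (indicator C \<mu> :: real)))"

lemma approximable_Int: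
  assumes "approximable C" "approximable D" shows "approximable (C \<inter> D)"
proof -
  obtain \<Psi> where \<Psi>: "C \<subseteq> N11" "\<And>n. shift_lipschitz (\<Psi> n)" "\<And>\<mu> m n. \<mu> \<in> N11 \<Longrightarrow> m \<le> n \<Longrightarrow> \<Psi> m \<mu> \<le> \<Psi> n \<mu>"
    "\<And>\<mu>. \<mu> \<in> N11 \<Longrightarrow> (\<lambda>n. \<Psi> n \<mu>) \<longlonglongrightarrow> (indicator C \<mu> :: real)"
    using assms(1) unfolding approximable_def by blast
  obtain \<Phi> where \<Phi>: "\<And>n. shift_lipschitz (\<Phi> n)" "\<And>\<mu> m n. \<mu> \<in> N11 \<Longrightarrow> m \<le> n \<Longrightarrow> \<Phi> m \<mu> \<le> \<Phi> n \<mu>"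
    "\<And>\<mu>. \<mu> \<in> N11 \<Longrightarrow> (\<lambda>n. \<Phi> n \<mu>) \<longlonglongrightarrow> (indicator D \<mu> :: real)"
    using assms(2) unfolding approximable_def by blast
  show ?thesis
    unfolding approximable_def
  proof (intro conjI exI[of _ "\<lambda>n \<mu>. \<Psi> n \<mu> * \<Phi> n \<mu>"] allI ballI impI)
    show "C \<inter> D \<subseteq> N11" using \<Psi>(1) by blast
    show "shift_lipschitz (\<lambda>\<mu>. \<Psi> n \<mu> * \<Phi> n \<mu>)" for n by (intro shift_lipschitz_mult \<Psi> \<Phi>)
    fix \<mu> :: "'a point measure" assume \<mu>: "\<mu> \<in> N11"
    show "\<Psi> m \<mu> * \<Phi> m \<mu> \<le> \<Psi> n \<mu> * \<Phi> n \<mu>" if "m \<le> n" for m n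
      using shift_lipschitz_bounds[OF \<Psi>(2) \<mu>] shift_lipschitz_bounds[OF \<Phi>(1) \<mu>]
      by (intro mult_mono \<Psi>(3) \<Phi>(2) \<mu> that) auto
    show "(\<lambda>n. \<Psi> n \<mu> * \<Phi> n \<mu>) \<longlonglongrightarrow> indicator (C \<inter> D) \<mu>"
      unfolding indicator_inter_arith by (intro tendsto_mult \<Psi>(4) \<Phi>(3) \<mu>)
  qed
qed

text \<open>The sign \<sigma> covers events on which an integral is above or below a level. The
  former generate the \<sigma>-algebra; the latter bound the number of points, as functionals in the
  cutoff and as events in the exhaustion.\<close>

lemma approximable_ramp_integral:
  fixes f :: "('d::finite) point \<Rightarrow> real"
  assumes f: "local_fun f" "0 \<le> K" "\<And>t t' s. \<bar>f (t, s) - f (t', s)\<bar> \<le> K * norm (t - t')"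
    and \<sigma>: "\<bar>\<sigma>\<bar> = 1"
  shows "shift_lipschitz (\<lambda>\<mu>. ramp n (\<sigma> * ((\<integral>x. f x \<partial>\<mu>) - c)))"
    and "approximable {\<mu> \<in> N11. 0 < \<sigma> * ((\<integral>x. f x \<partial>\<mu>) - c)}"
proof -
  show *: "shift_lipschitz (\<lambda>\<mu>. ramp n (\<sigma> * ((\<integral>x. f x \<partial>\<mu>) - c)))" for n
  proof (rule shift_lipschitz_integral[OF f, where \<phi>="\<lambda>y. ramp n (\<sigma> * (y - c))" and K'="real n"])
    show "continuous_on UNIV (\<lambda>y. ramp n (\<sigma> * (y - c)))"
      by (intro continuous_on_compose2[OF ramp_continuous] continuous_intros) auto
    fix x y
    have "\<bar>\<sigma> * (x - c) - \<sigma> * (y - c)\<bar> = \<bar>\<sigma>\<bar> * \<bar>x - y\<bar>"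
      by (simp flip: abs_mult add: algebra_simps)
    then show "\<bar>ramp n (\<sigma> * (x - c)) - ramp n (\<sigma> * (y - c))\<bar> \<le> real n * \<bar>x - y\<bar>"
      using ramp_lipschitz[of n "\<sigma> * (x - c)" "\<sigma> * (y - c)"] \<sigma> by simp
  qed (simp_all add: ramp_bounds)
  show "approximable {\<mu> \<in> N11. 0 < \<sigma> * ((\<integral>x. f x \<partial>\<mu>) - c)}"
    unfolding approximable_def
  proof (intro conjI exI[of _ "\<lambda>n \<mu>. ramp n (\<sigma> * ((\<integral>x. f x \<partial>\<mu>) - c))"] allI ballI impI * ramp_mono)
    fix \<mu> :: "'d point measure" assume "\<mu> \<in> N11"
    then have "indicator {\<mu> \<in> N11. 0 < \<sigma> * ((\<integral>x. f x \<partial>\<mu>) - c)} \<mu> =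
        (indicator {0<..} (\<sigma> * ((\<integral>x. f x \<partial>\<mu>) - c)) :: real)" by (simp add: indicator_def)
    then show "(\<lambda>n. ramp n (\<sigma> * ((\<integral>x. f x \<partial>\<mu>) - c))) \<longlonglongrightarrow> indicator {\<mu> \<in> N11. 0 < \<sigma> * ((\<integral>x. f x \<partial>\<mu>) - c)} \<mu>"
      using ramp_tendsto[of "\<sigma> * ((\<integral>x. f x \<partial>\<mu>) - c)"] by simp
  qed auto
qed

lemma approximable_sets: assumes "approximable C" shows "C \<in> sets N11_space"
proof -
  obtain \<Psi> where \<Psi>: "C \<subseteq> N11" "\<And>n. shift_lipschitz (\<Psi> n)"
    "\<And>\<mu>. \<mu> \<in> N11 \<Longrightarrow> (\<lambda>n. \<Psi> n \<mu>) \<longlonglongrightarrow> (indicator C \<mu> :: real)"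
    using assms unfolding approximable_def by blast
  have "(indicator C :: _ \<Rightarrow> real) \<in> borel_measurable N11_space"
    using \<Psi>(3) by (intro borel_measurable_LIMSEQ_real[OF _ shift_lipschitz_measurable[OF \<Psi>(2)]]) simp
  then have "C \<inter> space N11_space \<in> sets N11_space" by (simp add: borel_measurable_indicator_iff)
  then show ?thesis using \<Psi>(1) by (simp add: Int_absorb2)
qed

lemma bump_local_fun:
  fixes U :: "('d::finite) point set"
  assumes U: "U \<subseteq> window R \<epsilon>" "0 < \<epsilon>"
  shows "local_fun (bump n U)" and "\<bar>bump n U (t, s) - bump n U (t', s)\<bar> \<le> real n * norm (t - t')"
proof -
  show "local_fun (bump n U)"
    using U bump_support by (intro local_funI[OF bump_continuous bump_bounds U(2)]) blast
  show "\<bar>bump n U (t, s) - bump n U (t', s)\<bar> \<le> real n * norm (t - t')"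
    using bump_lipschitz[of n U "(t, s)" "(t', s)"] by (simp add: dist_Pair_Pair dist_norm)
qed

text \<open>Monotone convergence along the bumps. A set inside a window of positive level is not the
  whole vector space, so the bumps do increase to its indicator.\<close>

lemma bump_integral_SUP:
  fixes U :: "('d::finite) point set"
  assumes \<mu>: "\<mu> \<in> N11" and U: "open U" "U \<subseteq> window R \<epsilon>" "0 < \<epsilon>"
  shows "emeasure \<mu> U = (SUP n. ennreal (\<integral>x. bump n U x \<partial>\<mu>))"
proof -
  have lf: "local_fun (bump n U)" for n by (rule bump_local_fun(1)[OF U(2,3)])
  have "U \<noteq> UNIV"
  proof
    assume "U = UNIV"
    with U(2) have "(0 :: real ^ 'd, 0) \<in> window R \<epsilon>" by (simp add: top_unique)
    then show False using U(3) by (simp add: mem_window)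
  qed
  have "U \<in> sets \<mu>"
    using U window_EE[of \<epsilon> R] by (auto simp: N11_sets[OF \<mu>] sets_borel_EE)
  then have "emeasure \<mu> U = (\<integral>\<^sup>+x. ennreal (indicator U x) \<partial>\<mu>)"
    by (simp add: ennreal_indicator)
  moreover have lim1: "(\<lambda>n. \<integral>\<^sup>+x. ennreal (bump n U x) \<partial>\<mu>) \<longlonglongrightarrow> (\<integral>\<^sup>+x. ennreal (indicator U x) \<partial>\<mu>)"
  proof (rule nn_integral_LIMSEQ_on_space)
    show "ennreal (bump m U x) \<le> ennreal (bump n U x)" if "m \<le> n" for m n x
      by (intro ennreal_leI bump_mono that)
    show "(\<lambda>x. ennreal (bump n U x)) \<in> borel_measurable \<mu>" for n
      by (rule measurable_compose[OF measurable_N11[OF \<mu> local_fun_measurable[OF lf]] measurable_ennreal])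
    show "(\<lambda>n. ennreal (bump n U x)) \<longlonglongrightarrow> ennreal (indicator U x)" for x
      by (rule tendsto_ennrealI[OF bump_tendsto[OF U(1) \<open>U \<noteq> UNIV\<close>]])
  qed
  moreover have lim2: "(\<lambda>n. \<integral>\<^sup>+x. ennreal (bump n U x) \<partial>\<mu>) \<longlonglongrightarrow> (SUP n. \<integral>\<^sup>+x. ennreal (bump n U x) \<partial>\<mu>)"
    by (rule LIMSEQ_SUP) (intro incseq_SucI nn_integral_mono ennreal_leI bump_mono, simp)
  ultimately have "emeasure \<mu> U = (SUP n. \<integral>\<^sup>+x. ennreal (bump n U x) \<partial>\<mu>)"
    using LIMSEQ_unique[OF lim1 lim2] by simp
  then show ?thesis by (simp only: local_fun_nn_integral[OF \<mu> lf])
qed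

text \<open>The mass of an open set inside a window is a supremum of integrals of bumps, hence
  measurable for the generated \<sigma>-algebra. The open subsets of \<open>EE\<close> are stable
  under intersection and generate, so the Dynkin argument inside each window and the exhaustion by
  windows reach all Borel sets.\<close>

lemma sets_N11_space_approximable: "sets N11_space = sigma_sets N11 {C :: ('d::finite) point measure set. approximable C}"
proof
  let ?E = "{C :: 'd point measure set. approximable C}" and ?S = "sigma N11 {C :: 'd point measure set. approximable C}"
  have E: "?E \<subseteq> Pow N11" by (auto simp: approximable_def)
  show "sigma_sets N11 ?E \<subseteq> sets N11_space"
    using approximable_sets sets.sigma_sets_subset[of ?E N11_space] by auto
  have S: "space ?S = N11" "sets ?S = sigma_sets N11 ?E" using E by simp_all
  have window: "(\<lambda>\<mu>. emeasure \<mu> U) \<in> borel_measurable ?S"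
    if U: "open U" "U \<subseteq> window R \<epsilon>" "0 < \<epsilon>" for U :: "'d point set" and R \<epsilon>
  proof (rule borel_measurableI_greater)
    fix y :: ennreal
    \<comment> \<open>A supremum exceeds y exactly if one of its terms does, which exhibits the
      event as a countable union of approximable ones.\<close>
    have eq: "{\<mu> \<in> space ?S. y < emeasure \<mu> U} = (\<Union>n. {\<mu> \<in> N11. y < ennreal (\<integral>x. bump n U x \<partial>\<mu>)})"
      using bump_integral_SUP[OF _ U] by (auto simp: S(1) less_SUP_iff)
    show "{\<mu> \<in> space ?S. y < emeasure \<mu> U} \<in> sets ?S"
    proof (cases y)
      case (real c)
      have "{\<mu> \<in> N11. y < ennreal (\<integral>x. bump n U x \<partial>\<mu>)} \<in> ?E" for n
        using approximable_ramp_integral(2)[OF bump_local_fun(1)[OF U(2,3), of n]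
            of_nat_0_le_iff bump_local_fun(2)[OF U(2,3)], where \<sigma>=1 and c=c] real
        by (simp add: ennreal_less_iff)
      then show ?thesis unfolding eq S(2) by (intro sigma_sets.Union sigma_sets.Basic)
    next
      case top
      then show ?thesis by simp
    qed
  qed
  have EE_sigma: "sets (borel_EE :: 'd point measure) = sigma_sets EE {U. open U \<and> U \<subseteq> EE}"
  proof -
    have "sets (borel_EE :: 'd point measure) = (\<inter>) EE ` sigma_sets UNIV {U. open U}"
      by (simp add: borel_EE_def sets_restrict_space borel_def)
    also have "\<dots> = sigma_sets EE ((\<inter>) EE ` {U. open U})"
      by (intro sigma_sets_Int sigma_sets.Basic) (auto simp: EE_open)
    also have "(\<inter>) EE ` {U. open U} = {U :: 'd point set. open U \<and> U \<subseteq> EE}"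
      using EE_open by (auto intro!: image_eqI)
    finally show ?thesis .
  qed
  have "(\<lambda>\<mu>. emeasure \<mu> B) \<in> borel_measurable ?S" if B: "B \<in> sets borel_EE" for B :: "'d point set"
  proof -
    have N: "\<mu> \<in> N11" if "\<mu> \<in> space ?S" for \<mu> using that S(1) by simp
    have n: "(\<lambda>\<mu>. emeasure \<mu> (B \<inter> windows n)) \<in> borel_measurable ?S" for n
    proof -
      have op: "(\<lambda>\<mu>. emeasure (density \<mu> (indicator (windows n))) U) \<in> borel_measurable ?S"
        if U: "open U" "U \<subseteq> EE" for U :: "'d point set"
      proof -
        have "(\<lambda>\<mu>. emeasure \<mu> (U \<inter> windows n)) \<in> borel_measurable ?S"
          using U windows_open by (intro window[of _ "real (Suc n)" "1 / real (Suc n)"]) (auto simp: windows_def)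
        moreover have "emeasure (density \<mu> (indicator (windows n))) U = emeasure \<mu> (U \<inter> windows n)"
          if "\<mu> \<in> space ?S" for \<mu>
          using U by (intro N11_density_windows N[OF that]) (simp add: sets_borel_EE)
        ultimately show ?thesis by (simp cong: measurable_cong)
      qed
      have "(\<lambda>\<mu>. emeasure (density \<mu> (indicator (windows n))) B) \<in> borel_measurable ?S"
      proof (rule measurable_emeasure_generated[where G="{U. open U \<and> U \<subseteq> EE}" and \<Omega>=EE])
        show "finite_measure (density \<mu> (indicator (windows n)))" if "\<mu> \<in> space ?S" for \<mu>
          by (rule N11_density_windows(1)[OF N[OF that]])
        show "sets (density \<mu> (indicator (windows n))) = sigma_sets EE {U. open U \<and> U \<subseteq> EE}" if "\<mu> \<in> space ?S" for \<mu>
          using N11_sets[OF N[OF that]] EE_sigma by simp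
        show "Int_stable {U :: 'd point set. open U \<and> U \<subseteq> EE}" by (auto simp: Int_stable_def)
        show "(\<lambda>\<mu>. emeasure (density \<mu> (indicator (windows n))) EE) \<in> borel_measurable ?S"
          by (intro op EE_open) simp
        show "B \<in> sigma_sets EE {U. open U \<and> U \<subseteq> EE}" using B EE_sigma by simp
      qed (use op in auto)
      moreover have "emeasure (density \<mu> (indicator (windows n))) B = emeasure \<mu> (B \<inter> windows n)"
        if "\<mu> \<in> space ?S" for \<mu> by (intro N11_density_windows N[OF that] B)
      ultimately show ?thesis by (simp cong: measurable_cong)
    qed
    have "emeasure \<mu> B = (SUP n. emeasure \<mu> (B \<inter> windows n))" if "\<mu> \<in> space ?S" for \<mu>
      by (rule N11_windows_SUP[OF N[OF that] B])
    then show ?thesis using n by (subst measurable_cong) auto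
  qed
  then have "(\<lambda>\<mu>. \<mu>) \<in> ?S \<rightarrow>\<^sub>M N11_space" by (intro measurable_N11_spaceI) (simp_all add: S)
  show "sets N11_space \<subseteq> sigma_sets N11 ?E"
  proof
    fix A assume A: "A \<in> sets (N11_space :: 'd point measure measure)"
    from measurable_sets[OF \<open>(\<lambda>\<mu>. \<mu>) \<in> ?S \<rightarrow>\<^sub>M N11_space\<close> A] sets.sets_into_space[OF A]
    show "A \<in> sigma_sets N11 ?E" by (simp add: S vimage_def Int_absorb2)
  qed
qed

section \<open>The tail configuration\<close>

lemma mass_shift:
  assumes \<mu>: "\<mu> \<in> N11" and \<epsilon>: "0 < \<epsilon>"
  shows "mass R \<epsilon> \<mu> \<le> mass (R + norm z) \<epsilon> (shift_pts z \<mu>)"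
proof -
  let ?W = "window (R + norm z) \<epsilon>"
  have W: "?W \<in> sets (borel_EE :: 'a point measure)" "window R \<epsilon> \<in> sets (borel_EE :: 'a point measure)" using \<epsilon> by (simp_all add: window_sets)
  have "emeasure \<mu> (window R \<epsilon>) = (\<integral>\<^sup>+x. indicator (window R \<epsilon>) x \<partial>\<mu>)"
    using W(2) by (simp add: N11_sets[OF \<mu>])
  also have "\<dots> \<le> (\<integral>\<^sup>+x. indicator ?W (fst x - z, snd x) \<partial>\<mu>)"
  proof (rule nn_integral_mono)
    fix x :: "'a point"
    have "norm (fst x - z) < R + norm z" if "norm (fst x) < R"
      using norm_triangle_ineq4[of "fst x" z] that by linarith
    then show "(indicator (window R \<epsilon>) x :: ennreal) \<le> indicator ?W (fst x - z, snd x)"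
      by (cases x) (auto simp: indicator_def mem_window)
  qed
  also have "\<dots> = (\<integral>\<^sup>+x. indicator ?W x \<partial>shift_pts z \<mu>)"
    using W(1) by (intro nn_integral_shift[OF \<mu>, symmetric]) simp
  also have "\<dots> = emeasure (shift_pts z \<mu>) ?W"
    using W(1) by (simp add: N11_sets[OF shift_N11[OF \<mu>]])
  finally show ?thesis
    unfolding mass_def measure_def using N11_window_finite[OF shift_N11[OF \<mu>] \<epsilon>, of z]
    by (intro enn2real_mono) simp_all
qed

section \<open>Image measures of the weighted Campbell measure\<close>

definition exceed :: "real \<Rightarrow> ennreal" where
  "exceed = indicator {1<..}"

lemma exceed_measurable [measurable]: "exceed \<in> borel_measurable borel"
  unfolding exceed_def by simp

text \<open>For nonnegative h, each side of the theorem is the integral of h against such a measure,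
  so the theorem is an equality of two measures on positions and configurations. The weight
  \<open>mark exceed 0\<close> is 1 almost surely under an anchored law; it is kept so that the
  weight is a monotone limit of the soft weights.\<close>

definition transport ::
  "(('d::finite) point measure \<times> 'd point \<Rightarrow> (real ^ 'd) \<times> 'd point measure) \<Rightarrow>
   'd point measure measure \<Rightarrow> ((real ^ 'd) \<times> 'd point measure) measure" where
  "transport \<tau> \<nu> = distr (density (campbell \<nu>) (\<lambda>p. mark exceed 0 (fst p) * exceed (snd (snd p))))
     (borel \<Otimes>\<^sub>M N11_space) \<tau>"

lemma exceed_weight_measurable:
  "(\<lambda>p. mark exceed 0 (fst p) * exceed (snd (snd p))) \<in> borel_measurable (N11_space \<Otimes>\<^sub>M borel_EE)"
  by (intro borel_measurable_times_ennreal measurable_compose[OF measurable_fst mark_measurable]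
      measurable_compose[OF measurable_snd measurable_compose[OF snd_measurable_EE exceed_measurable]]
      exceed_measurable)

lemma nn_integral_transport:
  assumes \<tau>: "\<tau> \<in> N11_space \<Otimes>\<^sub>M borel_EE \<rightarrow>\<^sub>M borel \<Otimes>\<^sub>M N11_space"
    and f: "f \<in> borel_measurable (borel \<Otimes>\<^sub>M N11_space)"
  shows "(\<integral>\<^sup>+q. f q \<partial>transport \<tau> \<nu>) =
    (\<integral>\<^sup>+p. mark exceed 0 (fst p) * exceed (snd (snd p)) * f (\<tau> p) \<partial>campbell \<nu>)"
proof -
  have "\<tau> \<in> density (campbell \<nu>) (\<lambda>p. mark exceed 0 (fst p) * exceed (snd (snd p))) \<rightarrow>\<^sub>M borel \<Otimes>\<^sub>M N11_space"
    using \<tau> by (simp cong: measurable_cong_sets)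
  then have "(\<integral>\<^sup>+q. f q \<partial>transport \<tau> \<nu>) =
      (\<integral>\<^sup>+p. f (\<tau> p) \<partial>density (campbell \<nu>) (\<lambda>p. mark exceed 0 (fst p) * exceed (snd (snd p))))"
    unfolding transport_def using f by (intro nn_integral_distr) simp_all
  also have "\<dots> = (\<integral>\<^sup>+p. mark exceed 0 (fst p) * exceed (snd (snd p)) * f (\<tau> p) \<partial>campbell \<nu>)"
    using exceed_weight_measurable measurable_compose[OF \<tau> f]
    by (intro nn_integral_density) (simp_all cong: measurable_cong_sets)
  finally show ?thesis .
qed

text \<open>\<open>stay\<close> yields the argument of h on the left-hand side of the theorem, and
  \<open>move\<close> the one on the right, seen from the other point.\<close>

abbreviation "stay \<equiv> \<lambda>p :: ('d::finite) point measure \<times> 'd point. (fst (snd p), fst p)"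
abbreviation "move \<equiv> \<lambda>p :: ('d::finite) point measure \<times> 'd point. (- fst (snd p), shift_pts (fst (snd p)) (fst p))"

lemma stay_measurable: "stay \<in> N11_space \<Otimes>\<^sub>M borel_EE \<rightarrow>\<^sub>M borel \<Otimes>\<^sub>M N11_space"
  by (intro measurable_Pair measurable_compose[OF measurable_snd fst_measurable_EE]) simp

lemma move_measurable: "move \<in> N11_space \<Otimes>\<^sub>M borel_EE \<rightarrow>\<^sub>M borel \<Otimes>\<^sub>M N11_space"
  by (intro measurable_Pair shift_measurable borel_measurable_uminus measurable_compose[OF measurable_snd fst_measurable_EE]) simp_all

section \<open>Continuous approximation of the exceedance weights\<close>

definition soft_exceed :: "nat \<Rightarrow> real \<Rightarrow> real" where
  "soft_exceed n s = ramp n (s - 1)"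

lemma soft_exceed:
  "continuous_on UNIV (soft_exceed n)" "0 \<le> soft_exceed n s" "soft_exceed n s \<le> 1"
  "soft_exceed n s \<noteq> 0 \<Longrightarrow> 1 < s"
  unfolding soft_exceed_def using ramp_bounds ramp_pos[of n "s - 1"]
  by (auto intro!: continuous_on_compose2[OF ramp_continuous] continuous_intros)

lemma soft_exceed_mono: "m \<le> n \<Longrightarrow> soft_exceed m s \<le> soft_exceed n s"
  by (simp add: soft_exceed_def ramp_mono)

lemma soft_exceed_tendsto: "(\<lambda>n. soft_exceed n s) \<longlonglongrightarrow> indicator {1<..} s"
proof -
  have "indicator {0<..} (s - 1) = (indicator {1<..} s :: real)" by (simp add: indicator_def)
  then show ?thesis using ramp_tendsto[of "s - 1"] by (simp add: soft_exceed_def)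
qed

definition soft_mark :: "nat \<Rightarrow> ('d::finite) point measure \<Rightarrow> real" where
  "soft_mark n \<mu> = enn2real (mark (\<lambda>s. ennreal (soft_exceed n s)) 0 \<mu>)"

lemma soft_exceed_measurable: "(\<lambda>s. ennreal (soft_exceed n s)) \<in> borel_measurable borel"
  using borel_measurable_continuous_onI[OF soft_exceed(1)] by simp

lemma soft_mark_nonneg: "0 \<le> soft_mark n \<mu>"
  by (simp add: soft_mark_def)

lemma ennreal_soft_mark: "\<mu> \<in> N11 \<Longrightarrow> ennreal (soft_mark n \<mu>) = mark (\<lambda>s. ennreal (soft_exceed n s)) 0 \<mu>"
  unfolding soft_mark_def by (rule mark_ennreal_finite[OF _ soft_exceed(1,3)])

lemma soft_mark_limit:
  assumes \<mu>: "\<mu> \<in> N11"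
  obtains v where "\<And>m n. m \<le> n \<Longrightarrow> soft_mark m \<mu> \<le> soft_mark n \<mu>" "(\<lambda>n. soft_mark n \<mu>) \<longlonglongrightarrow> v"
    "mark exceed 0 \<mu> = ennreal v" "0 \<le> v"
proof (cases "\<exists>s. (0, s) \<in> atoms \<mu>")
  case True
  then obtain s where s: "(0, s) \<in> atoms \<mu>" by blast
  have "soft_mark n \<mu> = soft_exceed n s" for n
    unfolding soft_mark_def mark_atom[OF \<mu> s soft_exceed_measurable] using soft_exceed(2) by simp
  moreover have "mark exceed 0 \<mu> = ennreal (indicator {1<..} s)"
    using mark_atom[OF \<mu> s exceed_measurable] by (simp add: exceed_def ennreal_indicator)
  ultimately show ?thesis
    using that[of "indicator {1<..} s"] soft_exceed_mono soft_exceed_tendsto[of s] by simp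
next
  case False
  then have "mark b 0 \<mu> = 0" for b using mark_eq_0[OF \<mu>, of 0 b] by blast
  then show ?thesis using that[of 0] by (simp add: soft_mark_def)
qed

text \<open>Both score weights, the position set and the configuration event are approximated from
  below with one common index, together with a cutoff that fades as the index grows. For each index
  the limit identity holds; since every factor is nonnegative and increasing, both sides converge
  monotonically to the measures of the rectangle.\<close>

lemma transport_eq_rectangle:
  fixes \<nu> :: "('d::finite) point measure measure"
  assumes W: "weakly_converges vague_topology \<nu>s \<nu> F" and F: "F \<noteq> bot"
    and anch: "eventually (\<lambda>i. anchored (\<nu>s i)) F" "anchored \<nu>"
    and ex: "\<And>b. b \<in> borel_measurable borel \<Longrightarrow> (\<And>s. s \<le> 1 \<Longrightarrow> b s = 0) \<Longrightarrow> eventually (\<lambda>i. exchange b (\<nu>s i)) F"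
    and G: "open G" "G \<subseteq> ball 0 R" and C: "approximable C"
  shows "(\<integral>\<^sup>+q. indicator (G \<times> C) q \<partial>transport stay \<nu>) = (\<integral>\<^sup>+q. indicator (G \<times> C) q \<partial>transport move \<nu>)"
proof -
  have \<nu>: "sets \<nu> = sets N11_space" using anch(2) by (simp add: anchored_def)
  obtain \<Psi> where \<Psi>: "\<And>n. shift_lipschitz (\<Psi> n)" "\<And>\<mu> m n. \<mu> \<in> N11 \<Longrightarrow> m \<le> n \<Longrightarrow> \<Psi> m \<mu> \<le> \<Psi> n \<mu>"
    "\<And>\<mu>. \<mu> \<in> N11 \<Longrightarrow> (\<lambda>n. \<Psi> n \<mu>) \<longlonglongrightarrow> (indicator C \<mu> :: real)"
    using C unfolding approximable_def by blast
  \<comment> \<open>Radius 2 R because the cutoff is applied after shifts of norm up to R and must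
    still see all points of the original window of radius R.\<close>
  obtain g :: "'d point \<Rightarrow> real" where g: "local_fun g" "\<And>\<mu>. \<mu> \<in> N11 \<Longrightarrow> mass (2 * R) 1 \<mu> \<le> (\<integral>x. g x \<partial>\<mu>)"
    "\<And>t t' s. \<bar>g (t, s) - g (t', s)\<bar> \<le> 1 * norm (t - t')"
    using plateau[of 1 "2 * R"] by (metis mult_1 zero_less_one)
  \<comment> \<open>Zero once the majorant g integrates to at least n, and 1 once it integrates to
    at most n - 1, so the cutoff is increasing in n and is eventually 1 for every
    configuration.\<close>
  define cut where "cut n \<mu> = ramp 1 (- 1 * ((\<integral>x. g x \<partial>\<mu>) - real n))" for n and \<mu> :: "'d point measure"
  have cut_lip: "shift_lipschitz (cut n)" for n
    unfolding cut_def by (rule approximable_ramp_integral(1)[OF g(1) _ g(3)]) simp_all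
  have cut_mono: "cut m \<mu> \<le> cut n \<mu>" if "m \<le> n" for m n \<mu>
    using that unfolding cut_def ramp_def by simp
  have cut_lim: "(\<lambda>n. cut n \<mu>) \<longlonglongrightarrow> 1" for \<mu>
  proof -
    obtain N where N: "(\<integral>x. g x \<partial>\<mu>) + 1 < real N" using reals_Archimedean2 by blast
    have "cut n \<mu> = 1" if "N \<le> n" for n using N that by (simp add: cut_def ramp_def)
    then have "eventually (\<lambda>n. cut n \<mu> = 1) sequentially" by (auto simp: eventually_sequentially)
    then show ?thesis by (rule tendsto_eventually)
  qed
  define \<Phi> where "\<Phi> n \<mu> = \<Psi> n \<mu> * cut n \<mu>" for n and \<mu> :: "'d point measure"
  have \<Phi>_lip: "shift_lipschitz (\<Phi> n)" for n
    unfolding \<Phi>_def by (intro shift_lipschitz_mult \<Psi> cut_lip)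
  have \<Phi>_nonneg: "0 \<le> \<Phi> n \<mu>" if "\<mu> \<in> N11" for n \<mu> using shift_lipschitz_bounds[OF \<Phi>_lip that] by simp
  have \<Phi>_mono: "\<Phi> m \<mu> \<le> \<Phi> n \<mu>" if "m \<le> n" "\<mu> \<in> N11" for m n \<mu>
    unfolding \<Phi>_def using shift_lipschitz_bounds[OF \<Psi>(1) that(2)] shift_lipschitz_bounds[OF cut_lip that(2)]
    by (intro mult_mono \<Psi>(2) cut_mono that) auto
  have \<Phi>_lim: "(\<lambda>n. \<Phi> n \<mu>) \<longlonglongrightarrow> indicator C \<mu>" if "\<mu> \<in> N11" for \<mu>
    using tendsto_mult[OF \<Psi>(3)[OF that] cut_lim[of \<mu>]] by (simp add: \<Phi>_def)
  have \<Phi>_cut: "\<Phi> n (shift_pts z \<mu>) = 0" if \<mu>: "\<mu> \<in> N11" and z: "norm z \<le> R" and m: "real n < mass R 1 \<mu>" for n z \<mu>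
  proof -
    have "mass R 1 \<mu> \<le> mass (R + norm z) 1 (shift_pts z \<mu>)" by (rule mass_shift[OF \<mu>]) simp
    also have "\<dots> \<le> mass (2 * R) 1 (shift_pts z \<mu>)" using z by (intro mass_mono shift_N11 \<mu>) auto
    also have "\<dots> \<le> (\<integral>x. g x \<partial>shift_pts z \<mu>)" by (rule g(2)[OF shift_N11[OF \<mu>]])
    finally have "cut n (shift_pts z \<mu>) = 0" using m by (simp add: cut_def ramp_def)
    then show ?thesis by (simp add: \<Phi>_def)
  qed
  have "G \<noteq> UNIV" using G(2) bounded_subset[OF bounded_ball[of "0 :: real ^ 'd" R]] not_bounded_UNIV by blast
  have G_supp: "norm t < R" if "bump n G t \<noteq> 0" for n t
    using bump_support[OF that] G(2) by auto
  \<comment> \<open>Written for an arbitrary \<tau> so that convergence and the passage to a double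
    integral are proved once and used for both \<open>stay\<close> and \<open>move\<close>.\<close>
  define J where "J \<tau> n p = ennreal (soft_mark n (fst p) * (soft_exceed n (snd (snd p)) *
      (bump n G (fst (\<tau> p)) * \<Phi> n (snd (\<tau> p)))))"
    for \<tau> :: "'d point measure \<times> 'd point \<Rightarrow> (real ^ 'd) \<times> 'd point measure" and n p
  have J_meas: "J \<tau> n \<in> borel_measurable (N11_space \<Otimes>\<^sub>M borel_EE)"
    if \<tau>: "\<tau> \<in> N11_space \<Otimes>\<^sub>M borel_EE \<rightarrow>\<^sub>M borel \<Otimes>\<^sub>M N11_space" for \<tau> n
    unfolding J_def soft_mark_def
    by (intro measurable_compose[OF _ measurable_ennreal] borel_measurable_times borel_measurable_enn2real
        measurable_compose[OF measurable_fst mark_measurable[OF soft_exceed_measurable]]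
        measurable_compose[OF measurable_snd measurable_compose[OF snd_measurable_EE borel_measurable_continuous_onI[OF soft_exceed(1)]]]
        measurable_compose[OF measurable_compose[OF \<tau> measurable_fst] borel_measurable_continuous_onI[OF bump_continuous]]
        measurable_compose[OF measurable_compose[OF \<tau> measurable_snd] shift_lipschitz_measurable[OF \<Phi>_lip]])
  have J_lim: "(\<lambda>n. \<integral>\<^sup>+p. J \<tau> n p \<partial>campbell \<nu>) \<longlonglongrightarrow> (\<integral>\<^sup>+q. indicator (G \<times> C) q \<partial>transport \<tau> \<nu>)"
    if \<tau>: "\<tau> \<in> N11_space \<Otimes>\<^sub>M borel_EE \<rightarrow>\<^sub>M borel \<Otimes>\<^sub>M N11_space" for \<tau>
  proof -
    have \<tau>N: "snd (\<tau> p) \<in> N11" if "p \<in> space (campbell \<nu>)" for p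
      using measurable_space[OF \<tau>, of p] that by (auto simp: space_pair_measure mem_Times_iff)
    have GC: "(indicator (G \<times> C) :: _ \<Rightarrow> ennreal) \<in> borel_measurable (borel \<Otimes>\<^sub>M N11_space)"
      using G(1) approximable_sets[OF C] by (intro borel_measurable_indicator pair_measureI) auto
    have "(\<lambda>n. \<integral>\<^sup>+p. J \<tau> n p \<partial>campbell \<nu>) \<longlonglongrightarrow>
        (\<integral>\<^sup>+p. mark exceed 0 (fst p) * exceed (snd (snd p)) * indicator (G \<times> C) (\<tau> p) \<partial>campbell \<nu>)"
    proof (rule nn_integral_LIMSEQ_on_space)
      show "J \<tau> n \<in> borel_measurable (campbell \<nu>)" for n
        using J_meas[OF \<tau>, of n] by (simp cong: measurable_cong_sets)
    next
      fix p assume p: "p \<in> space (campbell \<nu>)"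
      then have \<mu>: "fst p \<in> N11" by auto
      from soft_mark_limit[OF \<mu>] obtain v where v: "\<And>m n. m \<le> n \<Longrightarrow> soft_mark m (fst p) \<le> soft_mark n (fst p)"
        "(\<lambda>n. soft_mark n (fst p)) \<longlonglongrightarrow> v" "mark exceed 0 (fst p) = ennreal v" "0 \<le> v" by blast
      show "J \<tau> m p \<le> J \<tau> n p" if "m \<le> n" for m n
        unfolding J_def using that v(1) soft_mark_nonneg soft_exceed(2) bump_bounds(1) \<Phi>_nonneg[OF \<tau>N[OF p]]
        by (intro ennreal_leI mult_mono soft_exceed_mono bump_mono \<Phi>_mono \<tau>N[OF p] mult_nonneg_nonneg) auto
      have "(\<lambda>n. J \<tau> n p) \<longlonglongrightarrow>
          ennreal (v * (indicator {1<..} (snd (snd p)) * (indicator G (fst (\<tau> p)) * indicator C (snd (\<tau> p)))))"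
        unfolding J_def by (intro tendsto_ennrealI tendsto_mult v(2) soft_exceed_tendsto bump_tendsto G(1)
            \<open>G \<noteq> UNIV\<close> \<Phi>_lim \<tau>N[OF p])
      also have "ennreal (v * (indicator {1<..} (snd (snd p)) * (indicator G (fst (\<tau> p)) * indicator C (snd (\<tau> p))))) =
          mark exceed 0 (fst p) * exceed (snd (snd p)) * indicator (G \<times> C) (\<tau> p)"
        unfolding v(3) unfolding exceed_def by (cases "\<tau> p") (auto simp: indicator_def)
      finally show "(\<lambda>n. J \<tau> n p) \<longlonglongrightarrow> mark exceed 0 (fst p) * exceed (snd (snd p)) * indicator (G \<times> C) (\<tau> p)" .
    qed
    then show ?thesis by (simp only: nn_integral_transport[OF \<tau> GC])
  qed
  have J_sum: "(\<integral>\<^sup>+p. J \<tau> n p \<partial>campbell \<nu>) = (\<integral>\<^sup>+\<mu>. mark (\<lambda>s. ennreal (soft_exceed n s)) 0 \<mu> *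
      (\<integral>\<^sup>+x. ennreal (soft_exceed n (snd x)) * ennreal (bump n G (fst (\<tau> (\<mu>, x))) * \<Phi> n (snd (\<tau> (\<mu>, x)))) \<partial>\<mu>) \<partial>\<nu>)"
    if \<tau>: "\<tau> \<in> N11_space \<Otimes>\<^sub>M borel_EE \<rightarrow>\<^sub>M borel \<Otimes>\<^sub>M N11_space" for \<tau> n
    unfolding nn_integral_campbell[OF \<nu> J_meas[OF \<tau>]]
  proof (rule nn_integral_cong)
    fix \<mu> assume "\<mu> \<in> space \<nu>"
    then have \<mu>: "\<mu> \<in> N11" by (simp add: anchored_space[OF anch(2)])
    let ?h = "\<lambda>p. ennreal (soft_exceed n (snd (snd p))) * ennreal (bump n G (fst (\<tau> p)) * \<Phi> n (snd (\<tau> p)))"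
    have h: "?h \<in> borel_measurable (N11_space \<Otimes>\<^sub>M borel_EE)"
      by (intro borel_measurable_times_ennreal measurable_compose[OF _ measurable_ennreal] borel_measurable_times
          measurable_compose[OF measurable_snd measurable_compose[OF snd_measurable_EE borel_measurable_continuous_onI[OF soft_exceed(1)]]]
          measurable_compose[OF measurable_compose[OF \<tau> measurable_fst] borel_measurable_continuous_onI[OF bump_continuous]]
          measurable_compose[OF measurable_compose[OF \<tau> measurable_snd] shift_lipschitz_measurable[OF \<Phi>_lip]])
    have "J \<tau> n (\<mu>, x) = mark (\<lambda>s. ennreal (soft_exceed n s)) 0 \<mu> * ?h (\<mu>, x)" for x
      by (simp only: J_def fst_conv snd_conv ennreal_mult'[OF soft_mark_nonneg] ennreal_mult'[OF soft_exceed(2)]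
          ennreal_soft_mark[OF \<mu>])
    then show "(\<integral>\<^sup>+x. J \<tau> n (\<mu>, x) \<partial>\<mu>) = mark (\<lambda>s. ennreal (soft_exceed n s)) 0 \<mu> *
        (\<integral>\<^sup>+x. ennreal (soft_exceed n (snd x)) * ennreal (bump n G (fst (\<tau> (\<mu>, x))) * \<Phi> n (snd (\<tau> (\<mu>, x)))) \<partial>\<mu>)"
      using nn_integral_cmult[OF N11_section_measurable[OF h \<mu>]] by simp
  qed
  have "(\<integral>\<^sup>+p. J stay n p \<partial>campbell \<nu>) = (\<integral>\<^sup>+p. J move n p \<partial>campbell \<nu>)" for n
  proof -
    have "eventually (\<lambda>i. exchange (\<lambda>s. ennreal (soft_exceed n s)) (\<nu>s i)) F"
    proof (rule ex[OF soft_exceed_measurable])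
      fix s :: real assume "s \<le> 1"
      then show "ennreal (soft_exceed n s) = 0" using soft_exceed(4)[of n s] by force
    qed
    from limit_exchange[OF W F anch this bump_continuous bump_bounds G_supp soft_exceed \<Phi>_lip \<Phi>_cut]
    show ?thesis by (simp add: J_sum[OF stay_measurable] J_sum[OF move_measurable])
  qed
  then show ?thesis
    using LIMSEQ_unique[OF J_lim[OF stay_measurable]] J_lim[OF move_measurable] by simp
qed

section \<open>Uniqueness of measures from rectangles\<close>

lemma sets_pair_N11_rectangles:
  "sets (borel \<Otimes>\<^sub>M (N11_space :: ('d::finite) point measure measure)) =
    sigma_sets (UNIV \<times> N11) {G \<times> C | G C. G \<in> {G :: (real ^ 'd) set. open G \<and> bounded G} \<and> C \<in> Collect approximable}"
proof -
  let ?B = "{G :: (real ^ 'd) set. open G \<and> bounded G}"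
  have borel: "sets (borel :: (real ^ 'd) measure) = sigma_sets (space borel) ?B"
  proof -
    have "U \<in> sigma_sets UNIV ?B" if "open U" for U :: "(real ^ 'd) set"
    proof -
      \<comment> \<open>Bounded open sets suffice as generators, since they exhaust every open set;
        boundedness places the position set in a ball, as the identity on rectangles
        demands.\<close>
      have "U = (\<Union>n::nat. U \<inter> ball 0 (real n))"
      proof (intro equalityI subsetI)
        fix x assume "x \<in> U"
        moreover obtain n where "norm x < real n" using reals_Archimedean2 by blast
        ultimately show "x \<in> (\<Union>n::nat. U \<inter> ball 0 (real n))" by auto
      qed auto
      moreover have "U \<inter> ball 0 (real n) \<in> ?B" for n
        using that bounded_subset[OF bounded_ball, of "U \<inter> ball 0 (real n)" 0 "real n"] by auto
      ultimately show ?thesis by (metis (no_types, lifting) sigma_sets.Basic sigma_sets.Union)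
    qed
    then have "sigma_sets UNIV {U :: (real ^ 'd) set. open U} \<subseteq> sigma_sets UNIV ?B"
      by (intro sigma_sets_mono) auto
    moreover have "sigma_sets UNIV ?B \<subseteq> sigma_sets UNIV {U :: (real ^ 'd) set. open U}"
      by (intro sigma_sets_mono) (auto intro: sigma_sets.Basic)
    ultimately show ?thesis by (simp add: borel_def)
  qed
  have whole: "approximable (N11 :: 'd point measure set)"
  proof -
    have "local_fun (\<lambda>x :: 'd point. 0 :: real)" by (intro local_funI[of _ 0 1]) auto
    from approximable_ramp_integral(2)[OF this, of 0 1 "- 1"] show ?thesis by simp
  qed
  have "sets (borel \<Otimes>\<^sub>M (N11_space :: 'd point measure measure)) =
      sets (sigma (space borel \<times> space N11_space) {G \<times> C | G C. G \<in> ?B \<and> C \<in> Collect approximable})"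
  proof (rule sets_pair_eq[OF _ borel _ _ _ _ _ _ _ _])
    show "countable (range (\<lambda>n::nat. ball 0 (real n) :: (real ^ 'd) set))" by simp
    show "range (\<lambda>n::nat. ball 0 (real n) :: (real ^ 'd) set) \<subseteq> ?B" by auto
    have "\<exists>n::nat. norm x < real n" for x :: "real ^ 'd" by (rule reals_Archimedean2)
    then show "\<Union> (range (\<lambda>n::nat. ball 0 (real n) :: (real ^ 'd) set)) = space borel" by auto
    show "sets (N11_space :: 'd point measure measure) = sigma_sets (space N11_space) (Collect approximable)"
      using sets_N11_space_approximable by simp
    show "countable {N11 :: 'd point measure set}" by simp
    show "{N11 :: 'd point measure set} \<subseteq> Collect approximable" using whole by simp
  qed (auto simp: approximable_def)
  also have "\<dots> = sigma_sets (UNIV \<times> N11) {G \<times> C | G C. G \<in> ?B \<and> C \<in> Collect approximable}"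
    by (simp, intro sets_measure_of) (auto simp: approximable_def)
  finally show ?thesis .
qed

text \<open>The inner sum is at most the number of points in the window, since both exceedance
  weights are at most 1. On C this number is bounded by N, and the law has mass 1.\<close>

lemma transport_stay_finite:
  fixes \<nu> :: "('d::finite) point measure measure"
  assumes \<nu>: "anchored \<nu>" and C: "approximable C" and bound: "\<And>\<mu>. \<mu> \<in> C \<Longrightarrow> mass R 1 \<mu> \<le> N"
  shows "(\<integral>\<^sup>+q. indicator (ball 0 R \<times> C) q \<partial>transport stay \<nu>) < \<infinity>"
proof -
  interpret prob_space \<nu> using \<nu> by (simp add: anchored_def)
  have s: "sets \<nu> = sets N11_space" using \<nu> by (simp add: anchored_def)
  have RC: "(indicator (ball 0 R \<times> C) :: _ \<Rightarrow> ennreal) \<in> borel_measurable (borel \<Otimes>\<^sub>M N11_space)"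
    using approximable_sets[OF C] by (intro borel_measurable_indicator pair_measureI) auto
  have "(\<integral>\<^sup>+q. indicator (ball 0 R \<times> C) q \<partial>transport stay \<nu>) =
      (\<integral>\<^sup>+\<mu>. \<integral>\<^sup>+x. mark exceed 0 \<mu> * exceed (snd x) * indicator (ball 0 R \<times> C) (fst x, \<mu>) \<partial>\<mu> \<partial>\<nu>)"
    unfolding nn_integral_transport[OF stay_measurable RC]
    by (subst nn_integral_campbell[OF s])
      (simp_all add: borel_measurable_times_ennreal[OF exceed_weight_measurable measurable_compose[OF stay_measurable RC]])
  also have "\<dots> \<le> (\<integral>\<^sup>+\<mu>. ennreal (max 0 N) \<partial>\<nu>)"
  proof (rule nn_integral_mono)
    fix \<mu> assume "\<mu> \<in> space \<nu>"
    then have \<mu>: "\<mu> \<in> N11" by (simp add: anchored_space[OF \<nu>])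
    have m: "mark exceed 0 \<mu> \<le> 1"
      by (rule mark_le_1[OF \<mu> exceed_measurable]) (simp add: exceed_def indicator_def)
    show "(\<integral>\<^sup>+x. mark exceed 0 \<mu> * exceed (snd x) * indicator (ball 0 R \<times> C) (fst x, \<mu>) \<partial>\<mu>) \<le> ennreal (max 0 N)"
    proof (cases "\<mu> \<in> C")
      case True
      have W: "window R 1 \<in> sets \<mu>" by (simp add: N11_sets[OF \<mu>] window_sets)
      have "(\<integral>\<^sup>+x. mark exceed 0 \<mu> * exceed (snd x) * indicator (ball 0 R \<times> C) (fst x, \<mu>) \<partial>\<mu>) \<le>
          (\<integral>\<^sup>+x. indicator (window R 1) x \<partial>\<mu>)"
        using m by (intro nn_integral_mono) (auto simp: indicator_def exceed_def window_def)
      also have "\<dots> = ennreal (mass R 1 \<mu>)"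
        using W N11_window_finite[OF \<mu>, of 1 R] by (simp add: mass_def emeasure_eq_ennreal_measure)
      also have "\<dots> \<le> ennreal (max 0 N)" using bound[OF True] by (intro ennreal_leI) simp
      finally show ?thesis .
    qed simp
  qed
  also have "\<dots> < \<infinity>" by (simp add: emeasure_space_1)
  finally show ?thesis .
qed

lemma transport_eq:
  fixes \<nu> :: "('d::finite) point measure measure"
  assumes W: "weakly_converges vague_topology \<nu>s \<nu> F" and F: "F \<noteq> bot"
    and anch: "eventually (\<lambda>i. anchored (\<nu>s i)) F" "anchored \<nu>"
    and ex: "\<And>b. b \<in> borel_measurable borel \<Longrightarrow> (\<And>s. s \<le> 1 \<Longrightarrow> b s = 0) \<Longrightarrow> eventually (\<lambda>i. exchange b (\<nu>s i)) F"
  shows "transport stay \<nu> = transport move \<nu>"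
proof -
  let ?E = "{G \<times> C | G C. G \<in> {G :: (real ^ 'd) set. open G \<and> bounded G} \<and> C \<in> Collect (approximable :: 'd point measure set \<Rightarrow> bool)}"
  have sets: "sets (transport \<tau> \<nu>) = sigma_sets (UNIV \<times> N11) ?E" for \<tau>
    by (simp add: transport_def sets_pair_N11_rectangles)
  have emeasure: "emeasure (transport \<tau> \<nu>) (G \<times> C) = (\<integral>\<^sup>+q. indicator (G \<times> C) q \<partial>transport \<tau> \<nu>)"
    if "open G" "approximable C" for G C \<tau>
    using that approximable_sets[of C] by (intro nn_integral_indicator[symmetric]) (simp add: transport_def)
  \<comment> \<open>A plateau function is chosen simultaneously for all radii, so that the events
    \<open>D R N\<close> below form a well-defined family.\<close>
  have "\<exists>g :: real \<Rightarrow> 'd point \<Rightarrow> real. \<forall>R. local_fun (g R) \<and> (\<forall>\<mu>\<in>N11. mass R 1 \<mu> \<le> (\<integral>x. g R x \<partial>\<mu>)) \<and>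
      (\<forall>t t' s. \<bar>g R (t, s) - g R (t', s)\<bar> \<le> 1 * norm (t - t'))"
  proof (rule choice, rule allI)
    fix R
    obtain g :: "'d point \<Rightarrow> real" where "local_fun g" "\<And>\<mu>. \<mu> \<in> N11 \<Longrightarrow> mass R 1 \<mu> \<le> (\<integral>x. g x \<partial>\<mu>)"
      "\<And>t t' s. \<bar>g (t, s) - g (t', s)\<bar> \<le> norm (t - t')"
      using plateau[OF zero_less_one, of R] by metis
    then show "\<exists>g :: 'd point \<Rightarrow> real. local_fun g \<and> (\<forall>\<mu>\<in>N11. mass R 1 \<mu> \<le> (\<integral>x. g x \<partial>\<mu>)) \<and>
      (\<forall>t t' s. \<bar>g (t, s) - g (t', s)\<bar> \<le> 1 * norm (t - t'))"
      unfolding mult_1 by (intro exI[of _ g] conjI ballI allI)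
  qed
  then obtain g :: "real \<Rightarrow> 'd point \<Rightarrow> real" where
    g_all: "\<forall>R. local_fun (g R) \<and> (\<forall>\<mu>\<in>N11. mass R 1 \<mu> \<le> (\<integral>x. g R x \<partial>\<mu>)) \<and>
      (\<forall>t t' s. \<bar>g R (t, s) - g R (t', s)\<bar> \<le> 1 * norm (t - t'))"
    by (rule exE)
  have g: "local_fun (g R)" "\<mu> \<in> N11 \<Longrightarrow> mass R 1 \<mu> \<le> (\<integral>x. g R x \<partial>\<mu>)"
    "\<bar>g R (t, s) - g R (t', s)\<bar> \<le> 1 * norm (t - t')" for R \<mu> t t' s
    using spec[OF g_all, of R] by simp_all
  \<comment> \<open>A bound on \<open>mass\<close> is not evidently an approximable event, but a
    bound on its continuous majorant is, and it implies the former.\<close>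
  define D where "D R N = {\<mu> \<in> N11. 0 < - 1 * ((\<integral>x. g R x \<partial>\<mu>) - N)}" for R N
  have D: "approximable (D R N)" for R N
    unfolding D_def by (rule approximable_ramp_integral(2)[OF g(1) _ g(3)]) simp_all
  have D_mass: "mass R 1 \<mu> \<le> N" if "\<mu> \<in> D R N" for R N \<mu>
    using that g(2)[of \<mu> R] by (simp add: D_def)
  \<comment> \<open>A countable cover by generators of finite measure: every position lies in some
    ball, and for fixed radius every configuration has a finite integral of the majorant.\<close>
  let ?A = "range (\<lambda>(m::nat, n::nat). ball (0 :: real ^ 'd) (real m) \<times> D (real m) (real n))"
  show ?thesis
  proof (rule measure_eqI_generator_eq_countable[where \<Omega>="UNIV \<times> N11" and E="?E" and A="?A"])
    show "Int_stable ?E"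
    proof (rule Int_stableI)
      fix A B assume "A \<in> ?E" "B \<in> ?E"
      then obtain G C G' C' where "A = G \<times> C" "open G" "bounded G" "approximable C"
        "B = G' \<times> C'" "open G'" "bounded G'" "approximable C'" by auto
      then have "A \<inter> B = (G \<inter> G') \<times> (C \<inter> C')" "open (G \<inter> G')" "bounded (G \<inter> G')" "approximable (C \<inter> C')"
        by (auto intro: approximable_Int bounded_Int)
      then show "A \<inter> B \<in> ?E" by blast
    qed
    show "?E \<subseteq> Pow (UNIV \<times> N11)" by (auto simp: approximable_def)
    show "emeasure (transport stay \<nu>) A = emeasure (transport move \<nu>) A" if A: "A \<in> ?E" for A
    proof -
      obtain G C where GC: "A = G \<times> C" "open G" "bounded G" "approximable C" using A by auto
      obtain R where R: "G \<subseteq> ball 0 R" using bounded_subset_ballD[OF GC(3)] by blast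
      have "(\<integral>\<^sup>+q. indicator (G \<times> C) q \<partial>transport stay \<nu>) = (\<integral>\<^sup>+q. indicator (G \<times> C) q \<partial>transport move \<nu>)"
        by (rule transport_eq_rectangle[OF W F anch _ GC(2) R GC(4)]) (rule ex)
      then show ?thesis by (simp only: GC(1) emeasure[OF GC(2,4)])
    qed
    show "?A \<subseteq> ?E"
    proof
      fix A assume "A \<in> ?A"
      then obtain m n :: nat where A: "A = ball 0 (real m) \<times> D (real m) (real n)" by auto
      show "A \<in> ?E"
        unfolding A
        by (intro CollectI exI[of _ "ball 0 (real m)"] exI[of _ "D (real m) (real n)"] conjI refl open_ball bounded_ball D)
    qed
    show "\<Union> ?A = UNIV \<times> N11"
    proof
      show "\<Union> ?A \<subseteq> UNIV \<times> N11" by (auto simp: D_def)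
      show "UNIV \<times> N11 \<subseteq> \<Union> ?A"
      proof
        fix p :: "(real ^ 'd) \<times> 'd point measure" assume "p \<in> UNIV \<times> N11"
        then obtain t \<mu> where p: "p = (t, \<mu>)" "\<mu> \<in> N11" by auto
        obtain m :: nat where m: "norm t < real m" using reals_Archimedean2 by blast
        obtain n :: nat where n: "(\<integral>x. g (real m) x \<partial>\<mu>) < real n" using reals_Archimedean2 by blast
        have "p \<in> ball 0 (real m) \<times> D (real m) (real n)" using p m n by (simp add: D_def)
        then show "p \<in> \<Union> ?A" by (intro UnionI[OF rangeI[of _ "(m, n)"]]) simp
      qed
    qed
    fix A assume "A \<in> ?A"
    then obtain m n :: nat where A: "A = ball 0 (real m) \<times> D (real m) (real n)" by auto
    have "emeasure (transport stay \<nu>) A < \<infinity>"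
      unfolding A emeasure[OF open_ball D] by (rule transport_stay_finite[OF anch(2) D D_mass])
    then show "emeasure (transport stay \<nu>) A \<noteq> \<infinity>" by simp
  qed (auto simp: sets)
qed

section \<open>The identity for the tail configuration\<close>

lemma anchored_mark_exceed:
  assumes "anchored \<nu>" shows "AE \<mu> in \<nu>. mark exceed 0 \<mu> = 1"
proof -
  have "AE \<mu> in \<nu>. emeasure \<mu> ({0} \<times> {1<..}) = 1" using assms by (simp add: anchored_def)
  then show ?thesis using AE_space[of \<nu>]
  proof eventually_elim
    case (elim \<mu>)
    then have \<mu>: "\<mu> \<in> N11" by (simp add: anchored_space[OF assms])
    have "emeasure \<mu> ({0} \<times> {1<..}) \<noteq> 0" using elim(1) by simp
    from N11_ex_atom[OF \<mu> this half_column_sets] obtain s where s: "(0, s) \<in> atoms \<mu>" "1 < s" by auto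
    show ?case using mark_atom[OF \<mu> s(1) exceed_measurable] s(2) by (simp add: exceed_def)
  qed
qed

lemma nn_integral_transport_anchored:
  assumes \<nu>: "anchored \<nu>" and \<tau>: "\<tau> \<in> N11_space \<Otimes>\<^sub>M borel_EE \<rightarrow>\<^sub>M borel \<Otimes>\<^sub>M N11_space"
    and f: "f \<in> borel_measurable (borel \<Otimes>\<^sub>M N11_space)"
  shows "(\<integral>\<^sup>+q. f q \<partial>transport \<tau> \<nu>) = (\<integral>\<^sup>+\<mu>. \<integral>\<^sup>+x. exceed (snd x) * f (\<tau> (\<mu>, x)) \<partial>\<mu> \<partial>\<nu>)"
proof -
  have s: "sets \<nu> = sets N11_space" using \<nu> by (simp add: anchored_def)
  have m: "(\<lambda>p. mark exceed 0 (fst p) * exceed (snd (snd p)) * f (\<tau> p)) \<in> borel_measurable (N11_space \<Otimes>\<^sub>M borel_EE)"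
    by (rule borel_measurable_times_ennreal[OF exceed_weight_measurable measurable_compose[OF \<tau> f]])
  have "(\<integral>\<^sup>+q. f q \<partial>transport \<tau> \<nu>) =
      (\<integral>\<^sup>+\<mu>. \<integral>\<^sup>+x. mark exceed 0 \<mu> * exceed (snd x) * f (\<tau> (\<mu>, x)) \<partial>\<mu> \<partial>\<nu>)"
    by (simp add: nn_integral_transport[OF \<tau> f] nn_integral_campbell[OF s m])
  also have "\<dots> = (\<integral>\<^sup>+\<mu>. \<integral>\<^sup>+x. exceed (snd x) * f (\<tau> (\<mu>, x)) \<partial>\<mu> \<partial>\<nu>)"
  proof (rule nn_integral_cong_AE)
    show "AE \<mu> in \<nu>. (\<integral>\<^sup>+x. mark exceed 0 \<mu> * exceed (snd x) * f (\<tau> (\<mu>, x)) \<partial>\<mu>) =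
        (\<integral>\<^sup>+x. exceed (snd x) * f (\<tau> (\<mu>, x)) \<partial>\<mu>)"
      using anchored_mark_exceed[OF \<nu>] by eventually_elim simp
  qed
  finally show ?thesis .
qed

theorem theorem3p5:
  fixes M :: "'w measure" and X :: "'w \<Rightarrow> ('d::finite) point measure" and lam :: real
    and P :: "'v measure" and Xt :: "'v \<Rightarrow> 'd point measure"
    and r :: "real \<Rightarrow> real" and \<beta> :: real
    and Q :: "'q measure" and Y :: "'q \<Rightarrow> 'd point measure"
    and h :: "(real ^ 'd) \<times> 'd point measure \<Rightarrow> real"
  assumes "marked_point_process M X" and "stationary M X"
    and "0 < lam" and "has_intensity M X lam"
    and "palm_version M X lam P Xt"
    and "regularly_varying r \<beta>"
    and "tail_configuration P Xt r Q Y"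
    and "h \<in> borel_measurable (borel \<Otimes>\<^sub>M N11_space)"
    and "\<And>t \<mu>. \<mu> \<in> N11 \<Longrightarrow> 0 \<le> h (t, \<mu>)"
  shows "(\<integral>\<^sup>+\<omega>. atom_sum (Y \<omega>) (\<lambda>(t, s). ennreal (h (t, Y \<omega>)) * indicator {1<..} s) \<partial>Q) =
         (\<integral>\<^sup>+\<omega>. atom_sum (Y \<omega>) (\<lambda>(t, s). ennreal (h (- t, shift_pts t (Y \<omega>))) * indicator {1<..} s) \<partial>Q)"
proof -
  define \<nu> where "\<nu> = distr Q N11_space Y"
  have r: "0 < r u" if "0 < u" for u using assms(6) that by (simp add: regularly_varying_def)
  note tail = tail_law_eventually[OF assms(5,1,3) r assms(7), folded \<nu>_def]
  have eq: "transport stay \<nu> = transport move \<nu>"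
    by (rule transport_eq[OF tail(1) _ tail(3,2,4)]) simp_all
  have Y: "Y \<in> Q \<rightarrow>\<^sub>M N11_space" using assms(7) by (simp add: tail_configuration_def)
  let ?f = "\<lambda>q. ennreal (h q)"
  have f: "?f \<in> borel_measurable (borel \<Otimes>\<^sub>M N11_space)" using assms(8) by measurable
  \<comment> \<open>One computation for both sides: the sum over the points of Y is an integral
    against the measure Y, the law of Y replaces Q, and the anchored weight at the origin is 1
    almost surely.\<close>
  have sum: "(\<integral>\<^sup>+\<omega>. atom_sum (Y \<omega>) (\<lambda>(t, s). ?f (\<tau> (Y \<omega>, (t, s))) * indicator {1<..} s) \<partial>Q) = (\<integral>\<^sup>+q. ?f q \<partial>transport \<tau> \<nu>)"
    if \<tau>: "\<tau> \<in> N11_space \<Otimes>\<^sub>M borel_EE \<rightarrow>\<^sub>M borel \<Otimes>\<^sub>M N11_space" for \<tau>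
  proof -
    have m: "(\<lambda>p. exceed (snd (snd p)) * ?f (\<tau> p)) \<in> borel_measurable (N11_space \<Otimes>\<^sub>M borel_EE)"
      by (intro borel_measurable_times_ennreal measurable_compose[OF \<tau> f]
          measurable_compose[OF measurable_snd measurable_compose[OF snd_measurable_EE exceed_measurable]])
    have "atom_sum (Y \<omega>) (\<lambda>(t, s). ?f (\<tau> (Y \<omega>, (t, s))) * indicator {1<..} s) =
        (\<integral>\<^sup>+x. exceed (snd x) * ?f (\<tau> (Y \<omega>, x)) \<partial>Y \<omega>)" if "\<omega> \<in> space Q" for \<omega>
    proof -
      have N: "Y \<omega> \<in> N11" using measurable_space[OF Y that] by simp
      have "(\<lambda>(t, s). ?f (\<tau> (Y \<omega>, (t, s))) * indicator {1<..} s) = (\<lambda>x. exceed (snd x) * ?f (\<tau> (Y \<omega>, x)))"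
        by (auto simp: exceed_def mult.commute)
      then show ?thesis using N11_atom_sum[OF N] measurable_Pair2[OF m, of "Y \<omega>"] N by simp
    qed
    then have "(\<integral>\<^sup>+\<omega>. atom_sum (Y \<omega>) (\<lambda>(t, s). ?f (\<tau> (Y \<omega>, (t, s))) * indicator {1<..} s) \<partial>Q) =
        (\<integral>\<^sup>+\<omega>. \<integral>\<^sup>+x. exceed (snd x) * ?f (\<tau> (Y \<omega>, x)) \<partial>Y \<omega> \<partial>Q)"
      by (intro nn_integral_cong)
    also have "\<dots> = (\<integral>\<^sup>+\<mu>. \<integral>\<^sup>+x. exceed (snd x) * ?f (\<tau> (\<mu>, x)) \<partial>\<mu> \<partial>\<nu>)"
      unfolding \<nu>_def using N11_sum_measurable[OF m refl]
      by (intro nn_integral_distr[OF Y, symmetric]) simp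
    also have "\<dots> = (\<integral>\<^sup>+q. ?f q \<partial>transport \<tau> \<nu>)"
      by (rule nn_integral_transport_anchored[OF tail(2) \<tau> f, symmetric])
    finally show ?thesis .
  qed
  show ?thesis using sum[OF stay_measurable] sum[OF move_measurable] by (simp add: eq)
qed

end
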